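(* Let $k$ be an algebraically closed field of characteristic $0$, let $\psi:C\to E$ be a covering of even degree $n$ from a genus $2$ curve $C$ to an elliptic curve $E$ over $k$, and let $\phi:\mathbb P^1\to\mathbb P^1$ be the covering induced by $\psi$. In the generic case ($\psi$ has two ramification points of index $2$ lying in different fibers) the ramification structure of $\phi$ is one of the following three: I: $\left((2)^{\frac{n-2}2},(2)^{\frac{n-2}2},(2)^{\frac{n-2}2},(2)^{\frac n2},(2)\right)$ II: $\left((2)^{\frac{n-4}2},(2)^{\frac{n-2}2},(2)^{\frac n2},(2)^{\frac n2},(2)\right)$ III: $\left((2)^{\frac{n-6}2},(2)^{\frac n2},(2)^{\frac n2},(2)^{\frac n2},(2)\right)$ Each of these has the following degenerations (two of the branch points collapse to one), which are the possible ramification structures of $\phi$ when $\psi$ is not generic. Degenerations of I: (1) $\left((2)^{\frac n2},(2)^{\frac{n-2}2},(2)^{\frac{n-2}2},(2)^{\frac n2}\right)$; (2) $\left((2)^{\frac{n-2}2},(2)^{\frac{n-2}2},(4)(2)^{\frac{n-6}2},(2)^{\frac n2}\right)$; (3) $\left((2)^{\frac{n-2}2},(2)^{\frac{n-2}2},(2)^{\frac{n-2}2},(4)(2)^{\frac{n-4}2}\right)$; (4) $\left((3)(2)^{\frac{n-4}2},(2)^{\frac{n-2}2},(2)^{\frac{n-2}2},(2)^{\frac n2}\right)$. Degenerations of II: (1) $\left((2)^{\frac{n-2}2},(2)^{\frac{n-2}2},(2)^{\frac n2},(2)^{\frac n2}\right)$; (2) $\left((2)^{\frac{n-4}2},(2)^{\frac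 n2},(2)^{\frac n2},(2)^{\frac n2}\right)$; (3) $\left((4)(2)^{\frac{n-8}2},(2)^{\frac{n-2}2},(2)^{\frac n2},(2)^{\frac n2}\right)$; (4) $\left((2)^{\frac{n-4}2},(4)(2)^{\frac{n-6}2},(2)^{\frac n2},(2)^{\frac n2}\right)$; (5) $\left((2)^{\frac{n-4}2},(2)^{\frac{n-2}2},(4)(2)^{\frac{n-4}2},(2)^{\frac n2}\right)$; (6) $\left((3)(2)^{\frac{n-6}2},(2)^{\frac{n-2}2},(2)^{\frac n2},(2)^{\frac n2}\right)$; (7) $\left((2)^{\frac{n-4}2},(3)(2)^{\frac{n-4}2},(2)^{\frac n2},(2)^{\frac n2}\right)$. Degenerations of III: (1) $\left((2)^{\frac{n-4}2},(2)^{\frac n2},(2)^{\frac n2},(2)^{\frac n2}\right)$; (2) $\left((2)^{\frac{n-6}2},(4)(2)^{\frac{n-4}2},(2)^{\frac n2},(2)^{\frac n2}\right)$; (3) $\left((2)^{\frac n2},(2)^{\frac n2},(2)^{\frac n2},(4)(2)^{\frac{n-10}2}\right)$; (4) $\left((3)(2)^{\frac{n-8}2},(2)^{\frac n2},(2)^{\frac n2},(2)^{\frac n2}\right)$.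
   Context: Let $w$ be the hyperelliptic involution of $C$; the origin of $E$ is chosen so that $\psi\circ w=-\psi$. Let $\pi_C:C\to\mathbb P^1=C/\langle w\rangle$ and $\pi_E:E\to\mathbb P^1=E/\langle -1\rangle$ be the natural degree 2 projections; the induced covering $\phi$ is the degree $n$ map with $\phi\circ\pi_C=\pi_E\circ\psi$. By Riemann–Hurwitz, $\psi$ is ramified either at exactly two points, each of index 2 (in different fibers: generic; or in the same fiber), or at exactly one point, of index 3. Notation for ramification structures: entries separated by commas describe the fibers over the different branch points of $\phi$ (the order of entries is immaterial; entries correspond to the four points of $\pi_E(E[2])$, together with one further point in the five-entry case); $(m)^r$ means that the fiber contains $r$ points of ramification index $m$, and $(m)=(m)^1$; unramified points in a fiber are not written. An entry $(2)^0$ with nothing else denotes an unramified fiber; a case in which a negative exponent appears does not occur for that $n$. *)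

theory Defs
  imports
    "HOL-Computational_Algebra.Computational_Algebra"
    "HOL-Library.Multiset"
begin

section \<open>Curves, points and coverings\<close>

text \<open>
  A smooth projective curve over an algebraically closed field \<open>k\<close> is given by its function field,
  i.e. a field \<open>'a\<close> together with the inclusion \<open>\<iota>\<close> of the constants, which is a finite extension of
  the rational function field \<open>k(X)\<close>.  Its points are the discrete valuations of \<open>'a\<close> that are
  trivial on \<open>k\<close>, normalised to have value group \<open>\<int>\<close>.  A covering \<open>X \<rightarrow> Y\<close> is given, contravariantly,
  by the comorphism \<open>k(Y) \<rightarrow> k(X)\<close>.
\<close>

definition field_hom :: "('a::field \<Rightarrow> 'b::field) \<Rightarrow> bool" where
  "field_hom h \<longleftrightarrow> h 1 = 1 \<and> (\<forall>x y. h (x + y) = h x + h y) \<and> (\<forall>x y. h (x * y) = h x * h y)"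

definition covering :: "('k::field \<Rightarrow> 'b::field) \<Rightarrow> ('k \<Rightarrow> 'a::field) \<Rightarrow> ('b \<Rightarrow> 'a) \<Rightarrow> bool" where
  "covering \<kappa> \<iota> h \<longleftrightarrow> field_hom h \<and> (\<forall>c. h (\<kappa> c) = \<iota> c)"

text \<open>This is \<open>0\<close> if the field extension is infinite.\<close>

definition cover_degree :: "('b::field \<Rightarrow> 'a::field) \<Rightarrow> nat" where
  "cover_degree h = vector_space.dim (\<lambda>b a. h b * a) UNIV"

text \<open>The projective line is the curve with function field \<open>'k poly fract\<close>.\<close>

definition const_P1 :: "'k::field \<Rightarrow> 'k poly fract" where
  "const_P1 c = Fract [:c:] 1"

definition function_field :: "('k::field \<Rightarrow> 'a::field) \<Rightarrow> bool" where
  "function_field \<iota> \<longleftrightarrow> field_hom \<iota> \<and> (\<exists>h. covering const_P1 \<iota> h \<and> cover_degree h > 0)"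

text \<open>The value of a valuation at \<open>0\<close>, properly \<open>\<infinity>\<close>, is set to the dummy value \<open>0\<close>.\<close>

definition point :: "('k::field \<Rightarrow> 'a::field) \<Rightarrow> ('a \<Rightarrow> int) \<Rightarrow> bool" where
  "point \<iota> v \<longleftrightarrow>
     v 0 = 0 \<and>
     (\<forall>x y. x \<noteq> 0 \<and> y \<noteq> 0 \<longrightarrow> v (x * y) = v x + v y) \<and>
     (\<forall>x y. x \<noteq> 0 \<and> y \<noteq> 0 \<and> x + y \<noteq> 0 \<longrightarrow> min (v x) (v y) \<le> v (x + y)) \<and>
     (\<forall>c. v (\<iota> c) = 0) \<and>
     (\<exists>x. v x = 1)"

text \<open>
  For a covering with comorphism \<open>h\<close> and a point \<open>v\<close> upstairs, \<open>v \<circ> h = e * u\<close> where \<open>e\<close> is the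
  ramification index and \<open>u\<close> is the image point; \<open>e\<close> is the positive generator of the value group
  of \<open>v \<circ> h\<close>.
\<close>

definition ram_index :: "('b::field \<Rightarrow> 'a::field) \<Rightarrow> ('a \<Rightarrow> int) \<Rightarrow> nat" where
  "ram_index h v = (LEAST e. 0 < e \<and> (\<exists>z. v (h z) = int e))"

definition image_point :: "('b::field \<Rightarrow> 'a::field) \<Rightarrow> ('a \<Rightarrow> int) \<Rightarrow> ('b \<Rightarrow> int)" where
  "image_point h v = (\<lambda>z. v (h z) div int (ram_index h v))"

definition fiber :: "('k::field \<Rightarrow> 'a::field) \<Rightarrow> ('b::field \<Rightarrow> 'a) \<Rightarrow> ('b \<Rightarrow> int) \<Rightarrow> ('a \<Rightarrow> int) set" where
  "fiber \<iota> h u = {v. point \<iota> v \<and> image_point h v = u}"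

definition ramification_points :: "('k::field \<Rightarrow> 'a::field) \<Rightarrow> ('b::field \<Rightarrow> 'a) \<Rightarrow> ('a \<Rightarrow> int) set" where
  "ramification_points \<iota> h = {v. point \<iota> v \<and> ram_index h v > 1}"

definition branch_points :: "('k::field \<Rightarrow> 'a::field) \<Rightarrow> ('b::field \<Rightarrow> 'a) \<Rightarrow> ('b \<Rightarrow> int) set" where
  "branch_points \<iota> h = image_point h ` ramification_points \<iota> h"


section \<open>Divisors and genus\<close>

definition divisor :: "('k::field \<Rightarrow> 'a::field) \<Rightarrow> (('a \<Rightarrow> int) \<Rightarrow> int) \<Rightarrow> bool" where
  "divisor \<iota> D \<longleftrightarrow> finite {v. D v \<noteq> 0} \<and> (\<forall>v. D v \<noteq> 0 \<longrightarrow> point \<iota> v)"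

text \<open>All points have degree \<open>1\<close> when \<open>k\<close> is algebraically closed.\<close>

definition div_degree :: "(('a \<Rightarrow> int) \<Rightarrow> int) \<Rightarrow> int" where
  "div_degree D = (\<Sum>v | D v \<noteq> 0. D v)"

definition riemann_roch_space :: "('k::field \<Rightarrow> 'a::field) \<Rightarrow> (('a \<Rightarrow> int) \<Rightarrow> int) \<Rightarrow> 'a set" where
  "riemann_roch_space \<iota> D = {z. z = 0 \<or> (\<forall>v. point \<iota> v \<longrightarrow> v z \<ge> - D v)}"

definition ell :: "('k::field \<Rightarrow> 'a::field) \<Rightarrow> (('a \<Rightarrow> int) \<Rightarrow> int) \<Rightarrow> nat" where
  "ell \<iota> D = vector_space.dim (\<lambda>c z. \<iota> c * z) (riemann_roch_space \<iota> D)"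

text \<open>The genus is the maximum of \<open>deg D - ell D + 1\<close> over all divisors \<open>D\<close>.\<close>

definition has_genus :: "('k::field \<Rightarrow> 'a::field) \<Rightarrow> int \<Rightarrow> bool" where
  "has_genus \<iota> g \<longleftrightarrow>
     (\<forall>D. divisor \<iota> D \<longrightarrow> div_degree D - int (ell \<iota> D) + 1 \<le> g) \<and>
     (\<exists>D. divisor \<iota> D \<and> div_degree D - int (ell \<iota> D) + 1 = g)"

definition pt_div :: "('a \<Rightarrow> int) \<Rightarrow> ('a \<Rightarrow> int) \<Rightarrow> int" where
  "pt_div P = (\<lambda>v. if v = P then 1 else 0)"

definition lin_equiv :: "('k::field \<Rightarrow> 'a::field) \<Rightarrow> (('a \<Rightarrow> int) \<Rightarrow> int) \<Rightarrow> (('a \<Rightarrow> int) \<Rightarrow> int) \<Rightarrow> bool" where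
  "lin_equiv \<iota> D D' \<longleftrightarrow> (\<exists>z. z \<noteq> 0 \<and> (\<forall>v. point \<iota> v \<longrightarrow> D v - D' v = v z))"


section \<open>Genus 2 curves and elliptic curves\<close>

definition genus2_curve :: "('k::field \<Rightarrow> 'a::field) \<Rightarrow> bool" where
  "genus2_curve \<iota> \<longleftrightarrow> function_field \<iota> \<and> has_genus \<iota> 2"

text \<open>\<open>\<O>\<close> is the origin.\<close>

definition elliptic_curve :: "('k::field \<Rightarrow> 'a::field) \<Rightarrow> ('a \<Rightarrow> int) \<Rightarrow> bool" where
  "elliptic_curve \<iota> \<O> \<longleftrightarrow> function_field \<iota> \<and> has_genus \<iota> 1 \<and> point \<iota> \<O>"

text \<open>
  In the group law with origin \<open>\<O>\<close>, points \<open>P\<close> and \<open>Q\<close> are inverse to each other iff the divisors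
  \<open>P + Q\<close> and \<open>2 \<O>\<close> are linearly equivalent.
\<close>

definition inverse_points :: "('k::field \<Rightarrow> 'a::field) \<Rightarrow> ('a \<Rightarrow> int) \<Rightarrow> ('a \<Rightarrow> int) \<Rightarrow> ('a \<Rightarrow> int) \<Rightarrow> bool" where
  "inverse_points \<iota> \<O> P Q \<longleftrightarrow> lin_equiv \<iota> (\<lambda>v. pt_div P v + pt_div Q v) (\<lambda>v. 2 * pt_div \<O> v)"

definition two_torsion :: "('k::field \<Rightarrow> 'a::field) \<Rightarrow> ('a \<Rightarrow> int) \<Rightarrow> ('a \<Rightarrow> int) set" where
  "two_torsion \<iota> \<O> = {P. point \<iota> P \<and> inverse_points \<iota> \<O> P P}"

text \<open>\<open>\<nu>\<close> is the comorphism of the negation map \<open>-1\<close> of the elliptic curve.\<close>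

definition negation :: "('k::field \<Rightarrow> 'a::field) \<Rightarrow> ('a \<Rightarrow> int) \<Rightarrow> ('a \<Rightarrow> 'a) \<Rightarrow> bool" where
  "negation \<iota> \<O> \<nu> \<longleftrightarrow> covering \<iota> \<iota> \<nu> \<and>
     (\<forall>P. point \<iota> P \<longrightarrow> inverse_points \<iota> \<O> P (image_point \<nu> P))"

text \<open>
  \<open>h\<close> is the comorphism of a quotient map onto the projective line, of degree \<open>2\<close>, by the
  automorphism with comorphism \<open>s\<close>.
\<close>

definition P1_quotient :: "('k::field \<Rightarrow> 'a::field) \<Rightarrow> ('a \<Rightarrow> 'a) \<Rightarrow> ('k poly fract \<Rightarrow> 'a) \<Rightarrow> bool" where
  "P1_quotient \<iota> s h \<longleftrightarrow> covering const_P1 \<iota> h \<and> range h = {z. s z = z} \<and> cover_degree h = 2"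

definition hyperelliptic_involution :: "('k::field \<Rightarrow> 'a::field) \<Rightarrow> ('a \<Rightarrow> 'a) \<Rightarrow> bool" where
  "hyperelliptic_involution \<iota> w \<longleftrightarrow>
     covering \<iota> \<iota> w \<and> w \<circ> w = id \<and> w \<noteq> id \<and> (\<exists>h. P1_quotient \<iota> w h)"

definition generic_covering :: "('k::field \<Rightarrow> 'a::field) \<Rightarrow> ('b::field \<Rightarrow> 'a) \<Rightarrow> bool" where
  "generic_covering \<iota> h \<longleftrightarrow>
     (\<exists>P Q. P \<noteq> Q \<and> ramification_points \<iota> h = {P, Q} \<and>
        ram_index h P = 2 \<and> ram_index h Q = 2 \<and> image_point h P \<noteq> image_point h Q)"


section \<open>Ramification structures\<close>

text \<open>
  A fiber is described by the multiset of its ramification indices greater than \<open>1\<close>.  A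
  ramification structure consists of the multiset of the fiber types over a distinguished set \<open>T\<close>
  of points (ramified or not), and the multiset of the fiber types over the remaining branch points.
\<close>

type_synonym fiber_type = "nat multiset"
type_synonym ram_structure = "fiber_type multiset \<times> fiber_type multiset"

definition fiber_type_of :: "('k::field \<Rightarrow> 'a::field) \<Rightarrow> ('b::field \<Rightarrow> 'a) \<Rightarrow> ('b \<Rightarrow> int) \<Rightarrow> fiber_type" where
  "fiber_type_of \<iota> h u = filter_mset (\<lambda>e. e > 1) (image_mset (ram_index h) (mset_set (fiber \<iota> h u)))"

definition ramification_structure ::
  "('k::field \<Rightarrow> 'a::field) \<Rightarrow> ('b::field \<Rightarrow> 'a) \<Rightarrow> ('b \<Rightarrow> int) set \<Rightarrow> ram_structure" where
  "ramification_structure \<iota> h T =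
     (image_mset (fiber_type_of \<iota> h) (mset_set T),
      image_mset (fiber_type_of \<iota> h) (mset_set (branch_points \<iota> h - T)))"

text \<open>
  An entry \<open>(m)\<^sup>r (m')\<^sup>s \<dots>\<close> is written as the list of the pairs of index and exponent.  Exponents
  are integers, and a structure with a negative exponent denotes nothing.
\<close>

definition entry :: "(nat \<times> int) list \<Rightarrow> fiber_type" where
  "entry xs = (\<Sum>(m, r) \<leftarrow> xs. replicate_mset (nat r) m)"

definition struct :: "(nat \<times> int) list list \<Rightarrow> (nat \<times> int) list list \<Rightarrow> ram_structure set" where
  "struct xss yss =
     (if \<forall>xs \<in> set (xss @ yss). \<forall>(m, r) \<in> set xs. r \<ge> 0
      then {(mset (map entry xss), mset (map entry yss))} else {})"

definition type_I :: "int \<Rightarrow> ram_structure set" where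
  "type_I n = struct
     [[(2, (n-2) div 2)], [(2, (n-2) div 2)], [(2, (n-2) div 2)], [(2, n div 2)]] [[(2, 1)]]"

definition type_II :: "int \<Rightarrow> ram_structure set" where
  "type_II n = struct
     [[(2, (n-4) div 2)], [(2, (n-2) div 2)], [(2, n div 2)], [(2, n div 2)]] [[(2, 1)]]"

definition type_III :: "int \<Rightarrow> ram_structure set" where
  "type_III n = struct
     [[(2, (n-6) div 2)], [(2, n div 2)], [(2, n div 2)], [(2, n div 2)]] [[(2, 1)]]"

definition degenerate_I :: "int \<Rightarrow> ram_structure set" where
  "degenerate_I n =
     struct [[(2, n div 2)], [(2, (n-2) div 2)], [(2, (n-2) div 2)], [(2, n div 2)]] [] \<union>
     struct [[(2, (n-2) div 2)], [(2, (n-2) div 2)], [(4, 1), (2, (n-6) div 2)], [(2, n div 2)]] [] \<union>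
     struct [[(2, (n-2) div 2)], [(2, (n-2) div 2)], [(2, (n-2) div 2)], [(4, 1), (2, (n-4) div 2)]] [] \<union>
     struct [[(3, 1), (2, (n-4) div 2)], [(2, (n-2) div 2)], [(2, (n-2) div 2)], [(2, n div 2)]] []"

definition degenerate_II :: "int \<Rightarrow> ram_structure set" where
  "degenerate_II n =
     struct [[(2, (n-2) div 2)], [(2, (n-2) div 2)], [(2, n div 2)], [(2, n div 2)]] [] \<union>
     struct [[(2, (n-4) div 2)], [(2, n div 2)], [(2, n div 2)], [(2, n div 2)]] [] \<union>
     struct [[(4, 1), (2, (n-8) div 2)], [(2, (n-2) div 2)], [(2, n div 2)], [(2, n div 2)]] [] \<union>
     struct [[(2, (n-4) div 2)], [(4, 1), (2, (n-6) div 2)], [(2, n div 2)], [(2, n div 2)]] [] \<union>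
     struct [[(2, (n-4) div 2)], [(2, (n-2) div 2)], [(4, 1), (2, (n-4) div 2)], [(2, n div 2)]] [] \<union>
     struct [[(3, 1), (2, (n-6) div 2)], [(2, (n-2) div 2)], [(2, n div 2)], [(2, n div 2)]] [] \<union>
     struct [[(2, (n-4) div 2)], [(3, 1), (2, (n-4) div 2)], [(2, n div 2)], [(2, n div 2)]] []"

definition degenerate_III :: "int \<Rightarrow> ram_structure set" where
  "degenerate_III n =
     struct [[(2, (n-4) div 2)], [(2, n div 2)], [(2, n div 2)], [(2, n div 2)]] [] \<union>
     struct [[(2, (n-6) div 2)], [(4, 1), (2, (n-4) div 2)], [(2, n div 2)], [(2, n div 2)]] [] \<union>
     struct [[(2, n div 2)], [(2, n div 2)], [(2, n div 2)], [(4, 1), (2, (n-10) div 2)]] [] \<union>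
     struct [[(3, 1), (2, (n-8) div 2)], [(2, n div 2)], [(2, n div 2)], [(2, n div 2)]] []"

text \<open>
  Two branch points of a degree \<open>n\<close> covering of the line collapse to one: the simple branch point
  outside \<open>T\<close> (fiber type \<open>(2)\<close>) moves into a point of \<open>T\<close>, and two points of the fiber there, of
  indices \<open>a\<close> and \<open>b\<close>, are replaced by one of index \<open>a + b\<close>.  (The total of the \<open>e - 1\<close> is preserved;
  on monodromy, this is multiplication by a transposition that joins two cycles.)
\<close>

definition full_fiber :: "nat \<Rightarrow> fiber_type \<Rightarrow> nat multiset" where
  "full_fiber n F = F + replicate_mset (n - sum_mset F) 1"

definition collapses :: "nat \<Rightarrow> ram_structure \<Rightarrow> ram_structure set" where
  "collapses n S =
     {(fst S - {#F#} + {#filter_mset (\<lambda>e. e > 1) (G + {#a + b#})#}, snd S - {#{#2#}#}) | F G a b.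
        {#2#} \<in># snd S \<and> F \<in># fst S \<and> full_fiber n F = G + {#a, b#}}"

end

theory Submission
  imports Defs
begin

text \<open>
  Choose \<open>s\<close> in the function field of \<open>E\<close> with \<open>\<nu> s = - s\<close> and \<open>s\<^sup>2 = \<pi>\<^sub>E F\<close>. Then \<open>\<psi> s\<close> is anti-invariant
  under \<open>w\<close> and its square is \<open>\<pi>\<^sub>C (\<phi> F)\<close>, so both curves are double covers of the line given by
  \<open>F\<close> and \<open>\<phi> F\<close>. A double cover is branched exactly where the order of the defining function is odd,
  and at \<open>2 g + 2\<close> points. Hence \<open>F\<close> has odd order at the four points of \<open>T = \<pi>\<^sub>E(E[2])\<close>, and there
  are exactly six points of odd ramification index of \<open>\<phi>\<close> over \<open>T\<close>, the images of the Weierstrass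
  points.

  The map \<open>\<phi>\<close> is a rational function of degree \<open>n\<close>. The four fibers over \<open>T\<close> have total degree \<open>4 n\<close>
  and the sum of all \<open>e - 1\<close> is \<open>2 n - 2\<close>. With six odd points over \<open>T\<close> this leaves room for exactly
  one deviation from index \<open>1\<close> or \<open>2\<close> over \<open>T\<close> and index \<open>1\<close> elsewhere: one point of index \<open>2\<close> outside
  \<open>T\<close> (and then \<open>\<psi>\<close> is generic), or one point of index \<open>3\<close> or \<open>4\<close> over \<open>T\<close>. As \<open>n\<close> is even, each fiber
  over \<open>T\<close> contains an even number of odd points, so they are distributed as \<open>2 + 2 + 2 + 0\<close>,
  \<open>4 + 2 + 0 + 0\<close> or \<open>6 + 0 + 0 + 0\<close>; these are the types I, II and III.
\<close>

section \<open>Valuations\<close>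

text \<open>Neither curve is studied directly: whatever is needed is computed in k(X) or in
  k(X)(sqrt F). Points over a given point of the line exist because k(X) embeds into Laurent series,
  where an element of even order has a square root. The genus is a maximum over all divisors, but
  divisors pulled back from the line are cofinal, and their functions are explicit pairs of
  polynomials; this is the source of the count of branch points. That the branch points on the side
  of \<open>E\<close> are the images of the 2-torsion rests on positive genus: a function with
  divisor P - (-P) would come from the line, hence have equal orders at P and -P. The ramification
  indices of \<psi> are read from the commutative square, where e(\<psi>) e(pi_E) = e(pi_C)
  e(\<phi>) and the two quotient maps have known indices 1 or 2. Over \<open>T\<close> an even index
  of \<phi> is halved and an odd one kept, so the one deviating point of \<phi> decides whether
  \<psi> is generic. For \<phi> the Riemann-Hurwitz formula comes from the zeros of the Wronskian of
  numerator and denominator.\<close>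

definition valn :: "('k::field \<Rightarrow> 'a::field) \<Rightarrow> ('a \<Rightarrow> int) \<Rightarrow> bool" where
  "valn \<iota> v \<longleftrightarrow>
     v 0 = 0 \<and>
     (\<forall>x y. x \<noteq> 0 \<and> y \<noteq> 0 \<longrightarrow> v (x * y) = v x + v y) \<and>
     (\<forall>x y. x \<noteq> 0 \<and> y \<noteq> 0 \<and> x + y \<noteq> 0 \<longrightarrow> min (v x) (v y) \<le> v (x + y)) \<and>
     (\<forall>c. v (\<iota> c) = 0)"

text \<open>Comparing values through \<open>vge\<close> restores the convention \<open>v 0 = \<infinity>\<close>.\<close>

definition vge :: "('a::field \<Rightarrow> int) \<Rightarrow> int \<Rightarrow> 'a \<Rightarrow> bool" where
  "vge v m x \<longleftrightarrow> x = 0 \<or> m \<le> v x"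

text \<open>The condition dropped in \<open>valn\<close> is the normalisation: a point composed with
  a comorphism is still a \<open>valn\<close>, but its value group may be a proper subgroup of the
  integers, or trivial.\<close>

lemma point_iff_valn: "point \<iota> v \<longleftrightarrow> valn \<iota> v \<and> (\<exists>x. v x = 1)"
  unfolding point_def valn_def by blast

lemma point_valn: "point \<iota> v \<Longrightarrow> valn \<iota> v"
  by (simp add: point_iff_valn)

lemma valn_0: "valn \<iota> v \<Longrightarrow> v 0 = 0"
  by (simp add: valn_def)

lemma valn_const: "valn \<iota> v \<Longrightarrow> v (\<iota> c) = 0"
  by (simp add: valn_def)

lemma valn_mult: "valn \<iota> v \<Longrightarrow> x \<noteq> 0 \<Longrightarrow> y \<noteq> 0 \<Longrightarrow> v (x * y) = v x + v y"
  by (simp add: valn_def)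

lemma valn_add: "valn \<iota> v \<Longrightarrow> x \<noteq> 0 \<Longrightarrow> y \<noteq> 0 \<Longrightarrow> x + y \<noteq> 0 \<Longrightarrow> min (v x) (v y) \<le> v (x + y)"
  by (simp add: valn_def)

lemma valn_1: "valn \<iota> v \<Longrightarrow> v 1 = 0"
  using valn_mult[of \<iota> v 1 1] by simp

lemma valn_minus: "valn \<iota> v \<Longrightarrow> v (- x) = v x"
proof -
  assume v: "valn \<iota> v"
  have "v (-1) = 0" using valn_mult[OF v, of "-1" "-1"] valn_1[OF v] by simp
  then show ?thesis using valn_mult[OF v, of "-1" x] by (cases "x = 0") auto
qed

lemma valn_inverse: "valn \<iota> v \<Longrightarrow> v (inverse x) = - v x"
  using valn_mult[of \<iota> v x "inverse x"] valn_1[of \<iota> v] valn_0[of \<iota> v] by (cases "x = 0") auto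

lemma valn_divide: "valn \<iota> v \<Longrightarrow> x \<noteq> 0 \<Longrightarrow> y \<noteq> 0 \<Longrightarrow> v (x / y) = v x - v y"
  using valn_mult[of \<iota> v x "inverse y"] valn_inverse[of \<iota> v y] by (simp add: divide_inverse)

lemma valn_power: "valn \<iota> v \<Longrightarrow> v (x ^ n) = int n * v x"
proof (cases "x = 0")
  case False
  assume v: "valn \<iota> v"
  show ?thesis
    by (induction n) (use False v in \<open>auto simp: valn_1 valn_mult algebra_simps\<close>)
qed (cases n; auto simp: valn_0 valn_1)

lemma valn_power_int: "valn \<iota> v \<Longrightarrow> v (x powi n) = n * v x"
  by (auto simp: power_int_def valn_power valn_inverse)

lemma vge_0 [simp]: "vge v m 0"
  by (simp add: vge_def)

lemma vge_self [simp]: "vge v (v x) x"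
  by (simp add: vge_def)

lemma vge_mono: "vge v m x \<Longrightarrow> k \<le> m \<Longrightarrow> vge v k x"
  by (auto simp: vge_def)

lemma vge_add: "valn \<iota> v \<Longrightarrow> vge v m x \<Longrightarrow> vge v m y \<Longrightarrow> vge v m (x + y)"
  using valn_add[of \<iota> v x y] by (cases "x = 0"; cases "y = 0"; cases "x + y = 0") (auto simp: vge_def)

lemma vge_minus: "valn \<iota> v \<Longrightarrow> vge v m (- x) \<longleftrightarrow> vge v m x"
  by (auto simp: vge_def valn_minus)

lemma vge_diff: "valn \<iota> v \<Longrightarrow> vge v m x \<Longrightarrow> vge v m y \<Longrightarrow> vge v m (x - y)"
  using vge_add[of \<iota> v m x "-y"] by (simp add: vge_minus)

lemma vge_mult: "valn \<iota> v \<Longrightarrow> vge v m x \<Longrightarrow> vge v k y \<Longrightarrow> vge v (m + k) (x * y)"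
  by (cases "x = 0"; cases "y = 0") (auto simp: vge_def valn_mult)

lemma vge_const: "valn \<iota> v \<Longrightarrow> vge v 0 (\<iota> c)"
  by (auto simp: vge_def valn_const)

lemma vge_const_mult: "valn \<iota> v \<Longrightarrow> vge v m x \<Longrightarrow> vge v m (\<iota> c * x)"
  using vge_mult[of \<iota> v 0 "\<iota> c" m x] by (simp add: vge_const)

lemma vge_power: "valn \<iota> v \<Longrightarrow> vge v 0 x \<Longrightarrow> vge v 0 (x ^ n)"
  by (cases "x = 0") (auto simp: vge_def valn_power valn_1 zero_power2 power_0_left)

lemma vge_sum: "valn \<iota> v \<Longrightarrow> (\<And>i. i \<in> I \<Longrightarrow> vge v m (f i)) \<Longrightarrow> vge v m (sum f I)"
  by (induction I rule: infinite_finite_induct) (auto intro: vge_add)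

text \<open>Strict case of the ultrametric inequality: if \<open>x + y\<close> had larger value than
  \<open>x\<close>, then so would \<open>x = (x + y) - y\<close>.\<close>

lemma valn_add_dominant:
  assumes v: "valn \<iota> v" and x: "x \<noteq> 0" and y: "vge v (v x + 1) y"
  shows "x + y \<noteq> 0" "v (x + y) = v x"
proof -
  show nz: "x + y \<noteq> 0"
  proof
    assume "x + y = 0"
    then have "y = - x" by (simp add: add_eq_0_iff)
    with x y show False by (auto simp: vge_def valn_minus[OF v])
  qed
  have "vge v (v x) (x + y)" using vge_add[OF v vge_self vge_mono[OF y]] by simp
  moreover have "\<not> vge v (v x + 1) (x + y)"
    using vge_diff[OF v _ y, of "x + y"] x by (auto simp: vge_def)
  ultimately show "v (x + y) = v x" using nz by (auto simp: vge_def)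
qed

section \<open>Comorphisms and the valuations pulled back along them\<close>

lemma field_hom_0: "field_hom h \<Longrightarrow> h 0 = 0"
  unfolding field_hom_def by (metis add_cancel_right_right)

lemma field_hom_1: "field_hom h \<Longrightarrow> h 1 = 1"
  by (simp add: field_hom_def)

lemma field_hom_add: "field_hom h \<Longrightarrow> h (x + y) = h x + h y"
  by (simp add: field_hom_def)

lemma field_hom_mult: "field_hom h \<Longrightarrow> h (x * y) = h x * h y"
  by (simp add: field_hom_def)

lemma field_hom_minus: "field_hom h \<Longrightarrow> h (- x) = - h x"
  by (metis field_hom_0 field_hom_add add.right_inverse minus_unique)

lemma field_hom_diff: "field_hom h \<Longrightarrow> h (x - y) = h x - h y"
  using field_hom_add[of h x "-y"] field_hom_minus[of h y] by simp

lemma field_hom_eq_0 [simp]: "field_hom h \<Longrightarrow> h x = 0 \<longleftrightarrow> x = 0"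
  by (metis field_hom_0 field_hom_1 field_hom_mult mult_zero_left right_inverse zero_neq_one)

lemma field_hom_inverse: "field_hom h \<Longrightarrow> h (inverse x) = inverse (h x)"
proof (cases "x = 0")
  case False
  assume h: "field_hom h"
  have "h x * h (inverse x) = 1"
    using False by (simp add: field_hom_mult[OF h, symmetric] field_hom_1[OF h])
  then show ?thesis by (metis inverse_unique)
qed (simp add: field_hom_0)

lemma field_hom_divide: "field_hom h \<Longrightarrow> h (x / y) = h x / h y"
  by (simp add: divide_inverse field_hom_mult field_hom_inverse)

lemma field_hom_power: "field_hom h \<Longrightarrow> h (x ^ n) = h x ^ n"
  by (induction n) (simp_all add: field_hom_1 field_hom_mult)

lemma field_hom_sum: "field_hom h \<Longrightarrow> h (sum f I) = (\<Sum>i\<in>I. h (f i))"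
  by (induction I rule: infinite_finite_induct) (simp_all add: field_hom_0 field_hom_add)

lemma field_hom_of_nat: "field_hom h \<Longrightarrow> h (of_nat n) = of_nat n"
  by (induction n) (simp_all add: field_hom_0 field_hom_1 field_hom_add)

lemma field_hom_2: "field_hom h \<Longrightarrow> h 2 = 2"
  using field_hom_of_nat[of h 2] by simp

lemma field_hom_compose: "field_hom g \<Longrightarrow> field_hom h \<Longrightarrow> field_hom (\<lambda>x. g (h x))"
  by (simp add: field_hom_def)

lemma covering_hom: "covering \<kappa> \<iota> h \<Longrightarrow> field_hom h"
  by (simp add: covering_def)

lemma covering_const: "covering \<kappa> \<iota> h \<Longrightarrow> h (\<kappa> c) = \<iota> c"
  by (simp add: covering_def)

lemma valn_covering:
  fixes h :: "'b::field \<Rightarrow> 'a::field"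
  assumes v: "valn \<iota> v" and h: "covering \<kappa> \<iota> h"
  shows "valn \<kappa> (\<lambda>z. v (h z))"
proof -
  note hh = covering_hom[OF h]
  show ?thesis unfolding valn_def
  proof (intro conjI allI impI)
    fix x y :: 'b assume "x \<noteq> 0 \<and> y \<noteq> 0 \<and> x + y \<noteq> 0"
    then have "h x \<noteq> 0" "h y \<noteq> 0" "h x + h y \<noteq> 0"
      using hh by (auto simp: field_hom_add[OF hh, symmetric])
    from valn_add[OF v this] show "min (v (h x)) (v (h y)) \<le> v (h (x + y))"
      by (simp add: field_hom_add[OF hh])
  qed (use hh in \<open>auto simp: field_hom_0 valn_0[OF v] covering_const[OF h] valn_const[OF v]
    field_hom_mult valn_mult[OF v]\<close>)
qed

lemma valn_scale:
  fixes u :: "'a::field \<Rightarrow> int"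
  assumes "\<And>z. w z = int e * u z" "e > 0" "valn \<iota> w"
  shows "valn \<iota> u"
proof -
  have e: "int e > 0" using assms(2) by simp
  show ?thesis unfolding valn_def
  proof (intro conjI allI impI)
    show "u 0 = 0" using assms(1)[of 0] valn_0[OF assms(3)] e by simp
    fix x y :: 'a
    { assume "x \<noteq> 0 \<and> y \<noteq> 0"
      then have "w (x * y) = w x + w y" using valn_mult[OF assms(3)] by simp
      then have "int e * u (x * y) = int e * (u x + u y)"
        unfolding assms(1) by (simp add: distrib_left)
      with e show "u (x * y) = u x + u y" by simp }
    { assume "x \<noteq> 0 \<and> y \<noteq> 0 \<and> x + y \<noteq> 0"
      then have "min (w x) (w y) \<le> w (x + y)" using valn_add[OF assms(3)] by simp
      then have "int e * u x \<le> int e * u (x + y) \<or> int e * u y \<le> int e * u (x + y)"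
        unfolding assms(1) by linarith
      with e show "min (u x) (u y) \<le> u (x + y)" by auto }
  next
    fix c show "u (\<iota> c) = 0" using assms(1)[of "\<iota> c"] valn_const[OF assms(3)] e by simp
  qed
qed

text \<open>The factor \<open>e\<close> is the least positive value. Euclidean division of any value
  by \<open>e\<close> leaves a remainder that is again a value, hence zero.\<close>

lemma valn_normalize:
  assumes v: "valn \<iota> v" and nt: "v z \<noteq> 0"
  obtains e u where "e > 0" "point \<iota> u" "\<And>z. v z = int e * u z"
proof -
  let ?P = "\<lambda>e. 0 < e \<and> (\<exists>z. v z = int e)"
  have "\<exists>e. ?P e"
  proof (cases "v z > 0")
    case True
    then have "?P (nat (v z))" by (auto intro: exI[of _ z])
    then show ?thesis by blast
  next
    case False
    then have "?P (nat (- v z))" using nt by (auto simp: valn_inverse[OF v] intro!: exI[of _ "inverse z"])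
    then show ?thesis by blast
  qed
  then have Pe: "?P (Least ?P)" by (rule LeastI_ex)
  define e where "e = Least ?P"
  obtain t where e: "e > 0" and t: "v t = int e" using Pe unfolding e_def by blast
  have t0: "t \<noteq> 0" using t e by (auto simp: valn_0[OF v])
  have dv: "int e dvd v x" for x
  proof (rule ccontr)
    assume n: "\<not> int e dvd v x"
    then have x0: "x \<noteq> 0" by (auto simp: valn_0[OF v])
    define r where "r = v x mod int e"
    have "r \<noteq> 0" using n by (simp add: r_def dvd_eq_mod_eq_0)
    moreover have "0 \<le> r" "r < int e" using e by (simp_all add: r_def)
    ultimately have r: "0 < r" "r < int e" by auto
    have "v (x * t powi (- (v x div int e))) = v x + (- (v x div int e)) * int e"
      using x0 t0 valn_mult[OF v, of x "t powi (- (v x div int e))"]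
      by (simp add: valn_power_int[OF v] t)
    also have "\<dots> = r" unfolding r_def by (simp add: minus_div_mult_eq_mod[symmetric])
    finally have "v (x * t powi (- (v x div int e))) = int (nat r)" using r by simp
    then have "?P (nat r)" using r by (metis zero_less_nat_eq)
    then have "e \<le> nat r" unfolding e_def by (rule Least_le)
    with r show False by linarith
  qed
  define u where "u = (\<lambda>x. v x div int e)"
  have ve: "v x = int e * u x" for x using dv[of x] by (simp add: u_def)
  have "valn \<iota> u" by (rule valn_scale[OF ve e v])
  moreover have "u t = 1" using t e by (simp add: u_def)
  ultimately have "point \<iota> u" by (auto simp: point_iff_valn)
  from that[OF e this ve] show ?thesis .
qed

text \<open>The defining relation of image point and ramification index, free of the
  \<open>LEAST\<close> and \<open>div\<close> in \<open>ram_index\<close> and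
  \<open>image_point\<close>; the next lemma shows that it pins both down.\<close>

definition lies_over :: "('b::field \<Rightarrow> 'a::field) \<Rightarrow> ('a \<Rightarrow> int) \<Rightarrow> nat \<Rightarrow> ('b \<Rightarrow> int) \<Rightarrow> bool" where
  "lies_over h v e u \<longleftrightarrow> e > 0 \<and> (\<forall>z. v (h z) = int e * u z)"

lemma lies_over_unique:
  assumes u: "\<exists>z. u z = 1" and "lies_over h v e u"
  shows "ram_index h v = e" "image_point h v = u"
proof -
  from u obtain t where t: "u t = 1" by blast
  have e: "e > 0" and ve: "\<And>z. v (h z) = int e * u z" using assms(2) by (auto simp: lies_over_def)
  show r: "ram_index h v = e" unfolding ram_index_def
  proof (rule Least_equality)
    show "0 < e \<and> (\<exists>z. v (h z) = int e)" using e t ve by (auto intro!: exI[of _ t])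
    fix y assume "0 < y \<and> (\<exists>z. v (h z) = int y)"
    then obtain z where "0 < y" "int e * u z = int y" using ve by auto
    then have "int e dvd int y" by (metis dvd_triv_left)
    with \<open>0 < y\<close> show "e \<le> y" by (simp add: dvd_imp_le)
  qed
  show "image_point h v = u" using e by (simp add: image_point_def r ve fun_eq_iff)
qed

lemma lies_over_point_unique:
  assumes "point \<kappa> u" "lies_over h v e u"
  shows "ram_index h v = e" "image_point h v = u"
  using lies_over_unique[of u h v e] assms by (auto simp: point_iff_valn)

text \<open>A comorphism alone may pull \<open>v\<close> back to the trivial valuation, which is no
  multiple of a point; \<open>nt\<close> excludes this and has to be supplied for each
  covering.\<close>

lemma covering_lies_over:
  assumes v: "point \<iota> v" and h: "covering \<kappa> \<iota> h" and nt: "v (h z) \<noteq> 0"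
  shows "lies_over h v (ram_index h v) (image_point h v)" "point \<kappa> (image_point h v)"
proof -
  obtain e u where eu: "e > 0" "point \<kappa> u" "\<And>z. v (h z) = int e * u z"
    using valn_normalize[OF valn_covering[OF point_valn[OF v] h], of z] nt by blast
  then have l: "lies_over h v e u" by (simp add: lies_over_def)
  from lies_over_point_unique[OF eu(2) l] l eu(2)
  show "lies_over h v (ram_index h v) (image_point h v)" "point \<kappa> (image_point h v)" by auto
qed

text \<open>Proportional points are both the normalisation of the same valuation, so they agree, and
  so do the factors.\<close>

lemma point_multiple_unique:
  assumes "point \<iota> u" "point \<iota> u'" "\<And>z. int e * u z = int e' * u' z" "e > 0"
  shows "e = e'" "u = u'"
proof -
  obtain z where "u z = 1" using assms(1) by (auto simp: point_iff_valn)
  then have "e' > 0" using assms(3)[of z] assms(4) by (cases e') auto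
  then have l: "lies_over (\<lambda>z. z) (\<lambda>z. int e * u z) e' u'"
    using assms(3) by (simp add: lies_over_def)
  have l': "lies_over (\<lambda>z. z) (\<lambda>z. int e * u z) e u" using assms(4) by (simp add: lies_over_def)
  show "e = e'" "u = u'"
    using lies_over_point_unique[OF assms(2) l] lies_over_point_unique[OF assms(1) l'] by simp_all
qed

section \<open>The projective line\<close>

lemma const_P1_to_fract: "const_P1 c = to_fract [:c:]"
  by (simp add: const_P1_def to_fract_def)

lemma field_hom_const_P1: "field_hom const_P1"
  unfolding field_hom_def const_P1_to_fract
  by (simp add: to_fract_add[symmetric] to_fract_mult[symmetric] del: to_fract_add to_fract_mult)
     (simp add: one_pCons[symmetric])

text \<open>Fractions have many representations; \<open>THE\<close> ranges over all of them, and
  \<open>ord_at_Fract\<close> justifies computing with any one. The value 0 at zero matches the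
  convention in \<open>point\<close>.\<close>

definition ord_at :: "'k::field \<Rightarrow> 'k poly fract \<Rightarrow> int" where
  "ord_at c z = (THE m. \<exists>a b. b \<noteq> 0 \<and> z = Fract a b \<and> m = (if a = 0 then 0 else int (order c a) - int (order c b)))"

definition ord_inf :: "'k::field poly fract \<Rightarrow> int" where
  "ord_inf z = (THE m. \<exists>a b. b \<noteq> 0 \<and> z = Fract a b \<and> m = (if a = 0 then 0 else int (degree b) - int (degree a)))"

lemma ord_at_Fract:
  fixes a b :: "'k::field poly"
  assumes "b \<noteq> 0"
  shows "ord_at c (Fract a b) = (if a = 0 then 0 else int (order c a) - int (order c b))"
  unfolding ord_at_def
proof (rule the_equality)
  show "\<exists>a' b'. b' \<noteq> 0 \<and> Fract a b = Fract a' b' \<and>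
     (if a = 0 then 0 else int (order c a) - int (order c b)) = (if a' = 0 then 0 else int (order c a') - int (order c b'))"
    using assms by blast
next
  fix m assume "\<exists>a' b'. b' \<noteq> 0 \<and> Fract a b = Fract a' b' \<and> m = (if a' = 0 then 0 else int (order c a') - int (order c b'))"
  then obtain a' b' where ab: "b' \<noteq> 0" "Fract a b = Fract a' b'"
    and m: "m = (if a' = 0 then 0 else int (order c a') - int (order c b'))" by blast
  have eq: "a * b' = a' * b" using ab assms by (simp add: eq_fract)
  have z: "a = 0 \<longleftrightarrow> a' = 0" using eq assms ab(1) by (metis mult_eq_0_iff)
  have "order c a + order c b' = order c a' + order c b" if "a \<noteq> 0"
    using that z eq assms ab(1) order_mult[of a b' c] order_mult[of a' b c] by simp
  then show "m = (if a = 0 then 0 else int (order c a) - int (order c b))" using m z by auto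
qed

lemma ord_inf_Fract:
  fixes a b :: "'k::field poly"
  assumes "b \<noteq> 0"
  shows "ord_inf (Fract a b) = (if a = 0 then 0 else int (degree b) - int (degree a))"
  unfolding ord_inf_def
proof (rule the_equality)
  show "\<exists>a' b'. b' \<noteq> 0 \<and> Fract a b = Fract a' b' \<and>
     (if a = 0 then 0 else int (degree b) - int (degree a)) = (if a' = 0 then 0 else int (degree b') - int (degree a'))"
    using assms by blast
next
  fix m assume "\<exists>a' b'. b' \<noteq> 0 \<and> Fract a b = Fract a' b' \<and> m = (if a' = 0 then 0 else int (degree b') - int (degree a'))"
  then obtain a' b' where ab: "b' \<noteq> 0" "Fract a b = Fract a' b'"
    and m: "m = (if a' = 0 then 0 else int (degree b') - int (degree a'))" by blast
  have eq: "a * b' = a' * b" using ab assms by (simp add: eq_fract)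
  have z: "a = 0 \<longleftrightarrow> a' = 0" using eq assms ab(1) by (metis mult_eq_0_iff)
  have "degree a + degree b' = degree a' + degree b" if "a \<noteq> 0"
    using that z eq assms ab(1) degree_mult_eq[of a b'] degree_mult_eq[of a' b] by simp
  then show "m = (if a = 0 then 0 else int (degree b) - int (degree a))" using m z by auto
qed

lemma ord_at_to_fract: "p \<noteq> 0 \<Longrightarrow> ord_at c (to_fract p) = int (order c p)"
  by (simp add: to_fract_def ord_at_Fract)

lemma ord_inf_to_fract: "p \<noteq> 0 \<Longrightarrow> ord_inf (to_fract p) = - int (degree p)"
  by (simp add: to_fract_def ord_inf_Fract)

lemma order_add_ge:
  fixes a b :: "'k::field poly"
  assumes "a + b \<noteq> 0" "n \<le> order c a \<or> a = 0" "n \<le> order c b \<or> b = 0"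
  shows "n \<le> order c (a + b)"
proof -
  have "[:-c, 1:] ^ n dvd a" "[:-c, 1:] ^ n dvd b" using assms by (auto simp: order_divides)
  then have "[:-c, 1:] ^ n dvd a + b" by (rule dvd_add)
  with assms(1) show ?thesis by (simp add: order_divides)
qed

lemma Fract_nonzero: "b \<noteq> 0 \<Longrightarrow> Fract a b \<noteq> 0 \<longleftrightarrow> a \<noteq> 0"
  by (simp add: Zero_fract_def eq_fract)

lemma point_ord_at: "point const_P1 (ord_at (c::'k::field))"
  unfolding point_def
proof (intro conjI allI impI)
  show "ord_at c 0 = 0" using ord_at_Fract[of 1 c 0] by (simp add: Zero_fract_def)
  fix x y :: "'k poly fract"
  obtain a b where x: "x = Fract a b" and b: "b \<noteq> 0" by (cases x) auto
  obtain d e where y: "y = Fract d e" and e: "e \<noteq> 0" by (cases y) auto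
  {
    assume "x \<noteq> 0 \<and> y \<noteq> 0"
    then have "a \<noteq> 0" "d \<noteq> 0" using b e by (auto simp: x y Fract_nonzero)
    then show "ord_at c (x * y) = ord_at c x + ord_at c y"
      using b e by (simp add: x y ord_at_Fract order_mult)
  }
  {
    assume "x \<noteq> 0 \<and> y \<noteq> 0 \<and> x + y \<noteq> 0"
    moreover have xy: "x + y = Fract (a * e + d * b) (b * e)" using b e by (simp add: x y)
    ultimately have nz: "a \<noteq> 0" "d \<noteq> 0" "a * e + d * b \<noteq> 0"
      using b e by (auto simp: Fract_nonzero x y)
    have "min (order c (a * e)) (order c (d * b)) \<le> order c (a * e + d * b)"
      by (rule order_add_ge[OF nz(3)]) auto
    then show "min (ord_at c x) (ord_at c y) \<le> ord_at c (x + y)"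
      unfolding xy using b e nz by (auto simp: x y ord_at_Fract order_mult)
  }
next
  fix d show "ord_at c (const_P1 d) = 0"
    by (cases "d = 0") (simp_all add: const_P1_def ord_at_Fract order_0I)
next
  have "ord_at c (to_fract [:-c, 1:]) = 1" using order_power_n_n[of c 1] by (simp add: ord_at_to_fract)
  then show "\<exists>x. ord_at c x = 1" by blast
qed

lemma point_ord_inf: "point const_P1 (ord_inf :: 'k::field poly fract \<Rightarrow> int)"
  unfolding point_def
proof (intro conjI allI impI)
  show "ord_inf (0 :: 'k poly fract) = 0" using ord_inf_Fract[of "1::'k poly" 0] by (simp add: Zero_fract_def)
  fix x y :: "'k poly fract"
  obtain a b where x: "x = Fract a b" and b: "b \<noteq> 0" by (cases x) auto
  obtain d e where y: "y = Fract d e" and e: "e \<noteq> 0" by (cases y) auto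
  {
    assume "x \<noteq> 0 \<and> y \<noteq> 0"
    then have "a \<noteq> 0" "d \<noteq> 0" using b e by (auto simp: x y Fract_nonzero)
    then show "ord_inf (x * y) = ord_inf x + ord_inf y"
      using b e by (simp add: x y ord_inf_Fract degree_mult_eq)
  }
  {
    assume "x \<noteq> 0 \<and> y \<noteq> 0 \<and> x + y \<noteq> 0"
    moreover have xy: "x + y = Fract (a * e + d * b) (b * e)" using b e by (simp add: x y)
    ultimately have nz: "a \<noteq> 0" "d \<noteq> 0" "a * e + d * b \<noteq> 0"
      using b e by (auto simp: Fract_nonzero x y)
    have "degree (a * e + d * b) \<le> max (degree (a * e)) (degree (d * b))"
      by (rule degree_add_le_max)
    then show "min (ord_inf x) (ord_inf y) \<le> ord_inf (x + y)"
      unfolding xy using b e nz by (auto simp: x y ord_inf_Fract degree_mult_eq)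
  }
next
  fix d :: 'k show "ord_inf (const_P1 d) = 0"
    by (cases "d = 0") (simp_all add: const_P1_def ord_inf_Fract)
next
  have "ord_inf (inverse (to_fract [:0, 1:]) :: 'k poly fract) = 1"
    by (simp add: to_fract_def ord_inf_Fract)
  then show "\<exists>x :: 'k poly fract. ord_inf x = 1" by blast
qed

lemma to_fract_pCons: "to_fract (pCons a p) = const_P1 a + to_fract [:0, 1:] * to_fract p"
  by (simp add: const_P1_to_fract to_fract_add[symmetric] to_fract_mult[symmetric] del: to_fract_add to_fract_mult)

lemma to_fract_power: "to_fract (p ^ n) = to_fract p ^ n"
  by (induction n) simp_all

lemma to_fract_linear: "to_fract [:-c, 1:] = to_fract [:0, 1:] - const_P1 c"
  by (simp add: const_P1_to_fract to_fract_diff[symmetric] del: to_fract_diff)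

text \<open>If \<open>X\<close> has a pole, the leading term of a polynomial has the strictly
  smallest value, so the value depends on the degree alone. When coefficients are added one by one
  from the top, the multiple of \<open>X\<close> always dominates the new constant.\<close>

lemma P1_valuation_at_infinity:
  fixes v :: "'k::field poly fract \<Rightarrow> int"
  assumes v: "valn const_P1 v" and X: "v (to_fract [:0, 1:]) < 0"
  shows "v z = int (nat (- v (to_fract [:0, 1:]))) * ord_inf z"
proof -
  have p: "v (to_fract p) = v (to_fract [:0, 1:]) * int (degree p)" if "p \<noteq> 0" for p
    using that
  proof (induction p)
    case (pCons a p)
    show ?case
    proof (cases "p = 0")
      case True
      then show ?thesis using v by (simp add: const_P1_to_fract[symmetric] valn_const)
    next
      case False
      let ?y = "to_fract [:0, 1:] * to_fract p :: 'k poly fract"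
      have y: "v ?y = v (to_fract [:0, 1:]) * (int (degree p) + 1)"
        using False pCons.IH by (simp add: valn_mult[OF v] algebra_simps)
      also have "\<dots> < 0" using X by (simp add: mult_less_0_iff)
      finally have "vge v (v ?y + 1) (const_P1 a)" by (simp add: vge_def valn_const[OF v])
      moreover have "?y \<noteq> 0" using False by simp
      ultimately have dom: "v (?y + const_P1 a) = v ?y" using valn_add_dominant[OF v] by blast
      have eq: "to_fract (pCons a p) = ?y + const_P1 a"
        using to_fract_pCons[of a p] by (simp only: add.commute)
      have "degree (pCons a p) = degree p + 1" using False by simp
      then show ?thesis unfolding eq dom y by (simp only: of_nat_add of_nat_1)
    qed
  qed simp
  obtain a b where z: "z = Fract a b" and b: "b \<noteq> 0" by (cases z) auto
  show ?thesis
  proof (cases "a = 0")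
    case True
    then have "z = 0" using b by (simp add: z Zero_fract_def eq_fract)
    then show ?thesis using valn_0[OF v] valn_0[OF point_valn[OF point_ord_inf]] by (metis mult_zero_right)
  next
    case False
    then have "v z = v (to_fract a) - v (to_fract b)"
      using b by (simp add: z Fract_conv_to_fract valn_divide[OF v])
    then show ?thesis using False b X unfolding p[OF False] p[OF b] by (simp add: z ord_inf_Fract algebra_simps)
  qed
qed

lemma vge_to_fract:
  assumes v: "valn const_P1 v" and X: "vge v 0 (to_fract [:0, 1:])"
  shows "vge v 0 (to_fract p)"
proof (induction p)
  case (pCons a p)
  have "vge v 0 (to_fract [:0, 1:] * to_fract p)" using vge_mult[OF v X pCons.IH] by simp
  with vge_add[OF v vge_const[OF v]] show ?case by (simp add: to_fract_pCons[of a p])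
qed simp

text \<open>A polynomial that does not vanish at \<open>c\<close> is a nonzero constant plus a
  multiple of X - c, hence a unit; so \<open>v\<close> only sees the powers of X - c in numerator
  and denominator.\<close>

lemma P1_valuation_at_finite:
  fixes v :: "'k::field poly fract \<Rightarrow> int"
  assumes v: "valn const_P1 v" and c: "v (to_fract [:-c, 1:]) > 0"
  shows "v z = int (nat (v (to_fract [:-c, 1:]))) * ord_at c z"
proof -
  have X: "vge v 0 (to_fract [:0, 1:])"
    using vge_add[OF v _ vge_const[OF v, of c], of "to_fract [:-c, 1:]"] c
    by (simp add: to_fract_linear vge_def)
  have unit: "v (to_fract p) = 0" if "poly p c \<noteq> 0" for p
  proof -
    have "p = [:-c, 1:] * synthetic_div p c + [:poly p c:]" by (rule synthetic_div_correct'[symmetric])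
    then have eq: "to_fract p = const_P1 (poly p c) + to_fract [:-c, 1:] * to_fract (synthetic_div p c)"
      by (metis add.commute const_P1_to_fract to_fract_add to_fract_mult)
    have "vge v (v (to_fract [:-c, 1:]) + 0) (to_fract [:-c, 1:] * to_fract (synthetic_div p c))"
      by (rule vge_mult[OF v vge_self vge_to_fract[OF v X]])
    then have "vge v (v (const_P1 (poly p c)) + 1) (to_fract [:-c, 1:] * to_fract (synthetic_div p c))"
      by (rule vge_mono) (use c valn_const[OF v] in simp)
    moreover have "const_P1 (poly p c) \<noteq> 0" using that by (simp add: field_hom_const_P1)
    ultimately show ?thesis unfolding eq using valn_add_dominant(2)[OF v] valn_const[OF v] by metis
  qed
  have p: "v (to_fract p) = v (to_fract [:-c, 1:]) * int (order c p)" if p0: "p \<noteq> 0" for p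
  proof -
    obtain q where q: "p = [:-c, 1:] ^ order c p * q" "\<not> [:-c, 1:] dvd q"
      using order_decomp[OF p0] by blast
    have "poly q c \<noteq> 0" using q(2) by (simp add: poly_eq_0_iff_dvd)
    then have "q \<noteq> 0" "v (to_fract q) = 0" using unit by auto
    then show ?thesis
      by (subst q(1)) (simp add: valn_mult[OF v] to_fract_power valn_power[OF v])
  qed
  obtain a b where z: "z = Fract a b" and b: "b \<noteq> 0" by (cases z) auto
  show ?thesis
  proof (cases "a = 0")
    case True
    then have "z = 0" using b by (simp add: z Zero_fract_def eq_fract)
    then show ?thesis using valn_0[OF v] valn_0[OF point_valn[OF point_ord_at]] by (metis mult_zero_right)
  next
    case False
    then have "v z = v (to_fract a) - v (to_fract b)"
      using b by (simp add: z Fract_conv_to_fract valn_divide[OF v])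
    then show ?thesis using False b c unfolding p[OF False] p[OF b] by (simp add: z ord_at_Fract algebra_simps)
  qed
qed

text \<open>When \<open>X\<close> has no pole, some X - c must have positive value: otherwise all
  linear factors, hence all nonzero polynomials over the algebraically closed field, would have
  value 0, and no element could have value 1.\<close>

lemma point_P1_cases:
  fixes u :: "'k::alg_closed_field poly fract \<Rightarrow> int"
  assumes u: "point const_P1 u"
  obtains c where "u = ord_at c" | "u = ord_inf"
proof (cases "u (to_fract [:0, 1:]) < 0")
  case True
  have "u = ord_inf"
  proof (rule point_multiple_unique(2)[OF u point_ord_inf])
    show "int 1 * u z = int (nat (- u (to_fract [:0, 1:]))) * ord_inf z" for z
      unfolding of_nat_1 mult_1 by (rule P1_valuation_at_infinity[OF point_valn[OF u] True])
  qed simp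
  then show ?thesis using that by blast
next
  case False
  note v = point_valn[OF u]
  have X: "vge u 0 (to_fract [:0, 1:])" using False by (simp add: vge_def)
  have "\<exists>c. u (to_fract [:-c, 1:]) > 0"
  proof (rule ccontr)
    assume "\<not> (\<exists>c. u (to_fract [:-c, 1:]) > 0)"
    then have lin: "u (to_fract [:-c, 1:]) = 0" for c
      using vge_to_fract[OF v X, of "[:-c, 1:]"] by (auto simp: vge_def not_less intro: antisym)
    have "u (to_fract p) = 0" for p :: "'k poly"
    proof (induction p rule: poly_root_order_induct)
      case (no_roots p)
      then have "degree p = 0" using alg_closed_imp_poly_has_root[of p] by auto
      then obtain a where "p = [:a:]" by (rule degree_eq_zeroE)
      then show ?case using valn_const[OF v] by (simp add: const_P1_to_fract)
    next
      case (root p x n)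
      then show ?case
        by (cases "p = 0") (auto simp: valn_mult[OF v] to_fract_power valn_power[OF v] lin)
    qed (simp add: valn_0[OF v])
    moreover obtain z where "u z = 1" using u by (auto simp: point_iff_valn)
    moreover obtain a b where "z = Fract a b" "b \<noteq> 0" by (cases z) auto
    moreover have "a \<noteq> 0" using calculation valn_0[OF v] Fract_nonzero[of b a] by auto
    ultimately show False using valn_divide[OF v, of "to_fract a" "to_fract b"] by (simp add: Fract_conv_to_fract)
  qed
  then obtain c where c: "u (to_fract [:-c, 1:]) > 0" by blast
  have "u = ord_at c"
  proof (rule point_multiple_unique(2)[OF u point_ord_at])
    show "int 1 * u z = int (nat (u (to_fract [:-c, 1:]))) * ord_at c z" for z
      unfolding of_nat_1 mult_1 by (rule P1_valuation_at_finite[OF v c])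
  qed simp
  then show ?thesis using that by blast
qed

lemma ord_at_linear: "ord_at c (to_fract [:-c, 1:]) = 1"
  using order_power_n_n[of c 1] by (simp add: ord_at_to_fract)

lemma order_linear: "order c [:-d, 1:] = (if c = d then 1 else 0)"
  using order_power_n_n[of c 1] by (auto simp: order_0I)

lemma ord_at_eq_iff [simp]: "ord_at c = ord_at d \<longleftrightarrow> c = d"
proof
  assume "ord_at c = ord_at d"
  then have "ord_at c (to_fract [:-d, 1:]) = 1" by (simp add: ord_at_linear)
  then show "c = d" by (auto simp: ord_at_to_fract order_linear split: if_splits)
qed simp

lemma ord_at_neq_ord_inf [simp]: "ord_at c \<noteq> ord_inf" "ord_inf \<noteq> ord_at c"
proof -
  show "ord_at c \<noteq> ord_inf"
  proof
    assume "ord_at c = ord_inf"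
    then have "ord_at c (to_fract [:-c, 1:]) = ord_inf (to_fract [:-c, 1:])" by simp
    then show False unfolding ord_at_linear by (simp add: ord_inf_to_fract)
  qed
  then show "ord_inf \<noteq> ord_at c" by metis
qed

lemma sum_order_eq_degree:
  fixes p :: "'k::alg_closed_field poly"
  assumes "p \<noteq> 0" "finite S" "{c. poly p c = 0} \<subseteq> S"
  shows "(\<Sum>c\<in>S. order c p) = degree p"
proof -
  have fac: "\<exists>S. finite S \<and> {c. poly p c = 0} = S \<and> (\<Sum>c\<in>S. order c p) = degree p" using assms(1)
  proof (induction p rule: poly_root_order_induct)
    case (no_roots p)
    then have "degree p = 0" using alg_closed_imp_poly_has_root[of p] by auto
    then show ?case using no_roots by auto
  next
    case (root p x n)
    then have p0: "p \<noteq> 0" by auto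
    have ord: "order c ([:-x, 1:] ^ n * p) = order c p" if "c \<noteq> x" for c
      using p0 that by (simp add: order_mult order_0I)
    have ordx: "order x ([:-x, 1:] ^ n * p) = n"
      using p0 root(2) by (simp add: order_mult order_power_n_n order_0I)
    obtain S where S: "finite S" "{c. poly p c = 0} = S" "(\<Sum>c\<in>S. order c p) = degree p"
      using root p0 by auto
    have "x \<notin> S" using root S(2) by auto
    have "(\<Sum>c\<in>S. order c ([:-x, 1:] ^ n * p)) = (\<Sum>c\<in>S. order c p)"
      by (rule sum.cong[OF refl], rule ord) (use \<open>x \<notin> S\<close> in auto)
    then have "(\<Sum>c\<in>insert x S. order c ([:-x, 1:] ^ n * p)) = n + degree p"
      using S \<open>x \<notin> S\<close> ordx by simp
    moreover have "{c. poly ([:-x, 1:] ^ n * p) c = 0} = insert x S" using S(2) root(1) by auto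
    moreover have "degree ([:-x, 1:] ^ n * p) = n + degree p"
      using p0 by (simp add: degree_mult_eq degree_power_eq)
    ultimately show ?case using S(1) by auto
  qed simp
  then have "(\<Sum>c | poly p c = 0. order c p) = degree p" by blast
  moreover have "(\<Sum>c | poly p c = 0. order c p) = (\<Sum>c\<in>S. order c p)"
    by (rule sum.mono_neutral_left) (use assms in \<open>auto simp: order_0I\<close>)
  ultimately show ?thesis by simp
qed

text \<open>The denominator is reduced root by root: at each of its roots, nonnegativity of the
  order forces a root of the numerator, and the common factor cancels.\<close>

lemma ord_at_nonneg_imp_poly:
  fixes z :: "'k::alg_closed_field poly fract"
  assumes "\<And>c. vge (ord_at c) 0 z"
  obtains p where "z = to_fract p"
proof -
  obtain a b where "z = Fract a b" "b \<noteq> 0" by (cases z) auto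
  then have "\<exists>p. z = to_fract p"
  proof (induction "degree b" arbitrary: a b rule: less_induct)
    case less
    show ?case
    proof (cases "degree b = 0 \<or> a = 0")
      case True
      then show ?thesis
      proof
        assume "degree b = 0"
        then obtain d where "b = [:d:]" by (rule degree_eq_zeroE)
        then have "z = to_fract (smult (inverse d) a)" using less.prems by (simp add: to_fract_def eq_fract)
        then show ?thesis by blast
      next
        assume "a = 0"
        then have "z = to_fract 0" using less.prems by (simp add: to_fract_def eq_fract)
        then show ?thesis by blast
      qed
    next
      case False
      then obtain c where c: "poly b c = 0" using alg_closed_imp_poly_has_root[of b] by auto
      have "Fract a b \<noteq> 0" using Fract_nonzero[OF less.prems(2), of a] False by blast
      then have "ord_at c (Fract a b) \<ge> 0"
        using assms[of c] unfolding less.prems(1) vge_def by blast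
      then have "int (order c b) \<le> int (order c a)"
        using False ord_at_Fract[OF less.prems(2), of c a] by simp
      moreover have "order c b \<noteq> 0" using c less.prems by (simp add: order_root)
      ultimately have "poly a c = 0" using False by (simp add: order_root)
      then obtain a' b' where ab: "a = [:-c, 1:] * a'" "b = [:-c, 1:] * b'"
        using c by (auto simp: poly_eq_0_iff_dvd elim!: dvdE)
      have b': "b' \<noteq> 0" using ab less.prems by auto
      have "z = Fract a' b'" unfolding less.prems(1) ab by (rule mult_fract_cancel) simp
      moreover have "degree b' < degree b" unfolding ab using b' by (subst degree_mult_eq) auto
      ultimately show ?thesis using less.hyps b' by blast
    qed
  qed
  with that show ?thesis by blast
qed

lemma squarefree_part:
  fixes z :: "'k::alg_closed_field poly fract"
  assumes "z \<noteq> 0"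
  obtains p r where "p \<noteq> 0" "\<And>c. order c p \<le> 1" "r \<noteq> 0" "z = to_fract p * r\<^sup>2"
proof -
  have poly: "\<exists>p r. p \<noteq> 0 \<and> (\<forall>c. order c p \<le> 1) \<and> r \<noteq> 0 \<and> q = p * r\<^sup>2" if "q \<noteq> 0" for q :: "'k poly"
    using that
  proof (induction "degree q" arbitrary: q rule: less_induct)
    case less
    show ?case
    proof (cases "\<forall>c. order c q \<le> 1")
      case True
      then show ?thesis using less.prems by (intro exI[of _ q] exI[of _ 1]) simp
    next
      case False
      then obtain c where "\<not> order c q \<le> 1" by blast
      then have "[:-c, 1:]\<^sup>2 dvd q" using order_divides[of c 2 q] by simp
      then obtain s where s: "q = [:-c, 1:]\<^sup>2 * s" by (rule dvdE)
      then have s0: "s \<noteq> 0" using less.prems by auto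
      then have "degree s < degree q" unfolding s by (simp add: degree_mult_eq degree_power_eq)
      then obtain p r where "p \<noteq> 0" "\<forall>c. order c p \<le> 1" "r \<noteq> 0" "s = p * r\<^sup>2" using less.hyps s0 by blast
      then show ?thesis unfolding s
        by (intro exI[of _ p] exI[of _ "[:-c, 1:] * r"]) (simp add: power_mult_distrib mult.left_commute del: mult_pCons_left)
    qed
  qed
  obtain a b where z: "z = Fract a b" and b: "b \<noteq> 0" by (cases z) auto
  have a: "a \<noteq> 0" using assms b by (simp add: z Fract_nonzero)
  obtain p r where pr: "p \<noteq> 0" "\<forall>c. order c p \<le> 1" "r \<noteq> 0" "a * b = p * r\<^sup>2"
    using poly[of "a * b"] a b by auto
  \<comment> \<open>Since a/b = ab/b^2, the squarefree part of the polynomial ab serves for the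
    fraction, and the square absorbs b.\<close>
  have "z = to_fract p * (to_fract r / to_fract b)\<^sup>2"
    using arg_cong[OF pr(4), of to_fract] b
    by (simp add: z Fract_conv_to_fract power2_eq_square field_simps)
  with that[of p "to_fract r / to_fract b"] pr b show ?thesis by simp
qed

section \<open>Points as embeddings into Laurent series\<close>

lemma valn_fls_subdegree:
  fixes H :: "'a::field \<Rightarrow> 'k::field fls"
  assumes H: "field_hom H" and c: "\<And>c. H (\<iota> c) = fls_const c"
  shows "valn \<iota> (\<lambda>z. fls_subdegree (H z))"
  unfolding valn_def
proof (intro conjI allI impI)
  fix x y :: 'a
  { assume "x \<noteq> 0 \<and> y \<noteq> 0"
    then show "fls_subdegree (H (x * y)) = fls_subdegree (H x) + fls_subdegree (H y)"
      using H by (simp add: field_hom_mult) }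
  { assume "x \<noteq> 0 \<and> y \<noteq> 0 \<and> x + y \<noteq> 0"
    then have "H x + H y \<noteq> 0" using H by (simp add: field_hom_add[OF H, symmetric])
    then show "min (fls_subdegree (H x)) (fls_subdegree (H y)) \<le> fls_subdegree (H (x + y))"
      using fls_plus_subdegree[of "H x" "H y"] by (simp add: field_hom_add[OF H]) }
qed (use H in \<open>simp_all add: field_hom_0 c\<close>)

text \<open>Over an algebraically closed field an element outside the constants is transcendental: a
  nonzero polynomial is a constant times factors X - x, and none of these vanishes at \<tau>. Hence
  evaluation at \<tau> extends to fractions.\<close>

lemma poly_eval_hom_exists:
  fixes j :: "'k::alg_closed_field \<Rightarrow> 'b::field"
  assumes j: "field_hom j" and \<tau>: "\<tau> \<notin> range j"
  obtains H where "field_hom H" "\<And>c. H (const_P1 c) = j c" "H (to_fract [:0, 1:]) = \<tau>"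
proof -
  define E where "E p = poly (map_poly j p) \<tau>" for p
  have E0: "E 0 = 0" by (simp add: E_def)
  have Ep: "E (pCons a p) = j a + \<tau> * E p" for a p
    using j by (simp add: E_def map_poly_pCons field_hom_0)
  have Eadd: "E (p + q) = E p + E q" for p q
    by (induction p q rule: poly_induct2) (simp_all add: E0 Ep field_hom_add[OF j] algebra_simps)
  have Esm: "E (smult c p) = j c * E p" for c p
    by (induction p) (simp_all add: E0 Ep field_hom_mult[OF j] algebra_simps)
  have Em: "E (p * q) = E p * E q" for p q
    by (induction p) (simp_all add: E0 Ep Eadd Esm field_hom_0[OF j] algebra_simps)
  have E1: "E 1 = 1" using Ep[of 1 0] by (simp add: E0 field_hom_1[OF j] one_pCons)
  have Epow: "E (p ^ n) = E p ^ n" for p n by (induction n) (simp_all add: E1 Em)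
  have Enz: "E p = 0 \<Longrightarrow> p = 0" for p
  proof (induction p rule: poly_root_order_induct)
    case (no_roots p)
    then have "degree p = 0" using alg_closed_imp_poly_has_root[of p] by auto
    then obtain a where "p = [:a:]" by (rule degree_eq_zeroE)
    with no_roots j show ?case by (simp add: Ep E0)
  next
    case (root p x n)
    have "E [:-x, 1:] = \<tau> - j x" by (simp add: Ep E0 field_hom_minus[OF j] field_hom_1[OF j])
    then have "E [:-x, 1:] \<noteq> 0" using \<tau> by auto
    moreover have "E ([:-x, 1:] ^ n * p) = E [:-x, 1:] ^ n * E p" by (simp only: Em Epow)
    ultimately show ?case using root by auto
  qed simp
  define H where "H z = (THE t. \<exists>a b. b \<noteq> 0 \<and> z = Fract a b \<and> t = E a / E b)" for z
  have HF: "H (Fract a b) = E a / E b" if b: "b \<noteq> 0" for a b :: "'k poly"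
    unfolding H_def
  proof (rule the_equality)
    show "\<exists>a' b'. b' \<noteq> 0 \<and> Fract a b = Fract a' b' \<and> E a / E b = E a' / E b'" using b by blast
    fix t assume "\<exists>a' b'. b' \<noteq> 0 \<and> Fract a b = Fract a' b' \<and> t = E a' / E b'"
    then obtain a' b' where ab: "b' \<noteq> 0" "Fract a b = Fract a' b'" and t: "t = E a' / E b'" by blast
    have "a * b' = a' * b" using ab b by (simp add: eq_fract)
    then have "E a * E b' = E a' * E b" by (simp add: Em[symmetric])
    moreover have "E b \<noteq> 0" "E b' \<noteq> 0" using Enz b ab by auto
    ultimately show "t = E a / E b" unfolding t by (simp add: frac_eq_eq)
  qed
  have Ht: "H (to_fract p) = E p" for p using HF[of 1 p] by (simp add: to_fract_def E1)
  show ?thesis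
  proof
    show "field_hom H" unfolding field_hom_def
    proof (intro conjI allI)
      show "H 1 = 1" using Ht[of 1] by (simp add: E1)
      fix x y :: "'k poly fract"
      obtain a b where x: "x = Fract a b" and b: "b \<noteq> 0" by (cases x) auto
      obtain d e where y: "y = Fract d e" and e: "e \<noteq> 0" by (cases y) auto
      have nz: "E b \<noteq> 0" "E e \<noteq> 0" using Enz b e by auto
      show "H (x + y) = H x + H y" using b e nz by (simp add: x y HF Eadd Em field_simps)
      show "H (x * y) = H x * H y" using b e nz by (simp add: x y HF Em)
    qed
    show "H (const_P1 c) = j c" for c by (simp add: const_P1_to_fract Ht Ep E0)
    show "H (to_fract [:0, 1:]) = \<tau>" by (simp add: Ht Ep E0 field_hom_0[OF j] field_hom_1[OF j])
  qed
qed

lemma field_hom_fls_const: "field_hom fls_const"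
  by (simp add: field_hom_def fls_plus_const)

lemma fls_subdegree_neq_0_imp_transcendental: "fls_subdegree (f - fls_const c) \<noteq> 0 \<Longrightarrow> f \<noteq> fls_const c \<Longrightarrow> f \<notin> range fls_const"
  by (auto simp: fls_minus_const)

text \<open>Expansion in a local parameter at \<open>u\<close>, which is then replaced by the power
  t^e: \<open>X\<close> goes to c + t^e or to t^(-e). With \<open>e = 2\<close> every order becomes
  even, which makes room for the square root of a function of odd order.\<close>

lemma point_P1_fls:
  fixes u :: "'k::alg_closed_field poly fract \<Rightarrow> int"
  assumes u: "point const_P1 u" and e: "e > 0"
  obtains H where "field_hom H" "\<And>c. H (const_P1 c) = fls_const c" "\<And>z. fls_subdegree (H z) = int e * u z"
  using u
proof (cases rule: point_P1_cases)
  case (1 c)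
  have "fls_const c + fls_X ^ e \<notin> range fls_const"
    by (rule fls_subdegree_neq_0_imp_transcendental[where c = c]) (use e in auto)
  then obtain H where H: "field_hom H" "\<And>c. H (const_P1 c) = fls_const c"
    "H (to_fract [:0, 1:]) = fls_const c + fls_X ^ e"
    using poly_eval_hom_exists[OF field_hom_fls_const] by blast
  have Hc: "H (to_fract [:-c, 1:]) = fls_X ^ e"
    by (simp add: to_fract_linear field_hom_diff[OF H(1)] H)
  have "fls_subdegree (H z) = int e * ord_at c z" for z
    using P1_valuation_at_finite[OF valn_fls_subdegree[OF H(1,2)], of c z] e by (simp add: Hc)
  then show ?thesis using that H 1 by blast
next
  case 2
  have "fls_X_inv ^ e \<notin> range (fls_const :: 'k \<Rightarrow> _)"
  proof
    assume "fls_X_inv ^ e \<in> range (fls_const :: 'k \<Rightarrow> _)"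
    then obtain c :: 'k where c: "fls_X_inv ^ e = fls_const c" by blast
    have "fls_subdegree (fls_X_inv ^ e :: 'k fls) = - int e" by simp
    then show False unfolding c using e by simp
  qed
  then obtain H where H: "field_hom H" "\<And>c. H (const_P1 c) = fls_const c"
    "H (to_fract [:0, 1:]) = (fls_X_inv ^ e :: 'k fls)"
    using poly_eval_hom_exists[OF field_hom_fls_const] by blast
  have "fls_subdegree (H z) = int e * ord_inf z" for z
    using P1_valuation_at_infinity[OF valn_fls_subdegree[OF H(1,2)], of z] e by (simp add: H(3))
  then show ?thesis using that H 2 by blast
qed

text \<open>After an even power of the variable is split off, the remaining power series has nonzero
  constant term. That term has a square root in \<open>'k\<close>, and in characteristic 0 the root
  extends to the whole series.\<close>

lemma fls_sqrt_exists:
  fixes f :: "'k::{alg_closed_field, field_char_0} fls"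
  assumes "f \<noteq> 0" "even (fls_subdegree f)"
  obtains S where "S\<^sup>2 = f"
proof -
  obtain k where k: "fls_subdegree f = 2 * k" using assms(2) by (elim evenE)
  define g where "g = fls_base_factor_to_fps f"
  have fg: "f = fls_X_intpow (2 * k) * fps_to_fls g"
    unfolding g_def k[symmetric] fls_X_intpow_times_conv_shift(1)
    by (rule fls_conv_base_factor_to_fps_shift_subdegree)
  have g0: "fps_nth g 0 \<noteq> 0" using assms(1) by (simp add: g_def)
  have ex: "\<exists>s. s\<^sup>2 = x" for x :: 'k using nth_root_exists[of 2 x] by auto
  define r where "r = (\<lambda>(_::nat) x::'k. SOME s. s\<^sup>2 = x)"
  have r: "(r (Suc 1) x)\<^sup>2 = x" for x unfolding r_def by (rule someI_ex[OF ex])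
  have "fps_radical r (Suc 1) g ^ Suc 1 = g"
    using power_radical[of g r 1] g0 r[of "fps_nth g 0"] by (simp add: numeral_2_eq_2 del: fps_radical_power_nth)
  then have "fps_to_fls (fps_radical r (Suc 1) g) ^ 2 = fps_to_fls g"
    by (simp only: fps_to_fls_power[symmetric] Suc_1)
  moreover have "(fls_X_intpow k :: 'k fls)\<^sup>2 = fls_X_intpow (2 * k)"
    by (simp only: power2_eq_square fls_X_intpow_times_fls_X_intpow mult_2)
  ultimately have "(fls_X_intpow k * fps_to_fls (fps_radical r (Suc 1) g))\<^sup>2 = f"
    unfolding fg by (simp only: power_mult_distrib)
  with that show ?thesis by blast
qed

text \<open>The residue of \<open>z\<close> is the constant coefficient of its Laurent
  series.\<close>

lemma fls_residue:
  fixes H :: "'a::field \<Rightarrow> 'k::field fls"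
  assumes H: "field_hom H" and c: "\<And>c. H (\<iota> c) = fls_const c"
    and v: "\<And>z. fls_subdegree (H z) = int e * v z" and e: "e > 0" and z: "z \<noteq> 0" "v z = 0"
  obtains d where "d \<noteq> 0" "vge v 1 (z - \<iota> d)"
proof -
  have Hz: "H z \<noteq> 0" using H z by simp
  define d where "d = fls_nth (H z) 0"
  have s0: "fls_subdegree (H z) = 0" using v[of z] z by simp
  have d: "d \<noteq> 0" using nth_fls_subdegree_nonzero[OF Hz] by (simp add: d_def s0)
  have "vge v 1 (z - \<iota> d)"
  proof (cases "z - \<iota> d = 0")
    case False
    then have "H (z - \<iota> d) \<noteq> 0" using H by simp
    then have "fls_subdegree (H (z - \<iota> d)) > 0"
      by (rule fls_subdegree_greaterI) (use s0 in \<open>auto simp: field_hom_diff[OF H] c d_def\<close>)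
    then have "v (z - \<iota> d) > 0" using e v[of "z - \<iota> d"] by (simp add: zero_less_mult_iff)
    then show ?thesis by (simp add: vge_def)
  qed simp
  with that d show ?thesis by blast
qed

lemma P1_residue:
  fixes u :: "'k::alg_closed_field poly fract \<Rightarrow> int"
  assumes u: "point const_P1 u" and z: "z \<noteq> 0" "u z = 0"
  obtains d where "d \<noteq> 0" "vge u 1 (z - const_P1 d)"
proof -
  obtain H where H: "field_hom H" "\<And>c. H (const_P1 c) = fls_const c" "\<And>z. fls_subdegree (H z) = int 1 * u z"
    using point_P1_fls[OF u, of 1] by auto
  obtain d where "d \<noteq> 0" "vge u 1 (z - const_P1 d)"
    using fls_residue[OF H(1,2,3) _ z] by auto
  with that show ?thesis by blast
qed

section \<open>Points of a double cover of the line\<close>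

text \<open>The curve y^2 = F over the line, that is the field k(X)(sqrt F), with its involution y
  to -y. \<open>F\<close> is any non-square rational function, so that the pullback of a generator
  on \<open>E\<close> fits as well.\<close>

locale double_cover =
  fixes \<iota> :: "'k::{alg_closed_field, field_char_0} \<Rightarrow> 'a::field"
    and \<pi> :: "'k poly fract \<Rightarrow> 'a" and y :: 'a and F :: "'k poly fract" and w :: "'a \<Rightarrow> 'a"
  assumes cov: "covering const_P1 \<iota> \<pi>"
    and y2: "y\<^sup>2 = \<pi> F"
    and y_notin: "y \<notin> range \<pi>"
    and generate: "\<And>z. \<exists>a b. z = \<pi> a + \<pi> b * y"
    and w_hom: "field_hom w"
    and w_pi: "\<And>a. w (\<pi> a) = \<pi> a"
    and w_y: "w y = - y"
begin

lemma pi_hom: "field_hom \<pi>"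
  using cov by (rule covering_hom)

lemma pi_const: "\<pi> (const_P1 c) = \<iota> c"
  using cov by (rule covering_const)

lemma iota_hom: "field_hom \<iota>"
  using field_hom_compose[OF pi_hom field_hom_const_P1] by (simp add: pi_const)

lemma cov_w: "covering \<iota> \<iota> w"
  using w_hom w_pi by (simp add: covering_def pi_const[symmetric])

lemma y_nz: "y \<noteq> 0"
  using y_notin field_hom_0[OF pi_hom] by (metis rangeI)

lemma F_nz: "F \<noteq> 0"
  using y_nz y2 field_hom_0[OF pi_hom] by auto

lemma two_nz: "(2::'a) \<noteq> 0"
proof -
  have "\<iota> 2 \<noteq> 0" using iota_hom by simp
  then show ?thesis by (simp add: field_hom_2[OF iota_hom])
qed

lemma coords_eq_0: "\<pi> a + \<pi> b * y = 0 \<longleftrightarrow> a = 0 \<and> b = 0"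
proof
  assume *: "\<pi> a + \<pi> b * y = 0"
  have "b = 0"
  proof (rule ccontr)
    assume "b \<noteq> 0"
    then have "\<pi> b \<noteq> 0" using pi_hom by simp
    moreover have "\<pi> b * y = - \<pi> a" using * by (simp add: add_eq_0_iff)
    ultimately have "y = - \<pi> a / \<pi> b" by (simp add: field_simps)
    also have "\<dots> = \<pi> (- a / b)" by (simp add: field_hom_minus[OF pi_hom] field_hom_divide[OF pi_hom])
    finally show False using y_notin by blast
  qed
  with * show "a = 0 \<and> b = 0" using pi_hom by (simp add: field_hom_0)
qed (simp add: field_hom_0[OF pi_hom])

lemma w_coords: "w (\<pi> a + \<pi> b * y) = \<pi> a - \<pi> b * y"
  by (simp add: field_hom_add[OF w_hom] field_hom_mult[OF w_hom] w_pi w_y)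

lemma w_w [simp]: "w (w z) = z"
proof -
  obtain a b where "z = \<pi> a + \<pi> b * y" using generate by blast
  then show ?thesis
    by (simp add: w_coords field_hom_diff[OF w_hom] field_hom_mult[OF w_hom] w_pi w_y)
qed

text \<open>Contrapositively, a point stays nontrivial on the line below. If it is trivial there,
  then y^2 = F gives \<open>y\<close> value 0, so every nonzero element and its inverse have
  nonnegative value.\<close>

lemma valn_trivial:
  assumes v: "valn \<iota> v" and tr: "\<And>a. v (\<pi> a) = 0"
  shows "v z = 0"
proof -
  have vy: "v y = 0" using valn_power[OF v, of y 2] tr[of F] by (simp add: y2)
  have ge: "vge v 0 x" for x
  proof -
    obtain a b where x: "x = \<pi> a + \<pi> b * y" using generate by blast
    have "vge v (0 + 0) (\<pi> b * y)"
      by (rule vge_mult[OF v]) (simp_all add: vge_def tr vy)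
    moreover have "vge v 0 (\<pi> a)" by (simp add: vge_def tr)
    ultimately show ?thesis unfolding x using vge_add[OF v] by simp
  qed
  show ?thesis
  proof (cases "z = 0")
    case False
    then show ?thesis using ge[of z] ge[of "inverse z"] valn_inverse[OF v, of z] by (auto simp: vge_def)
  qed (simp add: valn_0[OF v])
qed

abbreviation "im \<equiv> image_point \<pi>"
abbreviation "ram \<equiv> ram_index \<pi>"

lemma lies_over_im:
  assumes v: "point \<iota> v"
  shows "lies_over \<pi> v (ram v) (im v)" "point const_P1 (im v)"
proof -
  obtain x where "v x = 1" using v by (auto simp: point_iff_valn)
  then obtain a where a: "v (\<pi> a) \<noteq> 0" using valn_trivial[OF point_valn[OF v]] by (metis zero_neq_one)
  show "lies_over \<pi> v (ram v) (im v)" "point const_P1 (im v)"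
    using covering_lies_over[OF v cov a] by auto
qed

lemma v_pi: "point \<iota> v \<Longrightarrow> v (\<pi> a) = int (ram v) * im v a"
  using lies_over_im(1) by (simp add: lies_over_def)

lemma ram_pos: "point \<iota> v \<Longrightarrow> ram v > 0"
  using lies_over_im(1) by (simp add: lies_over_def)

lemma two_v_y: "point \<iota> v \<Longrightarrow> 2 * v y = int (ram v) * im v F"
  using valn_power[OF point_valn, of \<iota> v y 2] v_pi[of v F] by (simp add: y2)

lemma point_w:
  assumes v: "point \<iota> v"
  shows "point \<iota> (\<lambda>z. v (w z))" "im (\<lambda>z. v (w z)) = im v" "ram (\<lambda>z. v (w z)) = ram v"
proof -
  obtain x where "v x = 1" using v by (auto simp: point_iff_valn)
  then have "v (w (w x)) = 1" by simp
  then show "point \<iota> (\<lambda>z. v (w z))"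
    using valn_covering[OF point_valn[OF v] cov_w] unfolding point_iff_valn by blast
  have "lies_over \<pi> (\<lambda>z. v (w z)) (ram v) (im v)"
    using lies_over_im(1)[OF v] by (simp add: lies_over_def w_pi)
  from lies_over_point_unique[OF lies_over_im(2)[OF v] this]
  show "im (\<lambda>z. v (w z)) = im v" "ram (\<lambda>z. v (w z)) = ram v" by auto
qed

text \<open>The order at the point above \<open>u\<close> when \<open>u F\<close> is odd: an even
  number for the part from the line, an odd one for the part with \<open>y\<close>. They never tie,
  so the minimum is exact; the case distinctions only keep out the dummy value at 0.\<close>

definition odd_value :: "('k poly fract \<Rightarrow> int) \<Rightarrow> 'k poly fract \<Rightarrow> 'k poly fract \<Rightarrow> int" where
  "odd_value u a b = (if a = 0 then (if b = 0 then 0 else 2 * u b + u F)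
     else if b = 0 then 2 * u a else min (2 * u a) (2 * u b + u F))"

text \<open>From 2 v(y) = ram * u(F) the index is even, say 2h. Then every value is h times
  \<open>odd_value\<close>, and since the value 1 is taken, h = 1.\<close>

lemma odd_point:
  assumes v: "point \<iota> v" and odd: "odd (im v F)"
  shows "ram v = 2" "v (\<pi> a + \<pi> b * y) = odd_value (im v) a b"
proof -
  note vv = point_valn[OF v]
  have "even (int (ram v) * im v F)" using two_v_y[OF v] by (metis dvd_triv_left)
  then have "even (int (ram v))" using odd even_mult_iff by blast
  then obtain h where h: "ram v = 2 * h" by (auto elim!: evenE)
  have h0: "h > 0" using ram_pos[OF v] h by simp
  have vy: "v y = int h * im v F" using two_v_y[OF v] h by simp
  have vb: "v (\<pi> b * y) = int h * (2 * im v b + im v F)" if "b \<noteq> 0" for b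
    using that pi_hom y_nz valn_mult[OF vv, of "\<pi> b" y] v_pi[OF v, of b] vy h
    by (simp add: algebra_simps)
  have va: "v (\<pi> a) = int h * (2 * im v a)" for a using v_pi[OF v, of a] h by simp
  have form: "v (\<pi> a + \<pi> b * y) = int h * odd_value (im v) a b" for a b
  proof (cases "a = 0 \<or> b = 0")
    case True
    then show ?thesis
      using va[of a] vb[of b] valn_0[OF vv] by (auto simp: odd_value_def field_hom_0[OF pi_hom])
  next
    case False
    then have nz: "\<pi> a \<noteq> 0" "\<pi> b * y \<noteq> 0" using pi_hom y_nz by auto
    have ne: "2 * im v a \<noteq> 2 * im v b + im v F" using odd by presburger
    consider "2 * im v a < 2 * im v b + im v F" | "2 * im v b + im v F < 2 * im v a" using ne by linarith
    then show ?thesis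
    proof cases
      case 1
      then have "int h * (2 * im v a) < int h * (2 * im v b + im v F)" using h0 by simp
      then have "vge v (v (\<pi> a) + 1) (\<pi> b * y)" using va[of a] vb[of b] False by (simp add: vge_def)
      from valn_add_dominant(2)[OF vv nz(1) this] show ?thesis
        using 1 False va[of a] by (simp add: odd_value_def)
    next
      case 2
      then have "int h * (2 * im v b + im v F) < int h * (2 * im v a)" using h0 by simp
      then have "vge v (v (\<pi> b * y) + 1) (\<pi> a)" using va[of a] vb[of b] False by (simp add: vge_def)
      from valn_add_dominant(2)[OF vv nz(2) this] show ?thesis
        using 2 False vb[of b] by (simp add: odd_value_def add.commute)
    qed
  qed
  obtain x where x: "v x = 1" using v by (auto simp: point_iff_valn)
  obtain a' b' where "x = \<pi> a' + \<pi> b' * y" using generate by blast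
  then have "int h * odd_value (im v) a' b' = 1" using form x by metis
  then have "h = 1" by (simp add: zmult_eq_1_iff)
  then show "ram v = 2" "v (\<pi> a + \<pi> b * y) = odd_value (im v) a b" using h form by auto
qed

lemma odd_point_unique:
  assumes "point \<iota> v" "point \<iota> v'" "im v = im v'" "odd (im v F)"
  shows "v = v'"
proof
  fix z
  obtain a b where "z = \<pi> a + \<pi> b * y" using generate by blast
  then show "v z = v' z" using odd_point(2) assms by metis
qed

text \<open>A local square root of \<open>F\<close>: \<open>t\<close> takes half of its order at
  \<open>u\<close>, and \<open>c\<close> is a square root of the residue of the remaining
  unit.\<close>

lemma even_normalize:
  assumes u: "point const_P1 u" and even: "even (u F)"
  obtains t c where "t \<noteq> 0" "c \<noteq> 0" "u (F / t\<^sup>2) = 0" "vge u 1 (F / t\<^sup>2 - const_P1 (c\<^sup>2))"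
proof -
  note uu = point_valn[OF u]
  obtain r where r: "u r = 1" using u by (auto simp: point_iff_valn)
  then have r0: "r \<noteq> 0" using valn_0[OF uu] by auto
  define t where "t = r powi (u F div 2)"
  have t: "t \<noteq> 0" "u t = u F div 2" using r0 r by (auto simp: t_def valn_power_int[OF uu])
  have F0: "u (F / t\<^sup>2) = 0" "F / t\<^sup>2 \<noteq> 0"
    using t F_nz even by (auto simp: valn_divide[OF uu] valn_power[OF uu])
  obtain d where d: "d \<noteq> 0" "vge u 1 (F / t\<^sup>2 - const_P1 d)" using P1_residue[OF u F0(2,1)] by blast
  obtain c where "c\<^sup>2 = d" using nth_root_exists[of 2 d] by auto
  with that t d F0 show ?thesis by auto
qed

text \<open>The product of y/t - c and y/t + c has positive value, so one factor vanishes at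
  \<open>v\<close>; not both do, as their difference 2c is a nonzero constant.\<close>

lemma even_sign:
  assumes v: "point \<iota> v" and t: "t \<noteq> 0" and c: "c \<noteq> 0"
    and F0: "im v (F / t\<^sup>2) = 0" "vge (im v) 1 (F / t\<^sup>2 - const_P1 (c\<^sup>2))"
  shows "v (y / \<pi> t) = 0" "vge v 1 (y / \<pi> t - \<iota> c) \<longleftrightarrow> \<not> vge v 1 (y / \<pi> t + \<iota> c)"
proof -
  note vv = point_valn[OF v]
  have tz: "\<pi> t \<noteq> 0" using t pi_hom by simp
  have sq: "(y / \<pi> t)\<^sup>2 = \<pi> (F / t\<^sup>2)"
    by (simp add: power_divide y2 field_hom_divide[OF pi_hom] field_hom_power[OF pi_hom])
  have "2 * v (y / \<pi> t) = 0"
    using valn_power[OF vv, of "y / \<pi> t" 2] v_pi[OF v, of "F / t\<^sup>2"] F0 by (simp add: sq)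
  then show y0: "v (y / \<pi> t) = 0" by simp
  have "(y / \<pi> t - \<iota> c) * (y / \<pi> t + \<iota> c) = (y / \<pi> t)\<^sup>2 - \<iota> (c\<^sup>2)"
    by (simp add: power2_eq_square algebra_simps field_hom_mult[OF iota_hom])
  also have "\<dots> = \<pi> (F / t\<^sup>2 - const_P1 (c\<^sup>2))"
    by (simp add: sq field_hom_diff[OF pi_hom] pi_const)
  finally have prod: "(y / \<pi> t - \<iota> c) * (y / \<pi> t + \<iota> c) = \<pi> (F / t\<^sup>2 - const_P1 (c\<^sup>2))" .
  have ge: "vge v 0 (y / \<pi> t - \<iota> c)" "vge v 0 (y / \<pi> t + \<iota> c)"
    by (rule vge_diff[OF vv] vge_add[OF vv]; simp add: vge_def y0 valn_const[OF vv])+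
  have one: "vge v 1 (y / \<pi> t - \<iota> c) \<or> vge v 1 (y / \<pi> t + \<iota> c)"
  proof (rule ccontr)
    assume neg: "\<not> ?thesis"
    then have nz: "y / \<pi> t - \<iota> c \<noteq> 0" "y / \<pi> t + \<iota> c \<noteq> 0" by (metis vge_0)+
    then have "v ((y / \<pi> t - \<iota> c) * (y / \<pi> t + \<iota> c)) = 0"
      using neg ge by (simp add: valn_mult[OF vv] vge_def)
    moreover have "v (\<pi> (F / t\<^sup>2 - const_P1 (c\<^sup>2))) > 0"
    proof -
      have "F / t\<^sup>2 - const_P1 (c\<^sup>2) \<noteq> 0" using prod nz field_hom_0[OF pi_hom] by (metis mult_eq_0_iff)
      then have "im v (F / t\<^sup>2 - const_P1 (c\<^sup>2)) \<ge> 1" using F0(2) by (simp add: vge_def)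
      then show ?thesis using ram_pos[OF v] v_pi[OF v] by simp
    qed
    ultimately show False unfolding prod by simp
  qed
  have "\<not> (vge v 1 (y / \<pi> t - \<iota> c) \<and> vge v 1 (y / \<pi> t + \<iota> c))"
  proof
    assume "vge v 1 (y / \<pi> t - \<iota> c) \<and> vge v 1 (y / \<pi> t + \<iota> c)"
    then have "vge v 1 ((y / \<pi> t + \<iota> c) - (y / \<pi> t - \<iota> c))" using vge_diff[OF vv] by blast
    moreover have "(y / \<pi> t + \<iota> c) - (y / \<pi> t - \<iota> c) = \<iota> (c + c)"
      unfolding field_hom_add[OF iota_hom] by simp
    moreover have "c + c \<noteq> 0" using c by (simp add: mult_2[symmetric])
    then have "\<iota> (c + c) \<noteq> 0" using field_hom_eq_0[OF iota_hom] by blast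
    ultimately show False using valn_const[OF vv, of "c + c"] by (simp add: vge_def)
  qed
  with one show "vge v 1 (y / \<pi> t - \<iota> c) \<longleftrightarrow> \<not> vge v 1 (y / \<pi> t + \<iota> c)" by blast
qed

text \<open>
  Over a point at which \<open>F\<close> has even order, a point is determined by the sign of the square root
  that \<open>y\<close> reduces to, and its values are multiples of its ramification index.
\<close>

lemma even_value:
  assumes u: "point const_P1 u" and t: "t \<noteq> 0" and c: "c \<noteq> 0"
    and F0: "u (F / t\<^sup>2) = 0" "vge u 1 (F / t\<^sup>2 - const_P1 (c\<^sup>2))"
  shows "\<exists>m. \<forall>v. point \<iota> v \<and> im v = u \<and> vge v 1 (y / \<pi> t - \<iota> c) \<longrightarrow> v z = int (ram v) * m"
proof -
  note uu = point_valn[OF u]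
  let ?Q = "\<lambda>v. point \<iota> v \<and> im v = u \<and> vge v 1 (y / \<pi> t - \<iota> c)"
  define y0 where "y0 = y / \<pi> t"
  have tz: "\<pi> t \<noteq> 0" using t pi_hom by simp
  have y0z: "y0 \<noteq> 0" using y_nz tz by (simp add: y0_def)
  have sq: "y0\<^sup>2 = \<pi> (F / t\<^sup>2)"
    by (simp add: y0_def power_divide y2 field_hom_divide[OF pi_hom] field_hom_power[OF pi_hom])
  obtain a b' where zab: "z = \<pi> a + \<pi> b' * y" using generate by blast
  define b where "b = b' * t"
  have z: "z = \<pi> a + \<pi> b * y0" using tz by (simp add: zab b_def y0_def field_hom_mult[OF pi_hom])
  have vy0: "v y0 = 0" if "?Q v" for v using even_sign(1)[of v t c] that t c F0 by (simp add: y0_def)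
  have vby: "v (\<pi> b * y0) = int (ram v) * u b" if "?Q v" "b \<noteq> 0" for v b
    using that valn_mult[OF point_valn, of \<iota> v "\<pi> b" y0] pi_hom y0z vy0 v_pi[of v b] by auto
  have va: "v (\<pi> a) = int (ram v) * u a" if "?Q v" for v a using v_pi[of v a] that by auto
  show ?thesis
  proof (cases "a = 0 \<or> b = 0")
    case True
    then show ?thesis
    proof
      assume "a = 0"
      then have z: "z = \<pi> b * y0" by (simp add: z field_hom_0[OF pi_hom])
      show ?thesis
      proof (cases "b = 0")
        case True
        then have "z = 0" by (simp add: z field_hom_0[OF pi_hom])
        then show ?thesis by (intro exI[of _ 0]) (auto simp: valn_0[OF point_valn[where \<iota> = \<iota>]])
      next
        case False
        then show ?thesis using vby z by blast
      qed
    next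
      assume "b = 0"
      then show ?thesis using va[of _ a] by (auto simp: z field_hom_0[OF pi_hom])
    qed
  next
    case False
    then have nz: "\<pi> a \<noteq> 0" "\<pi> b * y0 \<noteq> 0" using pi_hom y0z by auto
    consider "u a < u b" | "u b < u a" | "u a = u b" by linarith
    then show ?thesis
    proof cases
      case 1
      have "v z = int (ram v) * u a" if Q: "?Q v" for v
      proof -
        have "int (ram v) * u a < int (ram v) * u b" using 1 ram_pos[of v] Q by simp
        then have "vge v (v (\<pi> a) + 1) (\<pi> b * y0)" using va[OF Q] vby[OF Q] False by (simp add: vge_def)
        from valn_add_dominant(2)[OF point_valn[where \<iota> = \<iota>] nz(1) this] show ?thesis using Q va[OF Q] by (simp add: z)
      qed
      then show ?thesis by blast
    next
      case 2
      have "v z = int (ram v) * u b" if Q: "?Q v" for v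
      proof -
        have "int (ram v) * u b < int (ram v) * u a" using 2 ram_pos[of v] Q by simp
        then have "vge v (v (\<pi> b * y0) + 1) (\<pi> a)" using va[OF Q] vby[OF Q] False by (simp add: vge_def)
        from valn_add_dominant(2)[OF point_valn[where \<iota> = \<iota>] nz(2) this] show ?thesis
          using Q vby[OF Q] False by (simp add: z add.commute)
      qed
      then show ?thesis by blast
    next
      \<comment> \<open>Terms of equal order may cancel. After both coefficients are scaled to units
        with residues \<alpha> and \<beta>, the sum reduces to \<alpha> + \<beta> c, which may be
        zero.\<close>
      case 3
      obtain r where r: "u r = 1" using u by (auto simp: point_iff_valn)
      then have r0: "r \<noteq> 0" using valn_0[OF uu] by auto
      define s where "s = r powi u a"
      have s: "s \<noteq> 0" "u s = u a" using r0 r by (auto simp: s_def valn_power_int[OF uu])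
      define a1 where "a1 = a / s" define b1 where "b1 = b / s"
      have a1: "a1 \<noteq> 0" "u a1 = 0" and b1: "b1 \<noteq> 0" "u b1 = 0"
        using False s 3 by (auto simp: a1_def b1_def valn_divide[OF uu])
      define z1 where "z1 = \<pi> a1 + \<pi> b1 * y0"
      define z2 where "z2 = \<pi> a1 - \<pi> b1 * y0"
      have zs: "z = \<pi> s * z1" using s pi_hom
        by (simp add: z z1_def a1_def b1_def field_hom_divide[OF pi_hom] algebra_simps)
      obtain \<alpha> where \<alpha>: "\<alpha> \<noteq> 0" "vge u 1 (a1 - const_P1 \<alpha>)" using P1_residue[OF u a1] by blast
      obtain \<beta> where \<beta>: "\<beta> \<noteq> 0" "vge u 1 (b1 - const_P1 \<beta>)" using P1_residue[OF u b1] by blast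
      have lift: "vge v 1 (\<pi> x)" if "?Q v" "vge u 1 x" for v x
      proof (cases "x = 0")
        case False
        then have "u x \<ge> 1" using that by (simp add: vge_def)
        moreover have "int (ram v) \<ge> 1" using ram_pos[of v] that by simp
        ultimately have "int (ram v) * u x \<ge> 1" using mult_mono[of 1 "int (ram v)" 1 "u x"] by simp
        then show ?thesis using va[OF that(1), of x] by (simp add: vge_def)
      qed (simp add: field_hom_0[OF pi_hom])
      have small: "vge v 1 (\<pi> (a1 - const_P1 \<alpha>))" "vge v 1 (\<pi> (b1 - const_P1 \<beta>) * y0)"
        "vge v 1 (\<iota> \<beta> * (y0 - \<iota> c))" if Q: "?Q v" for v
      proof -
        have vv: "valn \<iota> v" using Q point_valn by blast
        show "vge v 1 (\<pi> (a1 - const_P1 \<alpha>))" using lift[OF Q \<alpha>(2)] .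
        have "vge v (1 + 0) (\<pi> (b1 - const_P1 \<beta>) * y0)"
          by (rule vge_mult[OF vv lift[OF Q \<beta>(2)]]) (simp add: vge_def vy0[OF Q])
        then show "vge v 1 (\<pi> (b1 - const_P1 \<beta>) * y0)" by simp
        show "vge v 1 (\<iota> \<beta> * (y0 - \<iota> c))"
          by (rule vge_const_mult[OF vv]) (use Q in \<open>simp add: y0_def\<close>)
      qed
      have unit: "v x = 0" if "x = \<iota> d + e" "d \<noteq> 0" "vge v 1 e" "?Q v" for x d e v
      proof -
        have vv: "valn \<iota> v" using that point_valn by blast
        have "vge v (v (\<iota> d) + 1) e" using that by (simp add: valn_const[OF vv])
        from valn_add_dominant(2)[OF vv _ this] that show ?thesis using iota_hom by (simp add: valn_const[OF vv])
      qed
      show ?thesis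
      proof (cases "\<alpha> + \<beta> * c = 0")
        case False
        have eq: "z1 = \<iota> (\<alpha> + \<beta> * c) + (\<pi> (a1 - const_P1 \<alpha>) + \<pi> (b1 - const_P1 \<beta>) * y0 + \<iota> \<beta> * (y0 - \<iota> c))"
          by (simp add: z1_def field_hom_diff[OF pi_hom] pi_const field_hom_add[OF iota_hom]
              field_hom_mult[OF iota_hom] algebra_simps)
        have "v z = int (ram v) * u a" if Q: "?Q v" for v
        proof -
          have vv: "valn \<iota> v" using Q point_valn by blast
          have v1: "v z1 = 0" by (rule unit[OF eq False _ Q]) (intro vge_add[OF vv] small Q)
          have "z1 \<noteq> 0" using zs False nz coords_eq_0[of a b'] \<open>\<not> (a = 0 \<or> b = 0)\<close> zab by auto
          then show ?thesis using s v1 va[OF Q, of s] pi_hom by (simp add: zs valn_mult[OF vv])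
        qed
        then show ?thesis by blast
      next
        \<comment> \<open>Now the conjugate \<open>z2\<close> reduces to \<alpha> - \<beta> c = 2
          \<alpha>, a nonzero constant. The whole order of \<open>z1\<close> therefore sits in the
          norm \<open>N\<close>, an element from the line.\<close>
        case True
        have eq: "z2 = \<iota> (\<alpha> - \<beta> * c) + (\<pi> (a1 - const_P1 \<alpha>) - \<pi> (b1 - const_P1 \<beta>) * y0 - \<iota> \<beta> * (y0 - \<iota> c))"
          by (simp add: z2_def field_hom_diff[OF pi_hom] pi_const field_hom_diff[OF iota_hom]
              field_hom_mult[OF iota_hom] algebra_simps)
        have eq2: "\<alpha> - \<beta> * c = 2 * \<alpha>" using True by (simp add: add_eq_0_iff2 algebra_simps)
        have nd: "\<alpha> - \<beta> * c \<noteq> 0" unfolding eq2 using \<alpha>(1) by simp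
        define N where "N = a1\<^sup>2 - b1\<^sup>2 * (F / t\<^sup>2)"
        have prod: "z1 * z2 = \<pi> N"
          unfolding N_def z1_def z2_def field_hom_diff[OF pi_hom] field_hom_mult[OF pi_hom] field_hom_power[OF pi_hom] sq[symmetric]
          by (simp add: power2_eq_square algebra_simps)
        have "v z = int (ram v) * (u a + u N)" if Q: "?Q v" for v
        proof -
          have vv: "valn \<iota> v" using Q point_valn by blast
          have v2: "v z2 = 0" by (rule unit[OF eq nd _ Q]) (intro vge_diff[OF vv] small Q)
          have z1: "z1 \<noteq> 0" using zs nz coords_eq_0[of a b'] \<open>\<not> (a = 0 \<or> b = 0)\<close> zab by auto
          have z2: "z2 \<noteq> 0"
          proof
            assume "z2 = 0"
            then have "\<pi> a1 + \<pi> (- b1 / t) * y = 0"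
              by (simp add: z2_def y0_def field_hom_minus[OF pi_hom] field_hom_divide[OF pi_hom])
            then show False using a1 coords_eq_0 by blast
          qed
          have "v z1 + v z2 = int (ram v) * u N" using valn_mult[OF vv z1 z2] va[OF Q, of N] by (simp add: prod)
          then show ?thesis using s z1 v2 va[OF Q, of s] pi_hom
            by (simp add: zs valn_mult[OF vv] distrib_left)
        qed
        then show ?thesis by blast
      qed
    qed
  qed
qed

text \<open>The sign of \<open>c\<close> is chosen so that y/t reduces to c at \<open>v\<close>. All
  values are then multiples of the index, which is therefore 1, and \<open>v\<close> is the only
  point with this sign; the other sign belongs to its conjugate under \<open>w\<close>.\<close>

lemma even_point:
  assumes v: "point \<iota> v" and even: "even (im v F)"
  shows "ram v = 1" "(\<lambda>z. v (w z)) \<noteq> v"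
    "\<And>v'. point \<iota> v' \<Longrightarrow> im v' = im v \<Longrightarrow> v' = v \<or> v' = (\<lambda>z. v (w z))"
proof -
  obtain t c0 where t: "t \<noteq> 0" and c0: "c0 \<noteq> 0" and F0: "im v (F / t\<^sup>2) = 0"
    and F1: "vge (im v) 1 (F / t\<^sup>2 - const_P1 (c0\<^sup>2))"
    using even_normalize[OF lies_over_im(2)[OF v] even] by blast
  define c where "c = (if vge v 1 (y / \<pi> t - \<iota> c0) then c0 else - c0)"
  have c: "c \<noteq> 0" using c0 by (simp add: c_def)
  have F2: "vge (im v) 1 (F / t\<^sup>2 - const_P1 (c\<^sup>2))" using F1 by (simp add: c_def)
  have vc: "vge v 1 (y / \<pi> t - \<iota> c)"
    using even_sign(2)[OF v t c0 F0 F1] by (auto simp: c_def field_hom_minus[OF iota_hom])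
  note val = even_value[OF lies_over_im(2)[OF v] t c F0 F2]
  obtain x where x: "v x = 1" using v by (auto simp: point_iff_valn)
  obtain m where "v x = int (ram v) * m" using val[of x] v vc by blast
  then show "ram v = 1" using x by (simp add: zmult_eq_1_iff)
  have uniq: "v' = v" if v': "point \<iota> v'" "im v' = im v" "vge v' 1 (y / \<pi> t - \<iota> c)" for v'
  proof (rule point_multiple_unique(2)[OF v'(1) v])
    fix z
    obtain m where "\<forall>v'. point \<iota> v' \<and> im v' = im v \<and> vge v' 1 (y / \<pi> t - \<iota> c) \<longrightarrow> v' z = int (ram v') * m"
      using val by blast
    then have "v z = int (ram v) * m" "v' z = int (ram v') * m" using v vc v' by auto
    then show "int (ram v) * v' z = int (ram v') * v z" by simp
  qed (rule ram_pos[OF v])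
  have wc: "w (y / \<pi> t - \<iota> d) = - (y / \<pi> t + \<iota> d)" for d
    using w_pi[of "const_P1 d"]
    by (simp add: field_hom_diff[OF w_hom] field_hom_divide[OF w_hom] w_y w_pi pi_const)
  have sign: "vge v' 1 (y / \<pi> t + \<iota> c) \<longleftrightarrow> vge (\<lambda>z. v' (w z)) 1 (y / \<pi> t - \<iota> c)" if "point \<iota> v'" for v'
  proof -
    have "vge (\<lambda>z. v' (w z)) 1 (y / \<pi> t - \<iota> c) \<longleftrightarrow> vge v' 1 (w (y / \<pi> t - \<iota> c))"
      using w_hom by (simp add: vge_def del: right_minus_eq)
    then show ?thesis unfolding wc vge_minus[OF point_valn[OF that]] by simp
  qed
  show "(\<lambda>z. v (w z)) \<noteq> v"
    using sign[OF v] vc even_sign(2)[OF v t c F0 F2] by auto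
  fix v' assume v': "point \<iota> v'" "im v' = im v"
  show "v' = v \<or> v' = (\<lambda>z. v (w z))"
  proof (cases "vge v' 1 (y / \<pi> t - \<iota> c)")
    case True
    then show ?thesis using uniq v' by blast
  next
    case False
    then have "vge v' 1 (y / \<pi> t + \<iota> c)"
      using even_sign(2)[OF v'(1) t c] v'(2) F0 F2 by simp
    then have "(\<lambda>z. v' (w z)) = v" using sign[OF v'(1)] uniq point_w[OF v'(1)] v'(2) by simp
    then have "v' = (\<lambda>z. v (w z))" by (metis (no_types, lifting) w_w ext)
    then show ?thesis by blast
  qed
qed

text \<open>The Laurent embedding of k(X) at \<open>u\<close> is extended by sending
  \<open>y\<close> to a square root of the image of \<open>F\<close>; the order of the resulting
  series, normalised, is the desired point. The embedding is part of the conclusion because residues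
  are read from it.\<close>

lemma point_above:
  assumes u: "point const_P1 u"
  obtains v H e where "point \<iota> v" "im v = u" "field_hom H" "\<And>c. H (\<iota> c) = fls_const c"
    "e > 0" "\<And>z. fls_subdegree (H z) = int e * v z"
proof -
  \<comment> \<open>If \<open>F\<close> has odd order at \<open>u\<close>, the parameter is replaced
    by its square, so that \<open>H0 F\<close> has even order in either case.\<close>
  define e0 :: nat where "e0 = (if even (u F) then 1 else 2)"
  have "e0 > 0" by (simp add: e0_def)
  then obtain H0 where H0: "field_hom H0" "\<And>c. H0 (const_P1 c) = fls_const c"
    "\<And>z. fls_subdegree (H0 z) = int e0 * u z"
    using point_P1_fls[OF u] by blast
  have "H0 F \<noteq> 0" using F_nz H0(1) by simp
  moreover have "even (fls_subdegree (H0 F))" by (simp add: H0(3) e0_def)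
  ultimately obtain S where S: "S\<^sup>2 = H0 F" by (rule fls_sqrt_exists)
  obtain A B where AB: "\<And>z. z = \<pi> (A z) + \<pi> (B z) * y" using generate by metis
  define H where "H z = H0 (A z) + H0 (B z) * S" for z
  have Hc: "H (\<pi> a + \<pi> b * y) = H0 a + H0 b * S" for a b
  proof -
    let ?z = "\<pi> a + \<pi> b * y"
    have "\<pi> (a - A ?z) + \<pi> (b - B ?z) * y = ?z - (\<pi> (A ?z) + \<pi> (B ?z) * y)"
      by (simp add: field_hom_diff[OF pi_hom] algebra_simps)
    also have "\<dots> = 0" using AB[of ?z] by simp
    finally have "a = A ?z" "b = B ?z" by (simp_all add: coords_eq_0)
    then show ?thesis by (simp add: H_def)
  qed
  have Hpi: "H (\<pi> a) = H0 a" for a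
    using Hc[of a 0] by (simp add: field_hom_0[OF pi_hom] field_hom_0[OF H0(1)])
  have H: "field_hom H" unfolding field_hom_def
  proof (intro conjI allI)
    show "H 1 = 1" using Hpi[of 1] by (simp add: field_hom_1[OF pi_hom] field_hom_1[OF H0(1)])
    fix x z
    obtain a b where x: "x = \<pi> a + \<pi> b * y" using generate by blast
    obtain c d where z: "z = \<pi> c + \<pi> d * y" using generate by blast
    have "x + z = \<pi> (a + c) + \<pi> (b + d) * y"
      by (simp add: x z field_hom_add[OF pi_hom] algebra_simps)
    then show "H (x + z) = H x + H z"
      by (simp only: Hc x z) (simp add: field_hom_add[OF H0(1)] algebra_simps)
    have "x * z = \<pi> a * \<pi> c + \<pi> b * \<pi> d * y\<^sup>2 + (\<pi> a * \<pi> d + \<pi> b * \<pi> c) * y"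
      by (simp add: x z power2_eq_square algebra_simps)
    also have "\<dots> = \<pi> (a * c + b * d * F) + \<pi> (a * d + b * c) * y"
      by (simp add: y2 field_hom_add[OF pi_hom] field_hom_mult[OF pi_hom])
    finally have "H (x * z) = H0 (a * c + b * d * F) + H0 (a * d + b * c) * S" by (simp only: Hc)
    also have "\<dots> = H0 a * H0 c + H0 b * H0 d * S\<^sup>2 + (H0 a * H0 d + H0 b * H0 c) * S"
      by (simp add: S field_hom_add[OF H0(1)] field_hom_mult[OF H0(1)])
    also have "\<dots> = H x * H z"
      unfolding x z Hc by (simp add: power2_eq_square algebra_simps)
    finally show "H (x * z) = H x * H z" .
  qed
  have Hconst: "H (\<iota> c) = fls_const c" for c using Hpi[of "const_P1 c"] by (simp add: pi_const H0)
  have vH: "valn \<iota> (\<lambda>z. fls_subdegree (H z))" by (rule valn_fls_subdegree[OF H Hconst])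
  obtain r where r: "u r = 1" using u by (auto simp: point_iff_valn)
  have "fls_subdegree (H (\<pi> r)) \<noteq> 0" by (simp add: Hpi H0(3) r e0_def)
  from valn_normalize[OF vH this] obtain e v where
    ev: "e > 0" "point \<iota> v" "\<And>z. fls_subdegree (H z) = int e * v z" by blast
  have "im v = u"
  proof (rule point_multiple_unique(2)[OF lies_over_im(2)[OF ev(2)] u])
    show "int (e * ram v) * im v a = int e0 * u a" for a
      using ev(3)[of "\<pi> a"] by (simp add: Hpi H0(3) v_pi[OF ev(2)])
    show "e * ram v > 0" using ev(1) ram_pos[OF ev(2)] by simp
  qed
  with that ev H Hconst show ?thesis by blast
qed

text \<open>The residue field is \<open>'k\<close>. A point of the fiber other than the constructed
  \<open>v0\<close> is the conjugate of \<open>v0\<close>, so it too comes from a Laurent embedding,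
  composed with \<open>w\<close>.\<close>

lemma residue:
  assumes v: "point \<iota> v" and z: "z \<noteq> 0" "v z = 0"
  obtains d where "d \<noteq> 0" "vge v 1 (z - \<iota> d)"
proof -
  obtain v0 H e where v0: "point \<iota> v0" "im v0 = im v" and H: "field_hom H" "\<And>c. H (\<iota> c) = fls_const c"
    and e: "e > 0" "\<And>z. fls_subdegree (H z) = int e * v0 z"
    using point_above[OF lies_over_im(2)[OF v]] by metis
  show ?thesis
  proof (cases "v = v0")
    case True
    with fls_residue[OF H e(2) e(1) z(1)] z(2) that show ?thesis by blast
  next
    case False
    then have "even (im v0 F)" using odd_point_unique[OF v v0(1)] v0(2) by metis
    then have vw: "v = (\<lambda>z. v0 (w z))"
      using even_point(3)[OF v0(1) _ v v0(2)[symmetric]] False by blast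
    have h: "field_hom (\<lambda>z. H (w z))" by (rule field_hom_compose[OF H(1) w_hom])
    have c: "H (w (\<iota> c)) = fls_const c" for c using covering_const[OF cov_w] H(2) by simp
    have s: "fls_subdegree (H (w z)) = int e * v z" for z by (simp add: e(2) vw)
    from fls_residue[OF h c s e(1) z] that show ?thesis by blast
  qed
qed

lemma residue_quotient:
  assumes v: "point \<iota> v" and z: "z1 \<noteq> 0" "z2 \<noteq> 0" "v z1 = v z2"
  obtains d where "vge v (v z1 + 1) (z1 - \<iota> d * z2)"
proof -
  note vv = point_valn[OF v]
  have "z1 / z2 \<noteq> 0" "v (z1 / z2) = 0" using z by (simp_all add: valn_divide[OF vv])
  from residue[OF v this] obtain d where "vge v 1 (z1 / z2 - \<iota> d)" by blast
  from vge_mult[OF vv this vge_self, of z2] have "vge v (v z1 + 1) ((z1 / z2 - \<iota> d) * z2)"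
    using z by (simp add: add.commute)
  moreover have "(z1 / z2 - \<iota> d) * z2 = z1 - \<iota> d * z2" using z by (simp add: algebra_simps)
  ultimately show ?thesis using that by simp
qed

lemma fiber_odd:
  assumes u: "point const_P1 u" and odd: "odd (u F)"
  obtains v where "fiber \<iota> \<pi> u = {v}" "point \<iota> v" "im v = u" "ram v = 2" "(\<lambda>z. v (w z)) = v"
proof -
  obtain v where v: "point \<iota> v" "im v = u" using point_above[OF u] by metis
  have uniq: "v' = v" if "point \<iota> v'" "im v' = u" for v'
    using odd_point_unique[OF that(1) v(1)] that(2) v(2) odd by simp
  have "(\<lambda>z. v (w z)) = v" by (rule uniq) (use point_w[OF v(1)] v(2) in simp_all)
  moreover have "fiber \<iota> \<pi> u = {v}" using uniq v unfolding fiber_def by blast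
  ultimately show ?thesis using that v odd_point(1)[OF v(1)] odd by simp
qed

lemma fiber_even:
  assumes u: "point const_P1 u" and even: "even (u F)"
  obtains v where "fiber \<iota> \<pi> u = {v, \<lambda>z. v (w z)}" "point \<iota> v" "im v = u" "ram v = 1" "(\<lambda>z. v (w z)) \<noteq> v"
proof -
  obtain v where v: "point \<iota> v" "im v = u" using point_above[OF u] by metis
  have e: "even (im v F)" using v even by simp
  have "fiber \<iota> \<pi> u = {v, \<lambda>z. v (w z)}"
    using even_point(3)[OF v(1) e] v point_w[OF v(1)] by (auto simp: fiber_def)
  with that v even_point(1,2)[OF v(1) e] show ?thesis by blast
qed

lemma sum_ram_fiber:
  assumes u: "point const_P1 u"
  shows "finite (fiber \<iota> \<pi> u)" "(\<Sum>v\<in>fiber \<iota> \<pi> u. ram v) = 2" "fiber \<iota> \<pi> u \<noteq> {}"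
proof -
  have "finite (fiber \<iota> \<pi> u) \<and> (\<Sum>v\<in>fiber \<iota> \<pi> u. ram v) = 2 \<and> fiber \<iota> \<pi> u \<noteq> {}"
  proof (cases "even (u F)")
    case True
    obtain v where "fiber \<iota> \<pi> u = {v, \<lambda>z. v (w z)}" "point \<iota> v" "ram v = 1" "(\<lambda>z. v (w z)) \<noteq> v"
      using fiber_even[OF u True] by metis
    then show ?thesis using point_w(3)[of v] by (auto simp: numeral_2_eq_2)
  next
    case False
    then obtain v where "fiber \<iota> \<pi> u = {v}" "ram v = 2" using fiber_odd[OF u] by metis
    then show ?thesis by simp
  qed
  then show "finite (fiber \<iota> \<pi> u)" "(\<Sum>v\<in>fiber \<iota> \<pi> u. ram v) = 2" "fiber \<iota> \<pi> u \<noteq> {}" by auto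
qed

lemma ram_eq: "point \<iota> v \<Longrightarrow> ram v = (if odd (im v F) then 2 else 1)"
  using odd_point(1) even_point(1) by simp

lemma w_point_eq_iff: "point \<iota> v \<Longrightarrow> (\<lambda>z. v (w z)) = v \<longleftrightarrow> odd (im v F)"
  using odd_point_unique[OF point_w(1)] point_w(2) even_point(2) by metis

end

section \<open>Linear algebra over a subfield\<close>

lemma field_hom_vector_space: "field_hom h \<Longrightarrow> vector_space (\<lambda>b a. h b * a)"
  by unfold_locales (simp_all add: field_hom_add field_hom_mult field_hom_1 algebra_simps)

text \<open>A family instead of a set lets bases be indexed by products and by disjoint sums; its
  injectivity follows from independence.\<close>

lemma (in vector_space) dim_eq_card_family:
  assumes fin: "finite I"
    and sp: "\<And>z. z \<in> V \<Longrightarrow> \<exists>c. z = (\<Sum>i\<in>I. scale (c i) (e i))"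
    and mem: "\<And>i. i \<in> I \<Longrightarrow> e i \<in> V"
    and ind: "\<And>c i. (\<Sum>i\<in>I. scale (c i) (e i)) = 0 \<Longrightarrow> i \<in> I \<Longrightarrow> c i = 0"
  shows "dim V = card I"
proof -
  have inj: "inj_on e I"
  proof (rule inj_onI, rule ccontr)
    fix i j assume ij: "i \<in> I" "j \<in> I" "e i = e j" "i \<noteq> j"
    define c where "c k = (if k = i then 1 else if k = j then -1 else 0 :: 'a)" for k
    have "(\<Sum>k\<in>I. scale (c k) (e k)) = (\<Sum>k\<in>{i, j}. scale (c k) (e k))"
      by (rule sum.mono_neutral_right) (use fin ij in \<open>auto simp: c_def\<close>)
    also have "\<dots> = 0" using ij by (simp add: c_def)
    finally have "c i = 0" using ind ij by blast
    then show False by (simp add: c_def)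
  qed
  have "independent (e ` I)"
  proof
    assume "dependent (e ` I)"
    then obtain u v where u: "v \<in> e ` I" "u v \<noteq> 0" "(\<Sum>v\<in>e ` I. scale (u v) v) = 0"
      using dependent_finite[of "e ` I"] fin by auto
    have "(\<Sum>i\<in>I. scale (u (e i)) (e i)) = 0" using u(3) inj by (simp add: sum.reindex)
    then show False using ind[of "\<lambda>i. u (e i)"] u by auto
  qed
  moreover have "V \<subseteq> span (e ` I)"
  proof
    fix z assume "z \<in> V"
    then obtain c where z: "z = (\<Sum>i\<in>I. scale (c i) (e i))" using sp by blast
    show "z \<in> span (e ` I)" unfolding z by (intro span_sum span_scale span_base imageI)
  qed
  ultimately have "dim V = card (e ` I)" using mem dim_unique[of "e ` I" V] by blast
  then show ?thesis by (simp add: card_image inj)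
qed

lemma (in vector_space) finite_basis_of_dim:
  assumes "dim UNIV > 0"
  obtains B where "finite B" "card B = dim UNIV" "\<And>z. \<exists>c. z = (\<Sum>b\<in>B. scale (c b) b)"
    "\<And>c b. (\<Sum>b\<in>B. scale (c b) b) = 0 \<Longrightarrow> b \<in> B \<Longrightarrow> c b = 0"
proof -
  obtain B where B: "independent B" "UNIV \<subseteq> span B" "card B = dim UNIV" using basis_exists by blast
  have fin: "finite B" using B assms card_gt_0_iff by metis
  have "\<exists>c. z = (\<Sum>b\<in>B. scale (c b) b)" for z
    using B(2) span_finite[OF fin] by blast
  moreover have "c b = 0" if "(\<Sum>b\<in>B. scale (c b) b) = 0" "b \<in> B" for c b
    using independentD[OF B(1) fin subset_refl] that by blast
  ultimately show ?thesis using that fin B by blast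
qed

text \<open>A basis of \<open>U\<close> together with one vector of \<open>V\<close> outside
  \<open>U\<close> spans \<open>V\<close>.\<close>

lemma (in vector_space) dim_le_Suc_dim:
  assumes U: "subspace U" "U \<subseteq> V" and V: "V \<subseteq> span S" "finite S"
    and codim: "\<And>x z. x \<in> V \<Longrightarrow> z \<in> V \<Longrightarrow> x \<notin> U \<Longrightarrow> \<exists>c. z - scale c x \<in> U"
  shows "dim V \<le> dim U + 1"
proof (cases "V \<subseteq> U")
  case True
  then show ?thesis using U by (simp add: subset_antisym)
next
  case False
  then obtain x where x: "x \<in> V" "x \<notin> U" by blast
  obtain B where B: "B \<subseteq> U" "independent B" "U \<subseteq> span B" "card B = dim U" using basis_exists by blast
  have fin: "finite B" using independent_span_bound[OF V(2) B(2)] B(1) U(2) V(1) by blast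
  have "V \<subseteq> span (insert x B)"
  proof
    fix z assume "z \<in> V"
    then obtain c where "z - scale c x \<in> U" using codim x by blast
    then have "z - scale c x \<in> span B" using B by blast
    then show "z \<in> span (insert x B)" by (auto simp: span_breakdown_eq)
  qed
  then have "dim V \<le> card (insert x B)" using dim_le_card fin by blast
  also have "\<dots> \<le> card B + 1" using fin by (simp add: card_insert_if)
  finally show ?thesis using B(4) by simp
qed

text \<open>Tower law: the products of two bases form a basis. Infinite degrees are recorded as 0,
  so it is the positivity of the degrees that provides finite bases.\<close>

lemma cover_degree_compose:
  assumes h: "field_hom (h :: 'b::field \<Rightarrow> 'a::field)" and g: "field_hom (g :: 'c::field \<Rightarrow> 'b)"
    and "cover_degree h > 0" "cover_degree g > 0"
  shows "cover_degree (h \<circ> g) = cover_degree h * cover_degree g"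
proof -
  have sum: "(\<Sum>i\<in>B \<times> C. (h \<circ> g) (c i) * (h (snd i) * fst i)) = (\<Sum>b\<in>B. h (\<Sum>x\<in>C. g (c (b, x)) * x) * b)" for B C c
    by (simp add: sum.cartesian_product' field_hom_sum[OF h] field_hom_mult[OF h] sum_distrib_right mult.assoc)
  interpret H: vector_space "\<lambda>b a. h b * a" by (rule field_hom_vector_space[OF h])
  interpret G: vector_space "\<lambda>b a. g b * a" by (rule field_hom_vector_space[OF g])
  have hg: "field_hom (h \<circ> g)" using field_hom_compose[OF h g] by (simp add: comp_def)
  interpret HG: vector_space "\<lambda>b a. (h \<circ> g) b * a" by (rule field_hom_vector_space[OF hg])
  obtain B where B: "finite B" "card B = cover_degree h" "\<And>z. \<exists>c. z = (\<Sum>b\<in>B. h (c b) * b)"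
    "\<And>c b. (\<Sum>b\<in>B. h (c b) * b) = 0 \<Longrightarrow> b \<in> B \<Longrightarrow> c b = 0"
    using H.finite_basis_of_dim assms(3) unfolding cover_degree_def by blast
  obtain C where C: "finite C" "card C = cover_degree g" "\<And>z. \<exists>c. z = (\<Sum>b\<in>C. g (c b) * b)"
    "\<And>c b. (\<Sum>b\<in>C. g (c b) * b) = 0 \<Longrightarrow> b \<in> C \<Longrightarrow> c b = 0"
    using G.finite_basis_of_dim assms(4) unfolding cover_degree_def by blast
  have "HG.dim UNIV = card (B \<times> C)"
  proof (rule HG.dim_eq_card_family[where e = "\<lambda>i. h (snd i) * fst i"])
    show "finite (B \<times> C)" using B C by simp
    fix z :: 'a
    obtain c where c: "z = (\<Sum>b\<in>B. h (c b) * b)" using B(3) by blast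
    have "\<exists>D. \<forall>t. t = (\<Sum>x\<in>C. g (D t x) * x)" by (rule choice) (use C(3) in blast)
    then obtain D where D: "\<And>t. t = (\<Sum>x\<in>C. g (D t x) * x)" by blast
    define d where "d b = D (c b)" for b
    have d: "(\<Sum>x\<in>C. g (d b x) * x) = c b" for b unfolding d_def using D[of "c b"] by simp
    have "z = (\<Sum>b\<in>B. h (\<Sum>x\<in>C. g (d (fst (b, x)) (snd (b, x))) * x) * b)"
      unfolding fst_conv snd_conv d by (rule c)
    then have "z = (\<Sum>i\<in>B \<times> C. (h \<circ> g) (d (fst i) (snd i)) * (h (snd i) * fst i))"
      unfolding sum[where c = "\<lambda>i. d (fst i) (snd i)"] .
    then show "\<exists>c. z = (\<Sum>i\<in>B \<times> C. (h \<circ> g) (c i) * (h (snd i) * fst i))"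
      by (rule exI[of _ "\<lambda>i. d (fst i) (snd i)"])
  next
    fix c and i :: "'a \<times> 'b"
    assume "(\<Sum>i\<in>B \<times> C. (h \<circ> g) (c i) * (h (snd i) * fst i)) = 0" and i: "i \<in> B \<times> C"
    then have "(\<Sum>b\<in>B. h (\<Sum>x\<in>C. g (c (b, x)) * x) * b) = 0" by (simp only: sum)
    then have "(\<Sum>x\<in>C. g (c (fst i, x)) * x) = 0" 
      using B(4)[of "\<lambda>b. \<Sum>x\<in>C. g (c (b, x)) * x" "fst i"] i by auto
    then have "c (fst i, snd i) = 0" 
      by (rule C(4)[of "\<lambda>x. c (fst i, x)"]) (use i in auto)
    then show "c i = 0" unfolding prod.collapse .
  qed simp
  then show ?thesis using B C by (simp add: cover_degree_def card_cartesian_product)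
qed

section \<open>The genus of a double cover\<close>

lemma riemann_roch_space_iff: "z \<in> riemann_roch_space \<iota> D \<longleftrightarrow> (\<forall>v. point \<iota> v \<longrightarrow> vge v (- D v) z)"
  by (auto simp: riemann_roch_space_def vge_def)

lemma div_degree_superset:
  assumes "finite S" "{v. D v \<noteq> 0} \<subseteq> S"
  shows "div_degree D = sum D S"
  unfolding div_degree_def by (rule sum.mono_neutral_left) (use assms in auto)

lemma div_degree_mono:
  assumes "divisor \<iota> D" "divisor \<iota> D'" "\<And>v. D v \<le> D' v"
  shows "div_degree D \<le> div_degree D'"
proof -
  let ?S = "{v. D v \<noteq> 0} \<union> {v. D' v \<noteq> 0}"
  have "finite ?S" using assms by (simp add: divisor_def)
  then have "div_degree D = sum D ?S" "div_degree D' = sum D' ?S"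
    by (intro div_degree_superset; auto)+
  then show ?thesis using sum_mono[of ?S D D'] assms(3) by simp
qed

lemma subspace_riemann_roch:
  assumes "field_hom \<iota>"
  shows "module.subspace (\<lambda>c z. \<iota> c * z) (riemann_roch_space \<iota> D)"
proof -
  interpret vector_space "\<lambda>c z. \<iota> c * z" by (rule field_hom_vector_space[OF assms])
  show ?thesis
    by (rule subspaceI) (auto simp: riemann_roch_space_iff intro: vge_add[OF point_valn] vge_const_mult[OF point_valn])
qed

section \<open>Riemann-Roch spaces of divisors pulled back from the line\<close>

context double_cover
begin

interpretation L: vector_space "\<lambda>c z. \<iota> c * z"
  by (rule field_hom_vector_space[OF iota_hom])

text \<open>The residue field at \<open>P\<close> is \<open>'k\<close>: given two functions that
  attain the newly permitted order at \<open>P\<close>, one minus a constant multiple of the other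
  no longer does.\<close>

lemma ell_add_point:
  assumes P: "point \<iota> P"
    and E: "E = D(P := D P + 1)" and fin: "riemann_roch_space \<iota> E \<subseteq> L.span S" "finite S"
  shows "ell \<iota> E \<le> ell \<iota> D + 1"
  unfolding ell_def
proof (rule L.dim_le_Suc_dim[OF subspace_riemann_roch[OF iota_hom] _ fin])
  note PP = point_valn[OF P]
  have EP: "E P = D P + 1" and Ev: "\<And>v. v \<noteq> P \<Longrightarrow> E v = D v" by (simp_all add: E)
  have sub: "z \<in> riemann_roch_space \<iota> D \<longleftrightarrow> z \<in> riemann_roch_space \<iota> E \<and> vge P (- D P) z" for z
  proof
    assume z: "z \<in> riemann_roch_space \<iota> D"
    have "vge v (- E v) z" if "point \<iota> v" for v
      using z that vge_mono[of v "- D v" z "- E v"] by (auto simp: riemann_roch_space_iff E)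
    then show "z \<in> riemann_roch_space \<iota> E \<and> vge P (- D P) z"
      using z P by (auto simp: riemann_roch_space_iff)
  next
    assume z: "z \<in> riemann_roch_space \<iota> E \<and> vge P (- D P) z"
    have "vge v (- D v) z" if "point \<iota> v" for v
      using z that Ev[of v] by (cases "v = P") (auto simp: riemann_roch_space_iff)
    then show "z \<in> riemann_roch_space \<iota> D" by (simp add: riemann_roch_space_iff)
  qed
  then show "riemann_roch_space \<iota> D \<subseteq> riemann_roch_space \<iota> E" by blast
  fix x z assume x: "x \<in> riemann_roch_space \<iota> E" "x \<notin> riemann_roch_space \<iota> D"
    and z: "z \<in> riemann_roch_space \<iota> E"
  have PE: "vge P (- D P - 1) t" if "t \<in> riemann_roch_space \<iota> E" for t
    using that P EP by (auto simp: riemann_roch_space_iff dest!: spec[of _ P])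
  have x0: "x \<noteq> 0" and Px: "P x = - D P - 1"
    using PE[OF x(1)] sub[of x] x by (auto simp: vge_def)
  show "\<exists>c. z - \<iota> c * x \<in> riemann_roch_space \<iota> D"
  proof (cases "vge P (- D P) z")
    case True
    then have "z - \<iota> 0 * x \<in> riemann_roch_space \<iota> D" using sub z by (simp add: field_hom_0[OF iota_hom])
    then show ?thesis by blast
  next
    case False
    then have z0: "z \<noteq> 0" "P z = P x" using PE[OF z] Px by (auto simp: vge_def)
    obtain c where c: "vge P (P z + 1) (z - \<iota> c * x)" using residue_quotient[OF P z0(1) x0 z0(2)] .
    have "z - \<iota> c * x \<in> riemann_roch_space \<iota> E"
      using L.subspace_diff[OF subspace_riemann_roch[OF iota_hom] z
          L.subspace_scale[OF subspace_riemann_roch[OF iota_hom] x(1)]] .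
    moreover have "vge P (- D P) (z - \<iota> c * x)" using c z0 Px by simp
    ultimately show ?thesis using sub by blast
  qed
qed

text \<open>Adding one point raises the degree by 1 and \<open>ell\<close> by at most 1;
  \<open>D\<close> is raised to \<open>D'\<close> point by point.\<close>

lemma ell_mono_degree:
  assumes "divisor \<iota> D" "divisor \<iota> D'" "\<And>v. D v \<le> D' v"
    and fin: "riemann_roch_space \<iota> D' \<subseteq> L.span S" "finite S"
  shows "div_degree D - int (ell \<iota> D) \<le> div_degree D' - int (ell \<iota> D')"
  using assms(1,3)
proof (induction "nat (div_degree D' - div_degree D)" arbitrary: D rule: less_induct)
  case less
  show ?case
  proof (cases "D = D'")
    case False
    then obtain P where P: "D P < D' P" using less.prems(2) by (metis ext order_le_less)
    then have "D P \<noteq> 0 \<or> D' P \<noteq> 0" by linarith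
    then have pP: "point \<iota> P" using less.prems(1) assms(2) by (auto simp: divisor_def)
    define E where "E = D(P := D P + 1)"
    have supp: "{v. E v \<noteq> 0} \<subseteq> insert P {v. D v \<noteq> 0}" by (auto simp: E_def)
    have finD: "finite (insert P {v. D v \<noteq> 0})" using less.prems(1) by (simp add: divisor_def)
    have divE: "divisor \<iota> E"
      using less.prems(1) finite_subset[OF supp finD] pP by (auto simp: divisor_def E_def)
    have le: "E v \<le> D' v" for v using less.prems(2)[of v] P by (auto simp: E_def)
    have "div_degree E = sum E (insert P {v. D v \<noteq> 0})" by (rule div_degree_superset[OF finD supp])
    also have "\<dots> = sum (\<lambda>v. D v + (if v = P then 1 else 0)) (insert P {v. D v \<noteq> 0})"
      by (rule sum.cong) (auto simp: E_def)
    also have "\<dots> = sum D (insert P {v. D v \<noteq> 0}) + 1"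
      using finD by (simp add: sum.distrib sum.delta del: sum.insert_if)
    also have "sum D (insert P {v. D v \<noteq> 0}) = div_degree D"
      by (rule div_degree_superset[symmetric, OF finD]) auto
    finally have deg: "div_degree E = div_degree D + 1" .
    have "div_degree E \<le> div_degree D'" by (rule div_degree_mono[OF divE assms(2) le])
    then have "div_degree E - int (ell \<iota> E) \<le> div_degree D' - int (ell \<iota> D')"
      using less.hyps[OF _ divE le] deg by simp
    moreover have "riemann_roch_space \<iota> E \<subseteq> L.span S"
    proof -
      have "riemann_roch_space \<iota> E \<subseteq> riemann_roch_space \<iota> D'"
        using le vge_mono by (fastforce simp: riemann_roch_space_iff)
      with fin show ?thesis by blast
    qed
    then have "ell \<iota> E \<le> ell \<iota> D + 1" by (rule ell_add_point[OF pP E_def _ fin(2)])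
    ultimately show ?thesis using deg by linarith
  qed simp
qed

text \<open>The pullback of an effective divisor \<delta> on the line, points being counted with
  their ramification indices; its degree is twice that of \<delta>.\<close>

definition pullback :: "(('k poly fract \<Rightarrow> int) \<Rightarrow> nat) \<Rightarrow> ('a \<Rightarrow> int) \<Rightarrow> int" where
  "pullback \<delta> v = (if point \<iota> v then int (ram v) * int (\<delta> (im v)) else 0)"

lemma pullback_divisor:
  assumes fin: "finite U" "\<And>u. u \<in> U \<Longrightarrow> point const_P1 u" "\<And>u. \<delta> u \<noteq> 0 \<Longrightarrow> u \<in> U"
  shows "divisor \<iota> (pullback \<delta>)" "div_degree (pullback \<delta>) = 2 * int (sum \<delta> U)"
proof -
  let ?S = "\<Union>u\<in>U. fiber \<iota> \<pi> u"
  have finS: "finite ?S" using fin sum_ram_fiber(1) by auto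
  have supp: "{v. pullback \<delta> v \<noteq> 0} \<subseteq> ?S"
    using fin(3) by (auto simp: pullback_def fiber_def split: if_splits)
  show "divisor \<iota> (pullback \<delta>)"
    using finite_subset[OF supp finS] by (auto simp: divisor_def pullback_def)
  have "div_degree (pullback \<delta>) = sum (pullback \<delta>) ?S" by (rule div_degree_superset[OF finS supp])
  also have "\<dots> = (\<Sum>u\<in>U. sum (pullback \<delta>) (fiber \<iota> \<pi> u))"
    by (rule sum.UNION_disjoint) (use fin sum_ram_fiber(1) in \<open>auto simp: fiber_def\<close>)
  also have "\<dots> = (\<Sum>u\<in>U. 2 * int (\<delta> u))"
  proof (rule sum.cong[OF refl])
    fix u assume u: "u \<in> U"
    have "sum (pullback \<delta>) (fiber \<iota> \<pi> u) = (\<Sum>v\<in>fiber \<iota> \<pi> u. int (ram v) * int (\<delta> u))"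
      by (rule sum.cong) (auto simp: fiber_def pullback_def)
    also have "\<dots> = int (\<Sum>v\<in>fiber \<iota> \<pi> u. ram v) * int (\<delta> u)" by (simp add: sum_distrib_right)
    finally show "sum (pullback \<delta>) (fiber \<iota> \<pi> u) = 2 * int (\<delta> u)" using sum_ram_fiber(2) fin(2) u by simp
  qed
  finally show "div_degree (pullback \<delta>) = 2 * int (sum \<delta> U)" by (simp add: sum_distrib_left)
qed

text \<open>The divisor is invariant under \<open>w\<close>, so the space is the sum of its two
  eigenspaces, and the parts \<open>\<pi> a\<close> and \<open>\<pi> b * y\<close> are bounded
  separately. The bound for the second is doubled, since \<open>y\<close> has half the order of
  \<open>F\<close>.\<close>

lemma riemann_roch_pullback:
  "\<pi> a + \<pi> b * y \<in> riemann_roch_space \<iota> (pullback \<delta>) \<longleftrightarrow>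
     (\<forall>u. point const_P1 u \<longrightarrow> vge u (- int (\<delta> u)) a \<and> (b = 0 \<or> - 2 * int (\<delta> u) \<le> 2 * u b + u F))"
    (is "?z \<in> ?L \<longleftrightarrow> ?R")
proof
  assume z: "?z \<in> ?L"
  have wz: "w ?z \<in> ?L"
    unfolding riemann_roch_space_iff
  proof (intro allI impI)
    fix v assume v: "point \<iota> v"
    have "vge (\<lambda>x. v (w x)) (- pullback \<delta> (\<lambda>x. v (w x))) ?z"
      using z point_w(1)[OF v] by (simp add: riemann_roch_space_iff)
    then show "vge v (- pullback \<delta> v) (w ?z)"
      using point_w[OF v] v field_hom_0[OF w_hom] by (auto simp: vge_def pullback_def)
  qed
  have two: "\<iota> (1/2) * 2 = 1"
    by (simp add: field_hom_2[OF iota_hom, symmetric] field_hom_mult[OF iota_hom, symmetric] field_hom_1[OF iota_hom] del: mult_2_right)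
  have half: "\<pi> a = \<iota> (1/2) * (?z + w ?z)" "\<pi> b * y = \<iota> (1/2) * (?z - w ?z)"
    using two by (simp_all add: w_coords mult.assoc[symmetric] mult_2[symmetric] del: mult_2 mult_2_right)
  note sub = subspace_riemann_roch[OF iota_hom]
  have mem: "\<pi> a \<in> ?L" "\<pi> b * y \<in> ?L"
    by (subst half(1), rule L.subspace_scale[OF sub L.subspace_add[OF sub z wz]])
      (subst half(2), rule L.subspace_scale[OF sub L.subspace_diff[OF sub z wz]])
  show ?R
  proof (intro allI impI)
    fix u :: "'k poly fract \<Rightarrow> int" assume u: "point const_P1 u"
    obtain v where v: "point \<iota> v" "im v = u" using point_above[OF u] by metis
    note vv = point_valn[OF v(1)]
    have e: "int (ram v) > 0" using ram_pos[OF v(1)] by simp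
    have 1: "vge v (- pullback \<delta> v) (\<pi> a)" "vge v (- pullback \<delta> v) (\<pi> b * y)"
      using mem v(1) by (auto simp: riemann_roch_space_iff)
    have "vge u (- int (\<delta> u)) a"
    proof (cases "a = 0")
      case False
      then have "int (ram v) * (- int (\<delta> u)) \<le> int (ram v) * u a"
        using 1(1) v pi_hom by (simp add: vge_def pullback_def v_pi)
      then have "- int (\<delta> u) \<le> u a" using e by (simp only: mult_le_cancel_left_pos)
      then show ?thesis by (simp add: vge_def)
    qed simp
    moreover have "- 2 * int (\<delta> u) \<le> 2 * u b + u F" if "b \<noteq> 0"
    proof -
      have nz: "\<pi> b \<noteq> 0" using that pi_hom by simp
      then have "- pullback \<delta> v \<le> v (\<pi> b) + v y" using 1(2) y_nz by (simp add: vge_def valn_mult[OF vv])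
      then have "- 2 * pullback \<delta> v \<le> 2 * v (\<pi> b) + 2 * v y" by linarith
      then have "int (ram v) * (- 2 * int (\<delta> u)) \<le> int (ram v) * (2 * u b + u F)"
        unfolding two_v_y[OF v(1)] v_pi[OF v(1)] v(2) using v by (simp add: pullback_def algebra_simps)
      then show ?thesis using e by (simp only: mult_le_cancel_left_pos)
    qed
    ultimately show "vge u (- int (\<delta> u)) a \<and> (b = 0 \<or> - 2 * int (\<delta> u) \<le> 2 * u b + u F)" by blast
  qed
next
  assume R: ?R
  show "?z \<in> ?L" unfolding riemann_roch_space_iff
  proof (intro allI impI)
    fix v assume v: "point \<iota> v"
    note vv = point_valn[OF v]
    have e: "int (ram v) > 0" using ram_pos[OF v] by simp
    note Ru = R[rule_format, OF lies_over_im(2)[OF v]]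
    have "vge v (- pullback \<delta> v) (\<pi> a)"
    proof (cases "a = 0")
      case False
      then have "int (ram v) * (- int (\<delta> (im v))) \<le> int (ram v) * im v a"
        using Ru e by (intro mult_left_mono) (auto simp: vge_def)
      then show ?thesis using v by (simp add: vge_def pullback_def v_pi)
    qed (simp add: field_hom_0[OF pi_hom])
    moreover have "vge v (- pullback \<delta> v) (\<pi> b * y)"
    proof (cases "b = 0")
      case False
      then have nz: "\<pi> b \<noteq> 0" using pi_hom by simp
      have "int (ram v) * (- 2 * int (\<delta> (im v))) \<le> int (ram v) * (2 * im v b + im v F)"
        using Ru e False by (intro mult_left_mono) auto
      then have "- 2 * pullback \<delta> v \<le> 2 * v (\<pi> b) + 2 * v y"
        unfolding two_v_y[OF v] v_pi[OF v] using v by (simp add: pullback_def algebra_simps)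
      then show ?thesis using nz y_nz by (simp add: vge_def valn_mult[OF vv])
    qed (simp add: field_hom_0[OF pi_hom])
    ultimately show "vge v (- pullback \<delta> v) ?z" by (rule vge_add[OF vv])
  qed
qed

end

text \<open>The branch points of the double cover y^2 = F.\<close>

definition odd_points :: "'k::field poly fract \<Rightarrow> ('k poly fract \<Rightarrow> int) set" where
  "odd_points F = {u. point const_P1 u \<and> odd (u F)}"

locale squarefree_double_cover = double_cover \<iota> \<pi> y "to_fract p" w
  for \<iota> :: "'k::{alg_closed_field, field_char_0} \<Rightarrow> 'a::field" and \<pi> y p w +
  assumes order_le_1: "\<And>c. order c p \<le> 1"
begin

lemma p_nz: "p \<noteq> 0"
  using F_nz by simp

text \<open>Half the number of branch points, which turns out to be the genus plus 1: the branch
  points are the roots of \<open>p\<close>, together with infinity when the degree of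
  \<open>p\<close> is odd.\<close>

definition m :: nat where "m = (degree p + 1) div 2"

lemma card_odd_points: "finite (odd_points (to_fract p))" "card (odd_points (to_fract p)) = 2 * m"
proof -
  let ?R = "{c. poly p c = 0}"
  have fin: "finite ?R" using p_nz by (rule poly_roots_finite)
  have ord: "order c p = (if poly p c = 0 then 1 else 0)" for c
    using order_le_1[of c] p_nz by (auto simp: order_0I order_root)
  have "card ?R = (\<Sum>c\<in>?R. order c p)" by (simp add: ord)
  also have "\<dots> = degree p" by (rule sum_order_eq_degree[OF p_nz fin subset_refl])
  finally have card: "card ?R = degree p" .
  have eq: "odd_points (to_fract p) = ord_at ` ?R \<union> (if odd (degree p) then {ord_inf} else {})"
  proof (intro set_eqI iffI)
    fix u assume "u \<in> odd_points (to_fract p)"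
    then have u: "point const_P1 u" "odd (u (to_fract p))" by (auto simp: odd_points_def)
    from u(1) show "u \<in> ord_at ` ?R \<union> (if odd (degree p) then {ord_inf} else {})"
      by (cases rule: point_P1_cases)
        (use u(2) p_nz in \<open>auto simp: ord_at_to_fract ord_inf_to_fract ord split: if_splits\<close>)
  next
    fix u assume "u \<in> ord_at ` ?R \<union> (if odd (degree p) then {ord_inf} else {})"
    then show "u \<in> odd_points (to_fract p)"
      using p_nz by (auto simp: odd_points_def ord_at_to_fract ord_inf_to_fract ord point_ord_at point_ord_inf split: if_splits)
  qed
  have inj: "inj_on ord_at ?R" by (auto intro: inj_onI)
  show "finite (odd_points (to_fract p))" unfolding eq using fin by auto
  have "card (odd_points (to_fract p)) = degree p + (if odd (degree p) then 1 else 0)"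
  proof -
    have "ord_inf \<notin> ord_at ` ?R" by auto
    then show ?thesis unfolding eq using fin card by (simp add: card_image[OF inj])
  qed
  then show "card (odd_points (to_fract p)) = 2 * m" by (auto simp: m_def elim!: oddE)
qed

context
  fixes \<delta> :: "('k poly fract \<Rightarrow> int) \<Rightarrow> nat" and U :: "('k poly fract \<Rightarrow> int) set"
  assumes finU: "finite U" and pointsU: "\<And>u. u \<in> U \<Longrightarrow> point const_P1 u" and suppU: "\<And>u. \<delta> u \<noteq> 0 \<Longrightarrow> u \<in> U"
begin

abbreviation "M \<equiv> sum \<delta> U"

text \<open>\<open>q\<close> clears the poles permitted at finite points; those permitted at
  infinity are the part of \<open>M\<close> that its degree leaves over.\<close>

lemma common_denominator:
  obtains q where "q \<noteq> 0" "\<And>c. order c q = \<delta> (ord_at c)" "degree q + \<delta> ord_inf = M"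
proof -
  define C where "C = {c. ord_at c \<in> U}"
  have "inj_on ord_at C" by (auto intro: inj_onI)
  moreover have "ord_at ` C \<subseteq> U" by (auto simp: C_def)
  ultimately have finC: "finite C" using finU inj_on_finite by blast
  define q where "q = (\<Prod>c\<in>C. [:-c, 1:] ^ \<delta> (ord_at c))"
  have q: "q \<noteq> 0" using finC by (simp add: q_def)
  have "order x (\<Prod>c\<in>A. [:-c, 1:] ^ \<delta> (ord_at c)) = (if x \<in> A then \<delta> (ord_at x) else 0)" if "finite A" for A x
    using that
  proof (induction A rule: finite_induct)
    case (insert c A)
    have nz: "[:-c, 1:] ^ \<delta> (ord_at c) * (\<Prod>c\<in>A. [:-c, 1:] ^ \<delta> (ord_at c)) \<noteq> 0"
      using insert.hyps(1) by simp
    have "order x ([:-c, 1:] ^ \<delta> (ord_at c)) = (if x = c then \<delta> (ord_at c) else 0)"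
      by (cases "x = c") (simp_all add: order_power_n_n order_0I del: mult_pCons_left)
    with insert show ?case using nz by (auto simp: order_mult simp del: mult_pCons_left)
  qed simp
  then have ord: "order x q = \<delta> (ord_at x)" for x
    using finC suppU[of "ord_at x"] by (auto simp: q_def C_def)
  have "{c. poly q c = 0} \<subseteq> C"
    using ord suppU q by (auto simp: C_def order_root)
  then have "(\<Sum>c\<in>C. order c q) = degree q" by (rule sum_order_eq_degree[OF q finC])
  then have "degree q = sum \<delta> (ord_at ` C)" using \<open>inj_on ord_at C\<close> by (simp add: ord sum.reindex)
  moreover have "sum \<delta> U = sum \<delta> (insert ord_inf (ord_at ` C))"
  proof (rule sum.mono_neutral_left)
    show "U \<subseteq> insert ord_inf (ord_at ` C)"
    proof
      fix u assume "u \<in> U"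
      then show "u \<in> insert ord_inf (ord_at ` C)"
        by (cases rule: point_P1_cases[OF pointsU]) (auto simp: C_def)
    qed
  qed (use finC suppU in auto)
  moreover have "sum \<delta> (insert ord_inf (ord_at ` C)) = \<delta> ord_inf + sum \<delta> (ord_at ` C)"
    using finC by (subst sum.insert) auto
  ultimately show ?thesis using that[OF q ord] by simp
qed

text \<open>With common denominator \<open>q\<close>, the conditions at finite points say that
  \<open>A\<close> and \<open>B\<close> are polynomials, and the condition at infinity bounds their
  degrees. The \<open>y\<close>-part loses \<open>m\<close>, half the degree of \<open>p\<close>
  rounded up. The clause \<open>B = 0\<close> is separate because the zero polynomial has degree 0,
  which matters when \<open>M < m\<close>.\<close>

lemma riemann_roch_basis:
  assumes q: "q \<noteq> 0" "\<And>c. order c q = \<delta> (ord_at c)" "degree q + \<delta> ord_inf = M"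
  shows "z \<in> riemann_roch_space \<iota> (pullback \<delta>) \<longleftrightarrow>
    (\<exists>A B. degree A \<le> M \<and> (B = 0 \<or> degree B + m \<le> M) \<and>
       z = \<pi> (to_fract A / to_fract q) + \<pi> (to_fract B / to_fract q) * y)"
proof
  assume z: "z \<in> riemann_roch_space \<iota> (pullback \<delta>)"
  obtain a b where zab: "z = \<pi> a + \<pi> b * y" using generate by blast
  note R = z[unfolded zab riemann_roch_pullback, rule_format]
  have qz: "to_fract q \<noteq> 0" using q by simp
  have "vge (ord_at c) (- int (\<delta> (ord_at c)) + int (\<delta> (ord_at c))) (a * to_fract q)" for c
    by (rule vge_mult[OF point_valn[OF point_ord_at]])
      (use R[OF point_ord_at[of c]] q in \<open>auto simp: vge_def ord_at_to_fract\<close>)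
  then have "vge (ord_at c) 0 (a * to_fract q)" for c by simp
  then obtain A where A: "a * to_fract q = to_fract A" by (rule ord_at_nonneg_imp_poly)
  have "vge (ord_at c) 0 (b * to_fract q)" for c
  proof (cases "b = 0")
    case False
    have "- 2 * int (\<delta> (ord_at c)) \<le> 2 * ord_at c b + int (order c p)"
      using R[OF point_ord_at[of c]] False p_nz by (simp add: ord_at_to_fract)
    \<comment> \<open>Squarefreeness enters here: an order of \<open>p\<close> of at most 1 is lost
      when the doubled integer inequality is halved.\<close>
    then have "- int (\<delta> (ord_at c)) \<le> ord_at c b" using order_le_1[of c] by linarith
    then show ?thesis
      using False qz q valn_mult[OF point_valn[OF point_ord_at[of c]] False qz] by (simp add: vge_def ord_at_to_fract)
  qed simp
  then obtain B where B: "b * to_fract q = to_fract B" by (rule ord_at_nonneg_imp_poly)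
  have ab: "a = to_fract A / to_fract q" "b = to_fract B / to_fract q"
    using A B qz by (simp_all add: field_simps)
  have "degree A \<le> M"
  proof (cases "A = 0")
    case False
    then have "a \<noteq> 0" using ab qz by simp
    then have "- int (\<delta> ord_inf) \<le> ord_inf a" using R[OF point_ord_inf] by (simp add: vge_def)
    also have "ord_inf a = int (degree q) - int (degree A)"
      unfolding ab using False q(1) by (simp add: Fract_conv_to_fract[symmetric] ord_inf_Fract)
    finally show ?thesis using q(3) by linarith
  qed simp
  moreover have "B = 0 \<or> degree B + m \<le> M"
  proof (cases "B = 0")
    case False
    then have "b \<noteq> 0" using ab qz by simp
    then have "- 2 * int (\<delta> ord_inf) \<le> 2 * ord_inf b - int (degree p)"
      using R[OF point_ord_inf] p_nz by (simp add: ord_inf_to_fract)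
    moreover have "ord_inf b = int (degree q) - int (degree B)"
      unfolding ab using False q(1) by (simp add: Fract_conv_to_fract[symmetric] ord_inf_Fract)
    ultimately have "int (degree p) + 2 * int (degree B) \<le> 2 * int M" using q(3) by linarith
    then show ?thesis unfolding m_def by linarith
  qed simp
  ultimately show "\<exists>A B. degree A \<le> M \<and> (B = 0 \<or> degree B + m \<le> M) \<and>
       z = \<pi> (to_fract A / to_fract q) + \<pi> (to_fract B / to_fract q) * y"
    using zab ab by blast
next
  assume "\<exists>A B. degree A \<le> M \<and> (B = 0 \<or> degree B + m \<le> M) \<and>
       z = \<pi> (to_fract A / to_fract q) + \<pi> (to_fract B / to_fract q) * y"
  then obtain A B where AB: "degree A \<le> M" "B = 0 \<or> degree B + m \<le> M"
    and z: "z = \<pi> (to_fract A / to_fract q) + \<pi> (to_fract B / to_fract q) * y" by blast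
  have q0: "to_fract q \<noteq> 0" using q(1) by simp
  show "z \<in> riemann_roch_space \<iota> (pullback \<delta>)"
    unfolding z riemann_roch_pullback
  proof (intro allI impI)
    fix u :: "'k poly fract \<Rightarrow> int" assume u: "point const_P1 u"
    then show "vge u (- int (\<delta> u)) (to_fract A / to_fract q) \<and>
      (to_fract B / to_fract q = 0 \<or> - 2 * int (\<delta> u) \<le> 2 * u (to_fract B / to_fract q) + u (to_fract p))"
    proof (cases rule: point_P1_cases)
      case (1 c)
      show ?thesis unfolding 1 using q p_nz
        by (auto simp: vge_def Fract_conv_to_fract[symmetric] ord_at_Fract ord_at_to_fract Fract_nonzero)
    next
      case 2
      have "2 * m \<ge> degree p" by (simp add: m_def)
      then show ?thesis unfolding 2 using q p_nz AB
        by (cases "B = 0") (auto simp: vge_def Fract_conv_to_fract[symmetric] ord_inf_Fract ord_inf_to_fract Fract_nonzero)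
    qed
  qed
qed

interpretation L: vector_space "\<lambda>c z. \<iota> c * z"
  by (rule field_hom_vector_space[OF iota_hom])

text \<open>There are M + 1 coefficients for \<open>A\<close> and M - m + 1 for \<open>B\<close>. As
  the divisor has degree 2M, the quantity deg - ell + 1 is m - 1, whatever \<delta> is.\<close>

lemma ell_pullback:
  assumes M: "m \<le> M"
  shows "ell \<iota> (pullback \<delta>) = 2 * M + 2 - m"
    and "\<exists>S. finite S \<and> riemann_roch_space \<iota> (pullback \<delta>) \<subseteq> L.span S"
proof -
  obtain q where q: "q \<noteq> 0" "\<And>c. order c q = \<delta> (ord_at c)" "degree q + \<delta> ord_inf = M"
    using common_denominator by blast
  define I where "I = {..M} <+> {..M - m}"
  define e where "e = case_sum (\<lambda>i. \<pi> (to_fract (monom 1 i) / to_fract q)) (\<lambda>i. \<pi> (to_fract (monom 1 i) / to_fract q) * y)"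
  define P where "P N c = (\<Sum>i\<le>N. monom (c i) i)" for N and c :: "nat \<Rightarrow> 'k"
  have P: "to_fract (P N c) = (\<Sum>i\<le>N. const_P1 (c i) * to_fract (monom 1 i))" for N c
  proof -
    have "to_fract (sum f S) = (\<Sum>i\<in>S. to_fract (f i))" for f :: "nat \<Rightarrow> 'k poly" and S
      by (induction S rule: infinite_finite_induct) auto
    then show ?thesis
      by (simp add: P_def const_P1_to_fract to_fract_mult[symmetric] smult_monom del: to_fract_mult)
  qed
  have sum: "(\<Sum>i\<in>I. \<iota> (c i) * e i) =
      \<pi> (to_fract (P M (\<lambda>i. c (Inl i))) / to_fract q) + \<pi> (to_fract (P (M - m) (\<lambda>i. c (Inr i))) / to_fract q) * y" for c
  proof -
    have "(\<Sum>i\<in>I. \<iota> (c i) * e i) = (\<Sum>i\<le>M. \<iota> (c (Inl i)) * e (Inl i)) + (\<Sum>i\<le>M - m. \<iota> (c (Inr i)) * e (Inr i))"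
      unfolding I_def by (simp add: sum.Plus)
    moreover have "(\<Sum>i\<le>M. \<iota> (c (Inl i)) * e (Inl i)) = \<pi> (to_fract (P M (\<lambda>i. c (Inl i))) / to_fract q)"
      unfolding P by (simp only: sum_divide_distrib field_hom_sum[OF pi_hom] field_hom_divide[OF pi_hom]
        field_hom_mult[OF pi_hom] pi_const e_def sum.case times_divide_eq_right)
    moreover have "(\<Sum>i\<le>M - m. \<iota> (c (Inr i)) * e (Inr i)) = \<pi> (to_fract (P (M - m) (\<lambda>i. c (Inr i))) / to_fract q) * y"
      unfolding P by (simp only: sum_divide_distrib field_hom_sum[OF pi_hom] field_hom_divide[OF pi_hom]
        field_hom_mult[OF pi_hom] pi_const e_def sum.case times_divide_eq_right sum_distrib_right times_divide_eq_left mult.assoc)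
    ultimately show ?thesis by simp
  qed
  have degP: "degree (P N c) \<le> N" for N c
    unfolding P_def by (rule degree_sum_le) (auto intro: degree_monom_le order_trans)
  have coeffP: "coeff (P N c) i = (if i \<le> N then c i else 0)" for N c i
    by (simp add: P_def coeff_sum)
  have PI: "A = P N (coeff A)" if "degree A \<le> N" for A N
    using that by (intro poly_eqI) (auto simp: coeffP coeff_eq_0)
  have expand: "\<exists>c. z = (\<Sum>i\<in>I. \<iota> (c i) * e i)" if "z \<in> riemann_roch_space \<iota> (pullback \<delta>)" for z
  proof -
    obtain A B where AB: "degree A \<le> M" "B = 0 \<or> degree B + m \<le> M"
      and z: "z = \<pi> (to_fract A / to_fract q) + \<pi> (to_fract B / to_fract q) * y"
      using riemann_roch_basis[OF q] \<open>z \<in> _\<close> by blast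
    have "degree B \<le> M - m" using AB(2) by auto
    then have "z = (\<Sum>i\<in>I. \<iota> (case_sum (coeff A) (coeff B) i) * e i)"
      unfolding sum sum.case z using PI[OF AB(1)] PI[of B "M - m"] by simp
    then show ?thesis by (rule exI[of _ "case_sum (coeff A) (coeff B)"])
  qed
  have "L.dim (riemann_roch_space \<iota> (pullback \<delta>)) = card I"
  proof (rule L.dim_eq_card_family[where I = I and e = e])
    show "finite I" by (simp add: I_def)
    show "\<exists>c. z = (\<Sum>i\<in>I. \<iota> (c i) * e i)" if "z \<in> riemann_roch_space \<iota> (pullback \<delta>)" for z
      using that by (rule expand)
  next
    fix i assume "i \<in> I"
    then show "e i \<in> riemann_roch_space \<iota> (pullback \<delta>)"
    proof (cases i)
      case (Inl j)
      then have "e i = \<pi> (to_fract (monom 1 j) / to_fract q) + \<pi> (to_fract 0 / to_fract q) * y"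
        by (simp add: e_def field_hom_0[OF pi_hom])
      moreover have "degree (monom 1 j :: 'k poly) \<le> M" using Inl \<open>i \<in> I\<close> by (auto simp: I_def degree_monom_eq)
      ultimately show ?thesis unfolding riemann_roch_basis[OF q] by blast
    next
      case (Inr j)
      then have "e i = \<pi> (to_fract 0 / to_fract q) + \<pi> (to_fract (monom 1 j) / to_fract q) * y"
        by (simp add: e_def field_hom_0[OF pi_hom])
      moreover have "degree (monom 1 j :: 'k poly) + m \<le> M" using Inr \<open>i \<in> I\<close> M by (auto simp: I_def degree_monom_eq)
      moreover have "degree (0 :: 'k poly) \<le> M" by simp
      ultimately show ?thesis unfolding riemann_roch_basis[OF q] by blast
    qed
  next
    fix c i assume "(\<Sum>i\<in>I. \<iota> (c i) * e i) = 0" and i: "i \<in> I"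
    then have "P M (\<lambda>i. c (Inl i)) = 0" "P (M - m) (\<lambda>i. c (Inr i)) = 0"
      using q(1) by (simp_all add: sum coords_eq_0)
    then have "\<forall>j\<le>M. c (Inl j) = 0" "\<forall>j\<le>M - m. c (Inr j) = 0"
      using coeffP[of M "\<lambda>i. c (Inl i)"] coeffP[of "M - m" "\<lambda>i. c (Inr i)"] by (metis coeff_0)+
    with i show "c i = 0" by (auto simp: I_def)
  qed
  moreover have "card I = 2 * M + 2 - m" using M by (simp add: I_def card_Plus)
  ultimately show "ell \<iota> (pullback \<delta>) = 2 * M + 2 - m" by (simp add: ell_def)
  have "riemann_roch_space \<iota> (pullback \<delta>) \<subseteq> L.span (e ` I)"
  proof
    fix z assume "z \<in> riemann_roch_space \<iota> (pullback \<delta>)"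
    then obtain c where z: "z = (\<Sum>i\<in>I. \<iota> (c i) * e i)" using expand by blast
    show "z \<in> L.span (e ` I)" unfolding z by (intro L.span_sum L.span_scale L.span_base imageI)
  qed
  then show "\<exists>S. finite S \<and> riemann_roch_space \<iota> (pullback \<delta>) \<subseteq> L.span S"
    by (intro exI[of _ "e ` I"]) (simp add: I_def)
qed

text \<open>When \<open>M < m\<close>, no degree is admissible for a nonzero \<open>B\<close>, so
  the \<open>y\<close>-part is absent.\<close>

lemma riemann_roch_small:
  assumes "M < m" "z \<in> riemann_roch_space \<iota> (pullback \<delta>)"
  shows "z \<in> range \<pi>"
proof -
  obtain q where q: "q \<noteq> 0" "\<And>c. order c q = \<delta> (ord_at c)" "degree q + \<delta> ord_inf = M"
    using common_denominator by blast
  obtain A where "z = \<pi> (to_fract A / to_fract q) + \<pi> (to_fract 0 / to_fract q) * y"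
    using assms riemann_roch_basis[OF q] by auto
  then show ?thesis by (simp add: field_hom_0[OF pi_hom])
qed

end

interpretation L: vector_space "\<lambda>c z. \<iota> c * z"
  by (rule field_hom_vector_space[OF iota_hom])

text \<open>Every divisor lies below a pullback of large degree, where deg - ell + 1 is exactly m -
  1, and deg - ell is monotone.\<close>

lemma degree_minus_ell_le:
  assumes D: "divisor \<iota> D"
  shows "div_degree D - int (ell \<iota> D) + 1 \<le> int m - 1"
proof -
  define SD where "SD = {v. D v \<noteq> 0}"
  have fin: "finite SD" and pts: "\<And>v. v \<in> SD \<Longrightarrow> point \<iota> v" using D by (auto simp: SD_def divisor_def)
  \<comment> \<open>The sum over the fiber dominates \<open>D\<close> at each of its points; the
    extra \<open>m\<close> at infinity makes the degree large enough for
    \<open>ell_pullback\<close>.\<close>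
  define \<delta> where "\<delta> u = (\<Sum>v | v \<in> SD \<and> im v = u. nat \<bar>D v\<bar>) + (if u = ord_inf then m else 0)" for u
  define U where "U = insert ord_inf (im ` SD)"
  have finU: "finite U" using fin by (simp add: U_def)
  have ptsU: "point const_P1 u" if "u \<in> U" for u
    using that lies_over_im(2) pts point_ord_inf by (auto simp: U_def)
  have supp: "u \<in> U" if "\<delta> u \<noteq> 0" for u
  proof (rule ccontr)
    assume "u \<notin> U"
    then have "{v. v \<in> SD \<and> im v = u} = {}" "u \<noteq> ord_inf" by (auto simp: U_def)
    with that show False unfolding \<delta>_def by simp
  qed
  have Mm: "m \<le> sum \<delta> U"
  proof -
    have "m \<le> \<delta> ord_inf" by (simp add: \<delta>_def)
    also have "\<dots> \<le> sum \<delta> U" by (rule member_le_sum) (use finU in \<open>auto simp: U_def\<close>)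
    finally show ?thesis .
  qed
  note pb = pullback_divisor[OF finU ptsU supp]
  have le: "D v \<le> pullback \<delta> v" for v
  proof (cases "v \<in> SD")
    case True
    have "nat \<bar>D v\<bar> \<le> (\<Sum>v' | v' \<in> SD \<and> im v' = im v. nat \<bar>D v'\<bar>)"
      by (rule member_le_sum) (use fin True in auto)
    then have "nat \<bar>D v\<bar> \<le> \<delta> (im v)" by (simp add: \<delta>_def)
    then have "D v \<le> int (\<delta> (im v))" by linarith
    also have "\<dots> \<le> int (ram v) * int (\<delta> (im v))"
      using ram_pos[OF pts[OF True]] by (simp add: mult_le_cancel_right1)
    finally show ?thesis using pts[OF True] by (simp add: pullback_def)
  next
    case False
    then show ?thesis by (simp add: SD_def pullback_def)
  qed
  obtain S where S: "finite S" "riemann_roch_space \<iota> (pullback \<delta>) \<subseteq> L.span S"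
    using ell_pullback(2)[OF finU ptsU supp Mm] by blast
  have "div_degree D - int (ell \<iota> D) \<le> div_degree (pullback \<delta>) - int (ell \<iota> (pullback \<delta>))"
    by (rule ell_mono_degree[OF D pb(1) le S(2,1)])
  also have "\<dots> = int m - 2"
    using pb(2) ell_pullback(1)[OF finU ptsU supp Mm] Mm by (simp add: of_nat_diff)
  finally show ?thesis by simp
qed

lemma degree_minus_ell_attained:
  "\<exists>D. divisor \<iota> D \<and> div_degree D - int (ell \<iota> D) + 1 = int m - 1"
proof -
  define \<delta> :: "('k poly fract \<Rightarrow> int) \<Rightarrow> nat" where "\<delta> u = (if u = ord_inf then m else 0)" for u
  have U: "finite {ord_inf :: 'k poly fract \<Rightarrow> int}" "\<And>u. u \<in> {ord_inf} \<Longrightarrow> point const_P1 (u :: 'k poly fract \<Rightarrow> int)"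
    "\<And>u. \<delta> u \<noteq> 0 \<Longrightarrow> u \<in> {ord_inf}" "sum \<delta> {ord_inf} = m"
    using point_ord_inf by (auto simp: \<delta>_def split: if_splits)
  show ?thesis
    using pullback_divisor[OF U(1-3)] ell_pullback(1)[OF U(1-3)] U(4)
    by (intro exI[of _ "pullback \<delta>"]) (simp add: of_nat_diff)
qed

lemma has_genus_iff: "has_genus \<iota> g \<longleftrightarrow> g = int m - 1"
proof
  assume g: "has_genus \<iota> g"
  obtain D where "divisor \<iota> D" "div_degree D - int (ell \<iota> D) + 1 = int m - 1"
    using degree_minus_ell_attained by blast
  then have "int m - 1 \<le> g" using g unfolding has_genus_def by metis
  moreover obtain D' where "divisor \<iota> D'" "div_degree D' - int (ell \<iota> D') + 1 = g"
    using g unfolding has_genus_def by blast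
  then have "g \<le> int m - 1" using degree_minus_ell_le[of D'] by simp
  ultimately show "g = int m - 1" by simp
qed (use degree_minus_ell_le degree_minus_ell_attained in \<open>auto simp: has_genus_def\<close>)

end

section \<open>Genus and branch points of an arbitrary double cover\<close>

context double_cover
begin

text \<open>Dividing \<open>y\<close> by the image of \<open>r\<close> removes the square factor of
  \<open>F\<close> and changes no parity of an order.\<close>

lemma squarefree_model:
  obtains p y' where "squarefree_double_cover \<iota> \<pi> y' p w" "odd_points (to_fract p) = odd_points F"
proof -
  obtain p r where pr: "p \<noteq> 0" "\<And>c. order c p \<le> 1" "r \<noteq> 0" "F = to_fract p * r\<^sup>2"
    using squarefree_part[OF F_nz] by blast
  have rz: "\<pi> r \<noteq> 0" using pr(3) pi_hom by simp
  have "squarefree_double_cover \<iota> \<pi> (y / \<pi> r) p w"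
  proof unfold_locales
    show "(y / \<pi> r)\<^sup>2 = \<pi> (to_fract p)"
      using rz by (simp add: power_divide y2 pr(4) field_hom_mult[OF pi_hom] field_hom_power[OF pi_hom])
    show "y / \<pi> r \<notin> range \<pi>"
    proof
      assume "y / \<pi> r \<in> range \<pi>"
      then obtain a where "y / \<pi> r = \<pi> a" by blast
      then have "y = \<pi> (a * r)" using rz by (simp add: field_hom_mult[OF pi_hom] field_simps)
      then show False using y_notin by blast
    qed
    fix z
    obtain a b where "z = \<pi> a + \<pi> b * y" using generate by blast
    then have "z = \<pi> a + \<pi> (b * r) * (y / \<pi> r)" using rz by (simp add: field_hom_mult[OF pi_hom])
    then show "\<exists>a b. z = \<pi> a + \<pi> b * (y / \<pi> r)" by blast
  qed (use cov w_hom w_pi w_y pr in \<open>auto simp: field_hom_divide[OF w_hom]\<close>)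
  moreover have "odd_points (to_fract p) = odd_points F"
    using pr(1,3) by (auto simp: odd_points_def pr(4) valn_mult[OF point_valn] valn_power[OF point_valn])
  ultimately show ?thesis using that by blast
qed

lemma genus_odd_points:
  assumes "has_genus \<iota> g"
  shows "finite (odd_points F)" "int (card (odd_points F)) = 2 * g + 2"
proof -
  obtain p y' where "squarefree_double_cover \<iota> \<pi> y' p w" and eq: "odd_points (to_fract p) = odd_points F"
    using squarefree_model .
  then interpret S: squarefree_double_cover \<iota> \<pi> y' p w by simp
  show "finite (odd_points F)" "int (card (odd_points F)) = 2 * g + 2"
    using S.card_odd_points assms S.has_genus_iff unfolding eq by simp_all
qed

text \<open>The poles are bounded by the pullback of the single point \<open>u\<close>, so M = 1,
  while positive genus means m > 1: there is no room for a \<open>y\<close>-part. This is what keeps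
  distinct conjugate points from being linearly equivalent.\<close>

lemma one_fiber_poles_descend:
  assumes g: "has_genus \<iota> g" "g > 0" and u: "point const_P1 u"
    and z: "\<And>v. point \<iota> v \<Longrightarrow> im v \<noteq> u \<Longrightarrow> vge v 0 z" "\<And>v. point \<iota> v \<Longrightarrow> im v = u \<Longrightarrow> vge v (-1) z"
  shows "z \<in> range \<pi>"
proof -
  obtain p y' where "squarefree_double_cover \<iota> \<pi> y' p w"
    using squarefree_model .
  then interpret S: squarefree_double_cover \<iota> \<pi> y' p w by simp
  have m: "1 < S.m" using g S.has_genus_iff by simp
  define \<delta> :: "('k poly fract \<Rightarrow> int) \<Rightarrow> nat" where "\<delta> u' = (if u' = u then 1 else 0)" for u'
  have "z \<in> riemann_roch_space \<iota> (pullback \<delta>)"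
    unfolding riemann_roch_space_iff
  proof (intro allI impI)
    fix v assume v: "point \<iota> v"
    have "1 \<le> ram v" using ram_pos[OF v] by simp
    then show "vge v (- pullback \<delta> v) z"
      using z[OF v] v vge_mono[of v "-1" z "- int (ram v)"] by (cases "im v = u") (auto simp: pullback_def \<delta>_def)
  qed
  then show ?thesis
    by (intro S.riemann_roch_small[of "{u}" \<delta>]) (use u m in \<open>auto simp: \<delta>_def split: if_splits\<close>)
qed

end

section \<open>Coverings of the line by the line\<close>

lemma coprime_representation:
  fixes z :: "'k::field poly fract"
  obtains f g where "z = to_fract f / to_fract g" "g \<noteq> 0" "\<And>c. poly f c \<noteq> 0 \<or> poly g c \<noteq> 0"
proof -
  obtain a b where "z = Fract a b" "b \<noteq> 0" by (cases z) auto
  then have "\<exists>f g. z = Fract f g \<and> g \<noteq> 0 \<and> (\<forall>c. poly f c \<noteq> 0 \<or> poly g c \<noteq> 0)"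
  proof (induction "degree b" arbitrary: a b rule: less_induct)
    case less
    show ?case
    proof (cases "\<forall>c. poly a c \<noteq> 0 \<or> poly b c \<noteq> 0")
      case True
      with less.prems show ?thesis by blast
    next
      case False
      then obtain c where "poly a c = 0" "poly b c = 0" by blast
      then obtain a' b' where ab: "a = [:-c, 1:] * a'" "b = [:-c, 1:] * b'"
        by (auto simp: poly_eq_0_iff_dvd elim!: dvdE)
      have b': "b' \<noteq> 0" using ab less.prems by auto
      have "z = Fract a' b'" unfolding less.prems(1) ab by (rule mult_fract_cancel) simp
      moreover have "degree b' < degree b" unfolding ab using b' by (subst degree_mult_eq) auto
      ultimately show ?thesis using less.hyps b' by blast
    qed
  qed
  with that show ?thesis by (auto simp: Fract_conv_to_fract)
qed

text \<open>A covering of the line by itself is the substitution of a rational function for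
  \<open>X\<close>, here written in lowest terms as f/g.\<close>

locale P1_covering =
  fixes \<phi> :: "'k::{alg_closed_field, field_char_0} poly fract \<Rightarrow> 'k poly fract" and f g :: "'k poly"
  assumes cov: "covering const_P1 const_P1 \<phi>"
    and phi_X: "\<phi> (to_fract [:0, 1:]) = to_fract f / to_fract g"
    and g_nz: "g \<noteq> 0"
    and no_common_root: "\<And>c. poly f c \<noteq> 0 \<or> poly g c \<noteq> 0"
begin

lemma phi_hom: "field_hom \<phi>"
  using cov by (rule covering_hom)

lemma phi_const: "\<phi> (const_P1 c) = const_P1 c"
  using cov by (rule covering_const)

lemma phi_linear: "\<phi> (to_fract [:-c, 1:]) = to_fract (f - smult c g) / to_fract g"
proof -
  have "to_fract (smult c g) = const_P1 c * to_fract g"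
    by (simp add: const_P1_to_fract to_fract_mult[symmetric] del: to_fract_mult)
  then show ?thesis using g_nz
    by (simp add: to_fract_linear field_hom_diff[OF phi_hom] phi_X phi_const field_simps)
qed

text \<open>Its roots, with multiplicities, are the finite points of the fiber over
  \<open>u\<close>; the amount by which its degree falls short of \<open>d\<close> is the
  multiplicity of infinity in that fiber.\<close>

definition fiber_poly :: "('k poly fract \<Rightarrow> int) \<Rightarrow> 'k poly" where
  "fiber_poly u = (if u = ord_inf then g else f - smult (THE c. u = ord_at c) g)"

lemma fiber_poly_simps [simp]: "fiber_poly ord_inf = g" "fiber_poly (ord_at c) = f - smult c g"
  by (simp_all add: fiber_poly_def)

lemma phi_linear_nz: "f - smult c g \<noteq> 0"
proof
  assume "f - smult c g = 0"
  then have "\<phi> (to_fract [:-c, 1:]) = 0" by (simp add: phi_linear)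
  then have "to_fract [:-c, 1:] = (0 :: 'k poly fract)" using field_hom_eq_0[OF phi_hom] by blast
  then show False by simp
qed

lemma fiber_poly_nz:
  assumes "point const_P1 u"
  shows "fiber_poly u \<noteq> 0"
  using assms by (cases rule: point_P1_cases) (use g_nz phi_linear_nz in auto)

definition d :: nat where "d = max (degree f) (degree g)"

lemma d_pos: "d > 0"
proof (rule ccontr)
  assume "\<not> d > 0"
  then have "degree f = 0" "degree g = 0" by (auto simp: d_def)
  then obtain a b where ab: "f = [:a:]" "g = [:b:]" by (metis degree_eq_zeroE)
  then have "b \<noteq> 0" using g_nz by auto
  then have "f - smult (a / b) g = 0" by (simp add: ab)
  then show False using phi_linear_nz by blast
qed

lemma degree_fiber_poly_le:
  assumes "point const_P1 u"
  shows "degree (fiber_poly u) \<le> d"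
  using assms
proof (cases rule: point_P1_cases)
  case (1 c)
  have "degree (f - smult c g) \<le> d"
    by (rule degree_diff_le) (use degree_smult_le[of c g] in \<open>auto simp: d_def\<close>)
  then show ?thesis by (simp add: 1)
qed (simp add: d_def)

lemma lies_over_at:
  assumes u: "point const_P1 u" and c: "poly (fiber_poly u) c = 0"
  shows "lies_over \<phi> (ord_at c) (order c (fiber_poly u)) u"
proof -
  note v = valn_covering[OF point_valn[OF point_ord_at[of c]] cov]
  have pos: "order c (fiber_poly u) > 0" using c fiber_poly_nz[OF u] by (simp add: order_root)
  from u show ?thesis
  proof (cases rule: point_P1_cases)
    case (1 l)
    then have "poly g c \<noteq> 0" using c no_common_root[of c] by auto
    then have "ord_at c (\<phi> (to_fract [:-l, 1:])) = int (order c (fiber_poly u))"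
      using phi_linear_nz g_nz
      by (simp add: 1 phi_linear valn_divide[OF point_valn[OF point_ord_at]] ord_at_to_fract order_0I
          del: to_fract_diff)
    then show ?thesis
      using P1_valuation_at_finite[OF v, of l] pos by (simp add: lies_over_def 1)
  next
    case 2
    then have fc: "poly f c \<noteq> 0" using c no_common_root[of c] by auto
    then have "f \<noteq> 0" by auto
    then have "ord_at c (\<phi> (to_fract [:0, 1:])) = - int (order c (fiber_poly u))"
      using fc g_nz by (simp add: 2 phi_X valn_divide[OF point_valn[OF point_ord_at]] ord_at_to_fract order_0I)
    then show ?thesis
      using P1_valuation_at_infinity[OF v] pos by (simp add: lies_over_def 2)
  qed
qed

lemma lies_over_inf:
  assumes u: "point const_P1 u" and deg: "degree (fiber_poly u) < d"
  shows "lies_over \<phi> ord_inf (d - degree (fiber_poly u)) u"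
proof -
  note v = valn_covering[OF point_valn[OF point_ord_inf] cov]
  from u show ?thesis
  proof (cases rule: point_P1_cases)
    case (1 l)
    have "degree g = d"
    proof (rule ccontr)
      assume "degree g \<noteq> d"
      then have "degree g < degree f" "degree f = d" by (auto simp: d_def max_def split: if_splits)
      then have "degree (f + - smult l g) = d" using degree_smult_le[of l g] by (subst degree_add_eq_left) auto
      then show False using deg 1 by simp
    qed
    then have "ord_inf (\<phi> (to_fract [:-l, 1:])) = int (d - degree (fiber_poly u))"
      using phi_linear_nz g_nz deg
      by (simp add: 1 phi_linear valn_divide[OF point_valn[OF point_ord_inf]] ord_inf_to_fract of_nat_diff
          del: to_fract_diff)
    then show ?thesis
      using P1_valuation_at_finite[OF v, of l] deg by (simp add: lies_over_def 1)
  next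
    case 2
    then have fd: "degree f = d" using deg by (auto simp: d_def)
    then have "f \<noteq> 0" using d_pos by auto
    then have "ord_inf (\<phi> (to_fract [:0, 1:])) = - int (d - degree (fiber_poly u))"
      using fd g_nz deg by (simp add: 2 phi_X valn_divide[OF point_valn[OF point_ord_inf]] ord_inf_to_fract of_nat_diff)
    then show ?thesis
      using P1_valuation_at_infinity[OF v] deg by (simp add: lies_over_def 2)
  qed
qed

lemma point_below_at:
  obtains u where "point const_P1 u" "poly (fiber_poly u) c = 0"
proof (cases "poly g c = 0")
  case True
  then show ?thesis using that[OF point_ord_inf] by simp
next
  case False
  then show ?thesis using that[OF point_ord_at[of "poly f c / poly g c"]] by simp
qed

lemma point_below_inf:
  obtains u where "point const_P1 u" "degree (fiber_poly u) < d"
proof (cases "degree g < d")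
  case True
  then show ?thesis using that[OF point_ord_inf] by simp
next
  case False
  then have g: "degree g = d" by (simp add: d_def)
  define l where "l = coeff f d / coeff g d"
  have "coeff g d \<noteq> 0" unfolding g[symmetric] using g_nz by simp
  then have "coeff (f - smult l g) d = 0" by (simp add: l_def)
  moreover have "degree (f - smult l g) \<le> d"
    using degree_fiber_poly_le[OF point_ord_at[of l]] by simp
  ultimately have "degree (f - smult l g) < d"
    using phi_linear_nz by (metis leading_coeff_0_iff le_neq_implies_less)
  then show ?thesis using that[OF point_ord_at[of l]] by simp
qed

abbreviation "ram \<equiv> ram_index \<phi>"
abbreviation "im \<equiv> image_point \<phi>"

lemma im_ram_at:
  assumes "point const_P1 u"
  shows "im (ord_at c) = u \<longleftrightarrow> poly (fiber_poly u) c = 0"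
    and "poly (fiber_poly u) c = 0 \<Longrightarrow> ram (ord_at c) = order c (fiber_poly u)"
proof -
  have *: "im (ord_at c) = u \<and> ram (ord_at c) = order c (fiber_poly u)"
    if "point const_P1 u" "poly (fiber_poly u) c = 0" for u
    using lies_over_point_unique[OF that(1) lies_over_at[OF that]] by simp
  obtain u' where u': "point const_P1 u'" "poly (fiber_poly u') c = 0" using point_below_at by blast
  show "im (ord_at c) = u \<longleftrightarrow> poly (fiber_poly u) c = 0" using *[OF u'] u' *[OF assms] by auto
  show "poly (fiber_poly u) c = 0 \<Longrightarrow> ram (ord_at c) = order c (fiber_poly u)" using *[OF assms] by simp
qed

lemma im_ram_inf:
  assumes "point const_P1 u"
  shows "im ord_inf = u \<longleftrightarrow> degree (fiber_poly u) < d"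
    and "degree (fiber_poly u) < d \<Longrightarrow> ram ord_inf = d - degree (fiber_poly u)"
proof -
  have *: "im ord_inf = u \<and> ram ord_inf = d - degree (fiber_poly u)"
    if "point const_P1 u" "degree (fiber_poly u) < d" for u
    using lies_over_point_unique[OF that(1) lies_over_inf[OF that]] by simp
  obtain u' where u': "point const_P1 u'" "degree (fiber_poly u') < d" using point_below_inf by blast
  show "im ord_inf = u \<longleftrightarrow> degree (fiber_poly u) < d" using *[OF u'] u' *[OF assms] by auto
  show "degree (fiber_poly u) < d \<Longrightarrow> ram ord_inf = d - degree (fiber_poly u)" using *[OF assms] by simp
qed

lemma lies_over_im:
  assumes v: "point const_P1 v"
  shows "lies_over \<phi> v (ram v) (im v)" "point const_P1 (im v)"
proof -
  have "lies_over \<phi> v (ram v) (im v) \<and> point const_P1 (im v)"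
    using v
  proof (cases rule: point_P1_cases)
    case (1 c)
    obtain u where u: "point const_P1 u" "poly (fiber_poly u) c = 0" using point_below_at by blast
    then show ?thesis using lies_over_at[OF u] im_ram_at[OF u(1), of c] 1 by auto
  next
    case 2
    obtain u where u: "point const_P1 u" "degree (fiber_poly u) < d" using point_below_inf by blast
    then show ?thesis using lies_over_inf[OF u] im_ram_inf[OF u(1)] 2 by auto
  qed
  then show "lies_over \<phi> v (ram v) (im v)" "point const_P1 (im v)" by auto
qed

lemma v_phi: "point const_P1 v \<Longrightarrow> v (\<phi> z) = int (ram v) * im v z"
  using lies_over_im(1) by (simp add: lies_over_def)

lemma ram_pos: "point const_P1 v \<Longrightarrow> ram v > 0"
  using lies_over_im(1) by (simp add: lies_over_def)

lemma fiber_eq: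
  assumes u: "point const_P1 u"
  shows "fiber const_P1 \<phi> u =
    ord_at ` {c. poly (fiber_poly u) c = 0} \<union> (if degree (fiber_poly u) < d then {ord_inf} else {})"
proof (intro set_eqI iffI)
  fix v assume "v \<in> fiber const_P1 \<phi> u"
  then have v: "point const_P1 v" "im v = u" by (auto simp: fiber_def)
  from v(1) show "v \<in> ord_at ` {c. poly (fiber_poly u) c = 0} \<union> (if degree (fiber_poly u) < d then {ord_inf} else {})"
    by (cases rule: point_P1_cases) (use v(2) im_ram_at(1)[OF u] im_ram_inf(1)[OF u] in auto)
next
  fix v assume "v \<in> ord_at ` {c. poly (fiber_poly u) c = 0} \<union> (if degree (fiber_poly u) < d then {ord_inf} else {})"
  then show "v \<in> fiber const_P1 \<phi> u"
    using im_ram_at(1)[OF u] im_ram_inf(1)[OF u]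
    by (auto simp: fiber_def point_ord_at point_ord_inf split: if_splits)
qed

lemma sum_ram_fiber:
  assumes u: "point const_P1 u"
  shows "finite (fiber const_P1 \<phi> u)" "(\<Sum>v\<in>fiber const_P1 \<phi> u. ram v) = d"
proof -
  let ?R = "{c. poly (fiber_poly u) c = 0}"
  note nz = fiber_poly_nz[OF u]
  have fin: "finite ?R" using nz by (rule poly_roots_finite)
  then show "finite (fiber const_P1 \<phi> u)" by (simp add: fiber_eq[OF u])
  have inj: "inj_on ord_at ?R" by (auto intro: inj_onI)
  have "(\<Sum>v\<in>ord_at ` ?R. ram v) = (\<Sum>c\<in>?R. order c (fiber_poly u))"
    using im_ram_at(2)[OF u] by (simp add: sum.reindex[OF inj])
  also have "\<dots> = degree (fiber_poly u)" by (rule sum_order_eq_degree[OF nz fin subset_refl])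
  finally have s: "(\<Sum>v\<in>ord_at ` ?R. ram v) = degree (fiber_poly u)" .
  show "(\<Sum>v\<in>fiber const_P1 \<phi> u. ram v) = d"
  proof (cases "degree (fiber_poly u) < d")
    case True
    have "ord_inf \<notin> ord_at ` ?R" by auto
    then show ?thesis using True s fin im_ram_inf(2)[OF u True] by (simp add: fiber_eq[OF u])
  next
    case False
    then show ?thesis using s degree_fiber_poly_le[OF u] by (simp add: fiber_eq[OF u])
  qed
qed

text \<open>The numerator of the derivative of p/q, so its zeros locate the ramification.\<close>

definition wronskian :: "'k poly \<Rightarrow> 'k poly \<Rightarrow> 'k poly" where
  "wronskian p q = pderiv p * q - p * pderiv q"

text \<open>In characteristic 0, where p vanishes to order e, the term p' q vanishes to order
  exactly e - 1 and p q' to order at least e, so the first term decides.\<close>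

lemma order_wronskian:
  assumes p: "p \<noteq> 0" "poly p c = 0" and q: "poly q c \<noteq> 0"
  shows "wronskian p q \<noteq> 0" "order c (wronskian p q) = order c p - 1"
proof -
  note v = point_valn[OF point_ord_at[of c]]
  have op: "order c p \<noteq> 0" using p by (simp add: order_root)
  have p': "pderiv p \<noteq> 0"
  proof
    assume "pderiv p = 0"
    then have "degree p = 0" by (simp add: pderiv_eq_0_iff)
    then obtain a where "p = [:a:]" by (rule degree_eq_zeroE)
    with p show False by simp
  qed
  have o: "order c p = Suc (order c (pderiv p))" using order_pderiv[OF p] by simp
  have q0: "q \<noteq> 0" using q by auto
  have pq: "to_fract (pderiv p * q) \<noteq> 0" using p' q0 by simp
  have v1: "ord_at c (to_fract (pderiv p * q)) = int (order c p) - 1"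
    using p' q0 q o by (simp add: ord_at_to_fract order_mult order_0I del: to_fract_mult)
  have "vge (ord_at c) (ord_at c (to_fract (pderiv p * q)) + 1) (- to_fract (p * pderiv q))"
  proof (cases "pderiv q = 0")
    case False
    then show ?thesis unfolding v1 vge_minus[OF v] using p by (simp add: vge_def ord_at_to_fract order_mult del: to_fract_mult)
  qed simp
  from valn_add_dominant[OF v pq this]
  have w: "to_fract (wronskian p q) \<noteq> 0" "ord_at c (to_fract (wronskian p q)) = int (order c p) - 1"
    unfolding v1 by (simp_all add: wronskian_def)
  then show nz: "wronskian p q \<noteq> 0" by simp
  show "order c (wronskian p q) = order c p - 1" using w(2) nz o by (simp add: ord_at_to_fract)
qed

text \<open>The top coefficients of the two terms cannot cancel: their difference carries the factor
  deg p - deg q, nonzero in characteristic 0.\<close>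

lemma degree_wronskian:
  assumes p: "p \<noteq> 0" and lt: "degree p < degree q"
  shows "degree (wronskian p q) = degree p + degree q - 1"
proof (rule antisym)
  have "degree (pderiv p * q) \<le> degree p + degree q - 1"
  proof (cases "degree p = 0")
    case True
    then show ?thesis by (simp add: pderiv_eq_0_iff[THEN iffD2])
  next
    case False
    then show ?thesis using degree_mult_le[of "pderiv p" q] by (simp add: degree_pderiv)
  qed
  moreover have "degree (p * pderiv q) \<le> degree p + degree q - 1"
    using degree_mult_le[of p "pderiv q"] lt by (simp add: degree_pderiv)
  ultimately show "degree (wronskian p q) \<le> degree p + degree q - 1"
    unfolding wronskian_def by (rule degree_diff_le)
  have q0: "lead_coeff q \<noteq> 0" using lt by auto
  have c2: "coeff (p * pderiv q) (degree p + degree q - 1) = of_nat (degree q) * lead_coeff p * lead_coeff q"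
    using coeff_mult_degree_sum[of p "pderiv q"] lt
    by (simp add: degree_pderiv coeff_pderiv)
  have c1: "coeff (pderiv p * q) (degree p + degree q - 1) = of_nat (degree p) * lead_coeff p * lead_coeff q"
  proof (cases "degree p = 0")
    case True
    then show ?thesis by (simp add: pderiv_eq_0_iff[THEN iffD2])
  next
    case False
    then show ?thesis using coeff_mult_degree_sum[of "pderiv p" q]
      by (simp add: degree_pderiv coeff_pderiv)
  qed
  have "coeff (wronskian p q) (degree p + degree q - 1) =
    (of_nat (degree p) - of_nat (degree q)) * lead_coeff p * lead_coeff q"
    unfolding wronskian_def coeff_diff c1 c2 by (simp add: algebra_simps)
  also have "\<dots> \<noteq> 0" using p q0 lt by simp
  finally show "degree p + degree q - 1 \<le> degree (wronskian p q)" by (rule le_degree)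
qed

text \<open>Up to sign the Wronskian is unchanged when \<open>f\<close> is replaced by f - l g and
  when the two are swapped. So on each fiber it may be computed from the fiber polynomial and a
  partner that does not vanish there and has full degree if infinity belongs to the fiber.\<close>

lemma wronskian_fiber_poly:
  assumes "point const_P1 u"
  obtains q where "wronskian f g = wronskian (fiber_poly u) q \<or> wronskian f g = - wronskian (fiber_poly u) q"
    "\<And>c. poly (fiber_poly u) c = 0 \<Longrightarrow> poly q c \<noteq> 0" "degree (fiber_poly u) < d \<Longrightarrow> degree q = d"
  using assms
proof (cases rule: point_P1_cases)
  case (1 l)
  have "wronskian f g = wronskian (fiber_poly u) g"
    by (simp add: 1 wronskian_def pderiv_diff pderiv_smult algebra_simps)
  moreover have "poly g c \<noteq> 0" if "poly (fiber_poly u) c = 0" for c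
    using that no_common_root[of c] by (auto simp: 1)
  moreover have "degree g = d" if "degree (fiber_poly u) < d"
  proof (rule ccontr)
    assume "degree g \<noteq> d"
    then have "degree g < degree f" "degree f = d" by (auto simp: d_def max_def split: if_splits)
    then have "degree (f + - smult l g) = d" using degree_smult_le[of l g] by (subst degree_add_eq_left) auto
    then show False using that 1 by simp
  qed
  ultimately show ?thesis using that by blast
next
  case 2
  have "wronskian f g = - wronskian (fiber_poly u) f" by (simp add: 2 wronskian_def algebra_simps)
  moreover have "poly f c \<noteq> 0" if "poly (fiber_poly u) c = 0" for c
    using that no_common_root[of c] by (auto simp: 2)
  moreover have "degree f = d" if "degree (fiber_poly u) < d" using that by (auto simp: 2 d_def)
  ultimately show ?thesis using that by blast
qed

lemma wronskian_nz: "wronskian f g \<noteq> 0" and order_wronskian_eq: "order c (wronskian f g) = ram (ord_at c) - 1"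
proof -
  have *: "wronskian f g \<noteq> 0 \<and> order c (wronskian f g) = ram (ord_at c) - 1" for c
  proof -
    obtain u where u: "point const_P1 u" "poly (fiber_poly u) c = 0" using point_below_at by blast
    obtain q where q: "wronskian f g = wronskian (fiber_poly u) q \<or> wronskian f g = - wronskian (fiber_poly u) q"
      "\<And>c. poly (fiber_poly u) c = 0 \<Longrightarrow> poly q c \<noteq> 0" using wronskian_fiber_poly[OF u(1)] by metis
    from order_wronskian[OF fiber_poly_nz[OF u(1)] u(2) q(2)[OF u(2)]] q(1) im_ram_at(2)[OF u]
    show ?thesis by auto
  qed
  show "wronskian f g \<noteq> 0" "order c (wronskian f g) = ram (ord_at c) - 1" using * by auto
qed

text \<open>Infinity is invisible among the roots of the Wronskian; its contribution to
  Riemann-Hurwitz appears as the defect of the degree from 2d - 2.\<close>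

lemma degree_wronskian_eq: "degree (wronskian f g) + ram ord_inf = 2 * d - 1"
proof -
  obtain u where u: "point const_P1 u" "degree (fiber_poly u) < d" using point_below_inf by blast
  obtain q where q: "wronskian f g = wronskian (fiber_poly u) q \<or> wronskian f g = - wronskian (fiber_poly u) q"
    "degree q = d" using wronskian_fiber_poly[OF u(1)] u(2) by metis
  then have "degree (wronskian f g) = degree (wronskian (fiber_poly u) q)" by auto
  also have "\<dots> = degree (fiber_poly u) + d - 1"
    using degree_wronskian[OF fiber_poly_nz[OF u(1)], of q] u(2) q(2) by simp
  finally show ?thesis using im_ram_inf(2)[OF u] u(2) by simp
qed

theorem riemann_hurwitz:
  "finite (ramification_points const_P1 \<phi>)"
  "(\<Sum>v\<in>ramification_points const_P1 \<phi>. ram v - 1) = 2 * d - 2"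
proof -
  let ?W = "wronskian f g"
  let ?R = "{c. poly ?W c = 0}"
  have finR: "finite ?R" using wronskian_nz by (rule poly_roots_finite)
  have sub: "ramification_points const_P1 \<phi> \<subseteq> insert ord_inf (ord_at ` ?R)"
  proof
    fix v assume "v \<in> ramification_points const_P1 \<phi>"
    then have v: "point const_P1 v" "ram v > 1" by (auto simp: ramification_points_def)
    from v(1) show "v \<in> insert ord_inf (ord_at ` ?R)"
    proof (cases rule: point_P1_cases)
      case (1 c)
      then have "order c ?W \<noteq> 0" using v(2) by (simp add: order_wronskian_eq)
      then have "poly ?W c = 0" by (simp add: order_root)
      then show ?thesis using 1 by simp
    qed simp
  qed
  with finR show "finite (ramification_points const_P1 \<phi>)" by (meson finite_imageI finite_insert finite_subset)
  have inj: "inj_on ord_at ?R" by (auto intro: inj_onI)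
  have "(\<Sum>v\<in>ramification_points const_P1 \<phi>. ram v - 1) = (\<Sum>v\<in>insert ord_inf (ord_at ` ?R). ram v - 1)"
    by (rule sum.mono_neutral_left[OF _ sub])
      (use finR in \<open>auto simp: ramification_points_def point_ord_at point_ord_inf\<close>)
  also have "\<dots> = ram ord_inf - 1 + (\<Sum>v\<in>ord_at ` ?R. ram v - 1)"
    using finR by (subst sum.insert) auto
  also have "(\<Sum>v\<in>ord_at ` ?R. ram v - 1) = (\<Sum>c\<in>?R. order c ?W)"
    by (simp add: sum.reindex[OF inj] order_wronskian_eq)
  also have "\<dots> = degree ?W" by (rule sum_order_eq_degree[OF wronskian_nz finR subset_refl])
  finally show "(\<Sum>v\<in>ramification_points const_P1 \<phi>. ram v - 1) = 2 * d - 2"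
    using degree_wronskian_eq ram_pos[OF point_ord_inf] by simp
qed

end

section \<open>The degree of the comorphism as a field extension\<close>

context P1_covering
begin

interpretation V: vector_space "\<lambda>b a. \<phi> b * a"
  by (rule field_hom_vector_space[OF phi_hom])

abbreviation "X \<equiv> to_fract [:0, 1:] :: 'k poly fract"

text \<open>The span of 1, X, ..., X^(d-1) over the subfield \<open>range \<phi>\<close>. These
  powers turn out to be a basis of the whole field, so that the degree of the extension is
  \<open>d\<close>.\<close>

definition power_span :: "'k poly fract set" where
  "power_span = V.span ((\<lambda>i. X ^ i) ` {..<d})"

lemma to_fract_eq_sum: "degree p \<le> N \<Longrightarrow> to_fract p = (\<Sum>i\<le>N. const_P1 (coeff p i) * X ^ i)"
proof (induction p arbitrary: N)
  case (pCons a p)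
  show ?case
  proof (cases N)
    case 0
    then have "p = 0" using pCons.prems by (auto split: if_splits)
    then show ?thesis using 0 by (simp add: const_P1_to_fract)
  next
    case (Suc K)
    then have "degree p \<le> K" using pCons.prems by (auto split: if_splits)
    then have IH: "to_fract p = (\<Sum>i\<le>K. const_P1 (coeff p i) * X ^ i)" by (rule pCons.IH)
    have "to_fract (pCons a p) = const_P1 a + X * to_fract p" by (rule to_fract_pCons)
    also have "\<dots> = (\<Sum>i\<le>Suc K. const_P1 (coeff (pCons a p) i) * X ^ i)"
      unfolding IH sum.atMost_Suc_shift by (simp add: sum_distrib_left mult_ac)
    finally show ?thesis unfolding Suc .
  qed
qed (simp add: const_P1_to_fract)

lemma power_span_scale: "z \<in> power_span \<Longrightarrow> \<phi> a * z \<in> power_span"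
  unfolding power_span_def by (rule V.span_scale)

text \<open>\<open>X\<close> is a root of f(T) - \<phi>(X) g(T). The coefficient at T^d is the image
  of a nonzero polynomial of degree at most 1, because \<open>f\<close> and \<open>g\<close> do not
  both have degree below \<open>d\<close>; so the equation can be solved for X^d.\<close>

lemma X_power_d_in_span: "X ^ d \<in> power_span"
proof -
  define \<kappa> where "\<kappa> i = const_P1 (coeff f i) - X * const_P1 (coeff g i)" for i
  have "to_fract f - \<phi> X * to_fract g = 0" using g_nz by (simp add: phi_X)
  moreover have "to_fract f - \<phi> X * to_fract g = (\<Sum>i\<le>d. \<phi> (\<kappa> i) * X ^ i)"
    using to_fract_eq_sum[of f d] to_fract_eq_sum[of g d]
    by (simp add: d_def \<kappa>_def field_hom_diff[OF phi_hom] field_hom_mult[OF phi_hom] phi_const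
        sum_distrib_left sum_subtractf[symmetric] left_diff_distrib mult.assoc)
  ultimately have 0: "(\<Sum>i\<le>d. \<phi> (\<kappa> i) * X ^ i) = 0" by metis
  have "coeff f d \<noteq> 0 \<or> coeff g d \<noteq> 0"
  proof (cases "degree f = d")
    case True
    then have "f \<noteq> 0" using d_pos by auto
    then show ?thesis unfolding True[symmetric] by simp
  next
    case False
    then have "degree g = d" by (auto simp: d_def)
    then show ?thesis using g_nz leading_coeff_0_iff[of g] by auto
  qed
  moreover have "\<kappa> d = to_fract [:coeff f d, - coeff g d:]"
    by (simp add: \<kappa>_def const_P1_to_fract to_fract_mult[symmetric] to_fract_diff[symmetric] del: to_fract_mult to_fract_diff)
  ultimately have \<kappa>d: "\<phi> (\<kappa> d) \<noteq> 0" using phi_hom by auto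
  have "(\<Sum>i<d. \<phi> (\<kappa> i) * X ^ i) + \<phi> (\<kappa> d) * X ^ d = 0"
    using 0 by (simp add: lessThan_Suc_atMost[symmetric])
  then have "\<phi> (\<kappa> d) * X ^ d = - (\<Sum>i<d. \<phi> (\<kappa> i) * X ^ i)" by (simp add: add_eq_0_iff)
  moreover have "(\<Sum>i<d. \<phi> (\<kappa> i) * X ^ i) \<in> power_span"
    unfolding power_span_def by (intro V.span_sum V.span_scale V.span_base imageI)
  then have "- (\<Sum>i<d. \<phi> (\<kappa> i) * X ^ i) \<in> power_span"
    unfolding power_span_def by (rule V.span_neg)
  ultimately have "\<phi> (\<kappa> d) * X ^ d \<in> power_span" by simp
  then have "\<phi> (inverse (\<kappa> d)) * (\<phi> (\<kappa> d) * X ^ d) \<in> power_span" by (rule power_span_scale)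
  moreover have "\<phi> (inverse (\<kappa> d)) * (\<phi> (\<kappa> d) * X ^ d) = X ^ d"
    unfolding field_hom_inverse[OF phi_hom] mult.assoc[symmetric] using \<kappa>d by simp
  ultimately show ?thesis by (simp only:)
qed

lemma X_mult_span:
  assumes "z \<in> power_span"
  shows "X * z \<in> power_span"
proof -
  have "power_span \<subseteq> {z. X * z \<in> power_span}"
    unfolding power_span_def
  proof (rule V.span_minimal)
    show "(\<lambda>i. X ^ i) ` {..<d} \<subseteq> {z. X * z \<in> V.span ((\<lambda>i. X ^ i) ` {..<d})}"
    proof clarify
      fix i assume i: "i < d"
      show "X * X ^ i \<in> V.span ((\<lambda>i. X ^ i) ` {..<d})"
      proof (cases "Suc i = d")
        case True
        then show ?thesis using X_power_d_in_span unfolding power_span_def by (metis power_Suc)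
      next
        case False
        then have "X ^ Suc i \<in> (\<lambda>i. X ^ i) ` {..<d}" using i by (intro imageI) simp
        then show ?thesis using V.span_base by (metis power_Suc)
      qed
    qed
    show "V.subspace {z. X * z \<in> V.span ((\<lambda>i. X ^ i) ` {..<d})}"
      by (rule V.subspaceI)
        (auto simp: distrib_left V.span_zero mult.left_commute[of X] intro: V.span_add V.span_scale)
  qed
  with assms show ?thesis by blast
qed

lemma to_fract_mult_span: "z \<in> power_span \<Longrightarrow> to_fract p * z \<in> power_span"
proof (induction p)
  case 0
  then show ?case by (simp add: power_span_def V.span_zero)
next
  case (pCons a p)
  have "\<phi> (const_P1 a) * z + X * (to_fract p * z) \<in> power_span"
    using power_span_scale[OF pCons.prems] X_mult_span[OF pCons.IH[OF pCons.prems]]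
    unfolding power_span_def by (rule V.span_add)
  moreover have "\<phi> (const_P1 a) * z + X * (to_fract p * z) = to_fract (pCons a p) * z"
    unfolding to_fract_pCons[of a p] by (simp add: phi_const distrib_right mult.assoc)
  ultimately show ?case by metis
qed

text \<open>
  \<open>f(T) - \<phi>(X) g(T)\<close> vanishes at \<open>T = X\<close>; dividing it by \<open>T - c\<close> inverts \<open>X - c\<close>
  without leaving the span.
\<close>

lemma inverse_linear_mult_span:
  assumes z: "z \<in> power_span"
  shows "inverse (to_fract [:-c, 1:]) * z \<in> power_span"
proof -
  define l where "l = (to_fract [:-c, 1:] :: 'k poly fract)"
  have l0: "l \<noteq> 0" by (simp add: l_def)
  define F1 where "F1 = to_fract (synthetic_div f c)"
  define G1 where "G1 = to_fract (synthetic_div g c)"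
  have "p = [:-c, 1:] * synthetic_div p c + [:poly p c:]" for p
    by (rule synthetic_div_correct'[symmetric])
  then have sd: "to_fract p = l * to_fract (synthetic_div p c) + const_P1 (poly p c)" for p
    unfolding l_def const_P1_to_fract by (metis to_fract_add to_fract_mult)
  define K where "K = const_P1 (poly f c) - X * const_P1 (poly g c)"
  have "K = to_fract [:poly f c, - poly g c:]"
    by (simp add: K_def const_P1_to_fract to_fract_mult[symmetric] to_fract_diff[symmetric] del: to_fract_mult to_fract_diff)
  then have K0: "\<phi> K \<noteq> 0" using no_common_root[of c] phi_hom by auto
  have "to_fract f - \<phi> X * to_fract g = 0" using g_nz by (simp add: phi_X)
  moreover have "\<phi> K = const_P1 (poly f c) - \<phi> X * const_P1 (poly g c)"
    by (simp add: K_def field_hom_diff[OF phi_hom] field_hom_mult[OF phi_hom] phi_const)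
  then have "l * (F1 - \<phi> X * G1) + \<phi> K = to_fract f - \<phi> X * to_fract g"
    unfolding sd[of f] sd[of g] F1_def G1_def by (simp add: algebra_simps)
  ultimately have "l * (F1 - \<phi> X * G1) + \<phi> K = 0" by simp
  then have lK: "l * (\<phi> X * G1 - F1) = \<phi> K" by (simp add: algebra_simps add_eq_0_iff2 eq_neg_iff_add_eq_0)
  have "inverse l * z = \<phi> (inverse K) * (\<phi> X * (G1 * z) - F1 * z)"
  proof -
    have "\<phi> (inverse K) * (\<phi> X * (G1 * z) - F1 * z) = inverse (\<phi> K) * (\<phi> X * G1 - F1) * z"
      by (simp add: field_hom_inverse[OF phi_hom] left_diff_distrib mult.assoc)
    also have "inverse (\<phi> K) * (\<phi> X * G1 - F1) = inverse l"
      using K0 l0 lK by (simp add: field_simps)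
    finally show ?thesis by simp
  qed
  also have "\<dots> \<in> power_span"
    using to_fract_mult_span[OF z] unfolding power_span_def F1_def G1_def
    by (intro V.span_scale V.span_diff) (auto simp: power_span_def)
  finally show ?thesis by (simp add: l_def)
qed

lemma inverse_mult_span: "q \<noteq> 0 \<Longrightarrow> z \<in> power_span \<Longrightarrow> inverse (to_fract q) * z \<in> power_span"
proof (induction q arbitrary: z rule: poly_root_order_induct)
  case (no_roots q)
  then have "degree q = 0" using alg_closed_imp_poly_has_root[of q] by auto
  then obtain a where q: "q = [:a:]" by (rule degree_eq_zeroE)
  have "to_fract q = \<phi> (const_P1 a)" using phi_const[of a] by (simp only: q const_P1_to_fract)
  then show ?case using power_span_scale[OF no_roots(3), of "inverse (const_P1 a)"]
    by (simp add: field_hom_inverse[OF phi_hom])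
next
  case (root q x n)
  have pow: "inverse (to_fract [:-x, 1:]) ^ n * t \<in> power_span" if "t \<in> power_span" for t n
    using that
  proof (induction n arbitrary: t)
    case (Suc n)
    then show ?case using Suc.IH[OF inverse_linear_mult_span[OF Suc.prems, of x]]
      by (simp add: mult_ac)
  qed simp
  have "q \<noteq> 0" using root by auto
  then have "inverse (to_fract [:-x, 1:]) ^ n * (inverse (to_fract q) * z) \<in> power_span"
    using root by (intro pow) auto
  then show ?case
    by (simp add: to_fract_power power_inverse inverse_mult_distrib mult_ac del: mult_pCons_left)
qed simp

lemma power_span_UNIV: "power_span = UNIV"
proof -
  have one: "1 \<in> power_span"
    unfolding power_span_def by (rule V.span_base) (use d_pos in \<open>auto intro: image_eqI[of _ _ 0]\<close>)
  have "z \<in> power_span" for z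
  proof -
    obtain a b where z: "z = Fract a b" and b: "b \<noteq> 0" by (cases z) auto
    have "inverse (to_fract b) * (to_fract a * 1) \<in> power_span"
      by (intro inverse_mult_span to_fract_mult_span b one)
    then show ?thesis by (simp add: z Fract_conv_to_fract divide_inverse mult.commute)
  qed
  then show ?thesis by blast
qed

text \<open>Specialisation to a fiber: a relation, scaled so that its coefficients are regular and
  not all zero at \<open>l\<close>, reduces there to a nonzero polynomial of degree below
  \<open>d\<close>. This polynomial vanishes with multiplicities on the fiber over \<open>l\<close>,
  which has \<open>d\<close> finite points when these are counted with multiplicity.\<close>

lemma powers_independent:
  assumes sum0: "(\<Sum>i<d. \<phi> (c i) * X ^ i) = 0" and "i < d"
  shows "c i = 0"
proof (rule ccontr)
  assume "c i \<noteq> 0"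
  then have ne: "{u. u < d \<and> c u \<noteq> 0} \<noteq> {}" using \<open>i < d\<close> by blast
  \<comment> \<open>A fiber that avoids infinity is chosen; the one over 0 or the one over 1 will
    do.\<close>
  obtain l where l: "degree (f - smult l g) = d"
  proof (cases "degree f = d")
    case True
    then show ?thesis using that[of 0] by simp
  next
    case False
    then have "degree f < degree g" "degree g = d" by (auto simp: d_def max_def split: if_splits)
    then have "degree (f + - smult 1 g) = d" by (subst degree_add_eq_right) auto
    then show ?thesis using that[of 1] by simp
  qed
  note u = point_ord_at[of l]
  note uu = point_valn[OF u]
  \<comment> \<open>\<open>N\<close> is the least order at \<open>l\<close> among the nonzero
    coefficients. Division by an element of order \<open>N\<close> brings the minimum to 0; it is
    attained at \<open>j0\<close>, whose residue is then nonzero.\<close>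
  define N where "N = Min ((\<lambda>j. ord_at l (c j)) ` {u. u < d \<and> c u \<noteq> 0})"
  have N_le: "N \<le> ord_at l (c j)" if "j < d" "c j \<noteq> 0" for j
    unfolding N_def by (rule Min_le) (use that in auto)
  have "N \<in> (\<lambda>j. ord_at l (c j)) ` {u. u < d \<and> c u \<noteq> 0}"
    unfolding N_def by (rule Min_in) (use ne in auto)
  then obtain j0 where j0: "j0 < d" "c j0 \<noteq> 0" "ord_at l (c j0) = N" by blast
  define r where "r = to_fract [:-l, 1:] powi N"
  have r: "r \<noteq> 0" "ord_at l r = N" by (auto simp: r_def valn_power_int[OF uu] ord_at_linear)
  define c' where "c' j = c j / r" for j
  have c'0: "(\<Sum>i<d. \<phi> (c' i) * X ^ i) = 0"
  proof -
    have "(\<Sum>i<d. \<phi> (c' i) * X ^ i) = (\<Sum>i<d. \<phi> (c i) * X ^ i) / \<phi> r"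
      by (simp add: c'_def field_hom_divide[OF phi_hom] sum_divide_distrib)
    then show ?thesis using sum0 by simp
  qed
  have res: "\<exists>\<alpha>. vge (ord_at l) 1 (c' j - const_P1 \<alpha>) \<and> (j = j0 \<longrightarrow> \<alpha> \<noteq> 0)" if j: "j < d" for j
  proof (cases "c' j \<noteq> 0 \<and> ord_at l (c' j) = 0")
    case True
    then obtain \<alpha> where "\<alpha> \<noteq> 0" "vge (ord_at l) 1 (c' j - const_P1 \<alpha>)" using P1_residue[OF u] by blast
    then show ?thesis by blast
  next
    case False
    have "vge (ord_at l) 1 (c' j)"
    proof (cases "c' j = 0")
      case nz: False
      then have "c j \<noteq> 0" by (auto simp: c'_def)
      then have "0 \<le> ord_at l (c' j)" using N_le[OF j] r by (simp add: c'_def valn_divide[OF uu])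
      then show ?thesis using False nz by (simp add: vge_def)
    qed simp
    moreover have "j \<noteq> j0" using False j0 r by (auto simp: c'_def valn_divide[OF uu])
    ultimately show ?thesis by (intro exI[of _ 0]) (simp add: const_P1_to_fract)
  qed
  then obtain \<alpha> where \<alpha>: "\<And>j. j < d \<Longrightarrow> vge (ord_at l) 1 (c' j - const_P1 (\<alpha> j))" and \<alpha>0: "\<alpha> j0 \<noteq> 0"
    using j0(1) by metis
  define P where "P = (\<Sum>j<d. monom (\<alpha> j) j)"
  have cP: "coeff P j = (if j < d then \<alpha> j else 0)" for j by (simp add: P_def coeff_sum)
  have P0: "P \<noteq> 0" using cP[of j0] \<alpha>0 j0 by auto
  have dP: "degree P < d"
    using d_pos by (intro degree_lessI) (auto simp: cP)
  then have "to_fract P = (\<Sum>i\<le>d - 1. const_P1 (coeff P i) * X ^ i)" by (intro to_fract_eq_sum) simp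
  also have "{..d - 1} = {..<d}" using d_pos by auto
  also have "(\<Sum>i<d. const_P1 (coeff P i) * X ^ i) = (\<Sum>i<d. \<phi> (const_P1 (\<alpha> i)) * X ^ i)"
    by (rule sum.cong) (simp_all add: cP phi_const)
  also have "\<dots> = (\<Sum>i<d. \<phi> (const_P1 (\<alpha> i)) * X ^ i) - (\<Sum>i<d. \<phi> (c' i) * X ^ i)" by (simp add: c'0)
  also have "\<dots> = - (\<Sum>i<d. \<phi> (c' i - const_P1 (\<alpha> i)) * X ^ i)"
    by (simp add: field_hom_diff[OF phi_hom] sum_subtractf[symmetric] sum_negf[symmetric] algebra_simps)
  finally have toP: "to_fract P = - (\<Sum>i<d. \<phi> (c' i - const_P1 (\<alpha> i)) * X ^ i)" .
  let ?h = "f - smult l g"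
  \<comment> \<open>By the relation, \<open>P\<close> is minus a combination whose coefficients
    vanish at \<open>l\<close>; their images under \<phi> vanish at \<open>x\<close> at least to the
    ramification index, which is the order of \<open>?h\<close>.\<close>
  have ord_le: "order x ?h \<le> order x P" for x
  proof (cases "poly ?h x = 0")
    case False
    then show ?thesis by (simp add: order_0I)
  next
    case True
    note v = point_valn[OF point_ord_at[of x]]
    have fp: "poly (fiber_poly (ord_at l)) x = 0" using True by simp
    have lo: "ord_at x (\<phi> z) = int (order x ?h) * ord_at l z" for z
      using lies_over_at[OF u fp] by (simp add: lies_over_def)
    have summand: "vge (ord_at x) (int (order x ?h)) (\<phi> (c' i - const_P1 (\<alpha> i)) * X ^ i)" if "i < d" for i
    proof -
      have "vge (ord_at x) (int (order x ?h)) (\<phi> (c' i - const_P1 (\<alpha> i)))"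
      proof (cases "c' i - const_P1 (\<alpha> i) = 0")
        case False
        then have "1 \<le> ord_at l (c' i - const_P1 (\<alpha> i))" using \<alpha>[OF that] by (simp add: vge_def)
        then have "int (order x ?h) * 1 \<le> int (order x ?h) * ord_at l (c' i - const_P1 (\<alpha> i))"
          by (intro mult_left_mono) auto
        then show ?thesis by (simp add: vge_def lo)
      qed (simp add: field_hom_0[OF phi_hom])
      moreover have "vge (ord_at x) 0 (X ^ i)"
        by (rule vge_power[OF v]) (simp add: vge_def ord_at_to_fract)
      ultimately have "vge (ord_at x) (int (order x ?h) + 0) (\<phi> (c' i - const_P1 (\<alpha> i)) * X ^ i)" by (rule vge_mult[OF v])
      then show ?thesis by simp
    qed
    have "vge (ord_at x) (int (order x ?h)) (to_fract P)"
      unfolding toP vge_minus[OF v] by (rule vge_sum[OF v]) (use summand in auto)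
    then show ?thesis using P0 by (simp add: vge_def ord_at_to_fract)
  qed
  let ?S = "{x. poly ?h x = 0} \<union> {x. poly P x = 0}"
  have finS: "finite ?S" using poly_roots_finite[OF phi_linear_nz] poly_roots_finite[OF P0] by blast
  have "d = (\<Sum>x\<in>?S. order x ?h)" using sum_order_eq_degree[OF phi_linear_nz finS, of l] l by auto
  also have "\<dots> \<le> (\<Sum>x\<in>?S. order x P)" by (rule sum_mono) (rule ord_le)
  also have "\<dots> = degree P" by (rule sum_order_eq_degree[OF P0 finS]) auto
  finally show False using dP by simp
qed

theorem cover_degree_eq: "cover_degree \<phi> = d"
proof -
  have "V.dim UNIV = card {..<d}"
  proof (rule V.dim_eq_card_family[where e = "\<lambda>i. X ^ i"])
    fix z :: "'k poly fract"
    have "inj_on (\<lambda>i. X ^ i) {..<d}"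
    proof (rule inj_onI)
      fix i j assume "X ^ i = X ^ j"
      then have "ord_at 0 (X ^ i) = ord_at 0 (X ^ j)" by simp
      then show "i = j" using ord_at_linear[of "0::'k"] by (simp add: valn_power[OF point_valn[OF point_ord_at]])
    qed
    moreover have "z \<in> V.span ((\<lambda>i. X ^ i) ` {..<d})" using power_span_UNIV unfolding power_span_def by blast
    then obtain w where "z = (\<Sum>v\<in>(\<lambda>i. X ^ i) ` {..<d}. \<phi> (w v) * v)"
      using V.span_finite[of "(\<lambda>i. X ^ i) ` {..<d}"] by auto
    ultimately have "z = (\<Sum>i<d. \<phi> (w (X ^ i)) * X ^ i)" by (simp add: sum.reindex)
    then show "\<exists>c. z = (\<Sum>i<d. \<phi> (c i) * X ^ i)" by (rule exI[of _ "\<lambda>i. w (X ^ i)"])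
  qed (use powers_independent in auto)
  then show ?thesis by (simp add: cover_degree_def)
qed

end

section \<open>Ramification structures and their degenerations\<close>

abbreviation twos :: "nat \<Rightarrow> fiber_type" where
  "twos k \<equiv> replicate_mset k 2"

lemma entry_simps: "entry [] = {#}" "entry ((e, r) # xs) = replicate_mset (nat r) e + entry xs"
  by (simp_all add: entry_def)

lemma half_diff: "(2 * int h - 2) div 2 = int h - 1" "(2 * int h - 4) div 2 = int h - 2"
  "(2 * int h - 6) div 2 = int h - 3" "(2 * int h - 8) div 2 = int h - 4" "(2 * int h - 10) div 2 = int h - 5"
  by simp_all

text \<open>With n = 2h the exponents become differences of naturals, and the empty cases of
  \<open>struct\<close> become lower bounds on \<open>h\<close>.\<close>

lemma type_I_eq: "type_I (2 * int h) =
    (if 1 \<le> h then {({#twos (h-1), twos (h-1), twos (h-1), twos h#}, {#{#2#}#})} else {})"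
  by (auto simp: type_I_def struct_def entry_simps half_diff nat_diff_distrib')

lemma type_II_eq: "type_II (2 * int h) =
    (if 2 \<le> h then {({#twos (h-2), twos (h-1), twos h, twos h#}, {#{#2#}#})} else {})"
  by (auto simp: type_II_def struct_def entry_simps half_diff nat_diff_distrib')

lemma type_III_eq: "type_III (2 * int h) =
    (if 3 \<le> h then {({#twos (h-3), twos h, twos h, twos h#}, {#{#2#}#})} else {})"
  by (auto simp: type_III_def struct_def entry_simps half_diff nat_diff_distrib')

lemma degenerate_I_eq: "degenerate_I (2 * int h) =
    (if 1 \<le> h then {({#twos h, twos (h-1), twos (h-1), twos h#}, {#})} else {}) \<union>
    (if 3 \<le> h then {({#twos (h-1), twos (h-1), add_mset 4 (twos (h-3)), twos h#}, {#})} else {}) \<union>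
    (if 2 \<le> h then {({#twos (h-1), twos (h-1), twos (h-1), add_mset 4 (twos (h-2))#}, {#})} else {}) \<union>
    (if 2 \<le> h then {({#add_mset 3 (twos (h-2)), twos (h-1), twos (h-1), twos h#}, {#})} else {})"
  unfolding degenerate_I_def
  by (intro arg_cong2[where f = "(\<union>)"]) (auto simp: struct_def entry_simps half_diff nat_diff_distrib')

lemma degenerate_II_eq: "degenerate_II (2 * int h) =
    (if 1 \<le> h then {({#twos (h-1), twos (h-1), twos h, twos h#}, {#})} else {}) \<union>
    (if 2 \<le> h then {({#twos (h-2), twos h, twos h, twos h#}, {#})} else {}) \<union>
    (if 4 \<le> h then {({#add_mset 4 (twos (h-4)), twos (h-1), twos h, twos h#}, {#})} else {}) \<union>
    (if 3 \<le> h then {({#twos (h-2), add_mset 4 (twos (h-3)), twos h, twos h#}, {#})} else {}) \<union>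
    (if 2 \<le> h then {({#twos (h-2), twos (h-1), add_mset 4 (twos (h-2)), twos h#}, {#})} else {}) \<union>
    (if 3 \<le> h then {({#add_mset 3 (twos (h-3)), twos (h-1), twos h, twos h#}, {#})} else {}) \<union>
    (if 2 \<le> h then {({#twos (h-2), add_mset 3 (twos (h-2)), twos h, twos h#}, {#})} else {})"
  unfolding degenerate_II_def
  by (intro arg_cong2[where f = "(\<union>)"]) (auto simp: struct_def entry_simps half_diff nat_diff_distrib')

lemma degenerate_III_eq: "degenerate_III (2 * int h) =
    (if 2 \<le> h then {({#twos (h-2), twos h, twos h, twos h#}, {#})} else {}) \<union>
    (if 3 \<le> h then {({#twos (h-3), add_mset 4 (twos (h-2)), twos h, twos h#}, {#})} else {}) \<union>
    (if 5 \<le> h then {({#twos h, twos h, twos h, add_mset 4 (twos (h-5))#}, {#})} else {}) \<union>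
    (if 4 \<le> h then {({#add_mset 3 (twos (h-4)), twos h, twos h, twos h#}, {#})} else {})"
  unfolding degenerate_III_def
  by (intro arg_cong2[where f = "(\<union>)"]) (auto simp: struct_def entry_simps half_diff nat_diff_distrib')

text \<open>The effect of a collapse on the one fiber into which the simple branch point
  moves.\<close>

definition joins :: "nat \<Rightarrow> fiber_type \<Rightarrow> fiber_type set" where
  "joins n F = {filter_mset (\<lambda>e. e > 1) (G + {#a + b#}) | G a b. full_fiber n F = G + {#a, b#}}"

lemma collapses_eq:
  "collapses n (A, {#{#2#}#}) = (\<Union>F\<in>set_mset A. (\<lambda>J. (A - {#F#} + {#J#}, {#})) ` joins n F)"
proof (intro set_eqI iffI)
  fix s :: ram_structure assume "s \<in> collapses n (A, {#{#2#}#})"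
  then obtain F G a b where s: "s = (A - {#F#} + {#filter_mset (\<lambda>e. e > 1) (G + {#a + b#})#}, {#{#2#}#} - {#{#2#}#})"
    and F: "F \<in># A" and full: "full_fiber n F = G + {#a, b#}"
    unfolding collapses_def fst_conv snd_conv mem_Collect_eq by blast
  have "filter_mset (\<lambda>e. e > 1) (G + {#a + b#}) \<in> joins n F" using full unfolding joins_def by blast
  then show "s \<in> (\<Union>F\<in>set_mset A. (\<lambda>J. (A - {#F#} + {#J#}, {#})) ` joins n F)"
    using F by (intro UN_I[of F] image_eqI) (simp_all add: s)
next
  fix s :: ram_structure assume "s \<in> (\<Union>F\<in>set_mset A. (\<lambda>J. (A - {#F#} + {#J#}, {#})) ` joins n F)"
  then obtain F G a b where "s = (A - {#F#} + {#filter_mset (\<lambda>e. e > 1) (G + {#a + b#})#}, {#{#2#}#} - {#{#2#}#})"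
    "{#2::nat#} \<in># {#{#2#}#}" "F \<in># A" "full_fiber n F = G + {#a, b#}"
    unfolding joins_def by fastforce
  then show "s \<in> collapses n (A, {#{#2#}#})"
    unfolding collapses_def fst_conv snd_conv mem_Collect_eq by blast
qed

lemma filter_twos_ones: "filter_mset (\<lambda>e. e > Suc 0) (twos k + replicate_mset l (Suc 0)) = twos k"
proof -
  have "filter_mset (\<lambda>e. e > Suc 0) (twos k) = twos k" by (induction k) auto
  moreover have "filter_mset (\<lambda>e. e > Suc 0) (replicate_mset l (Suc 0)) = {#}" by (induction l) auto
  ultimately show ?thesis by simp
qed

lemma twos_eq_iff: "twos a = twos b \<longleftrightarrow> a = b"
  by (auto dest: arg_cong[where f = size])

text \<open>The full fiber consists of \<open>k\<close> twos and \<open>2 * j\<close> ones. Joining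
  1 + 1, 2 + 2 or 1 + 2 creates a 2, a 4 or a 3; the side conditions say that the two points to be
  joined are there.\<close>

lemma joins_twos:
  "joins (2 * (k + j)) (twos k) =
     (if 1 \<le> j then {twos (k+1)} else {}) \<union>
     (if 2 \<le> k then {add_mset 4 (twos (k-2))} else {}) \<union>
     (if 1 \<le> k \<and> 1 \<le> j then {add_mset 3 (twos (k-1))} else {})"
proof (intro set_eqI iffI)
  let ?M = "\<lambda>k l. twos k + replicate_mset l (1::nat)"
  have full: "full_fiber (2 * (k + j)) (twos k) = ?M k (2 * j)"
    by (simp add: full_fiber_def sum_mset_replicate_mset algebra_simps)
  fix J
  {
    assume "J \<in> joins (2 * (k + j)) (twos k)"
    then obtain G a b where eq: "?M k (2 * j) = G + {#a, b#}"
      and J: "J = filter_mset (\<lambda>e. e > 1) (G + {#a + b#})"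
      unfolding joins_def full by blast
    have "a \<in># ?M k (2 * j)" "b \<in># ?M k (2 * j)" unfolding eq by simp_all
    then have "a \<in> {1, 2}" "b \<in> {1, 2}" by (auto split: if_splits)
    then consider "a = 1" "b = 1" | "a = 2" "b = 2" | "{#a, b#} = {#1, 2#}" by (auto simp: add_mset_commute)
    then show "J \<in> (if 1 \<le> j then {twos (k+1)} else {}) \<union>
     (if 2 \<le> k then {add_mset 4 (twos (k-2))} else {}) \<union>
     (if 1 \<le> k \<and> 1 \<le> j then {add_mset 3 (twos (k-1))} else {})"
    proof cases
      case 1
      have "count (?M k (2 * j)) 1 = count G 1 + 2" unfolding eq using 1 by simp
      then obtain i where j: "j = Suc i" by (cases j) auto
      have "G = ?M k (2 * i)" using eq unfolding j 1 by simp
      then have "J = twos (k + 1)"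
        using filter_twos_ones[of "k + 1" "2 * i"] by (simp add: J 1 numeral_2_eq_2)
      then show ?thesis using j by simp
    next
      case 2
      have "count (?M k (2 * j)) 2 = count G 2 + 2" unfolding eq using 2 by simp
      then have "2 \<le> k" by simp
      then obtain i where k: "k = Suc (Suc i)" by (metis Suc_le_D le_Suc_ex add_2_eq_Suc)
      have "G = ?M i (2 * j)" using eq unfolding k 2 by simp
      then have "J = add_mset 4 (twos i)"
        using filter_twos_ones[of i "2 * j"] by (simp add: J 2)
      then show ?thesis using k by simp
    next
      case 3
      have ab: "a + b = 3" using arg_cong[OF 3, of sum_mset] by simp
      have "count (?M k (2 * j)) 2 = count G 2 + 1" "count (?M k (2 * j)) 1 = count G 1 + 1"
        unfolding eq 3 by simp_all
      then obtain i l where kj: "k = Suc i" "j = Suc l" by (cases k; cases j) auto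
      have "G = ?M i (2 * l + 1)" using eq unfolding 3 kj by simp
      then have "J = add_mset 3 (twos i)"
        using filter_twos_ones[of i "2 * l + 1"] by (simp add: J ab)
      then show ?thesis using kj by simp
    qed
  }
  {
    assume "J \<in> (if 1 \<le> j then {twos (k+1)} else {}) \<union>
     (if 2 \<le> k then {add_mset 4 (twos (k-2))} else {}) \<union>
     (if 1 \<le> k \<and> 1 \<le> j then {add_mset 3 (twos (k-1))} else {})"
    then consider "1 \<le> j" "J = twos (k+1)" | "2 \<le> k" "J = add_mset 4 (twos (k-2))"
      | "1 \<le> k" "1 \<le> j" "J = add_mset 3 (twos (k-1))" by (auto split: if_splits)
    then show "J \<in> joins (2 * (k + j)) (twos k)"
    proof cases
      case 1
      then obtain i where j: "j = Suc i" by (cases j) auto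
      have "?M k (2 * j) = ?M k (2 * i) + {#1, 1#}" by (simp add: j)
      moreover have "J = filter_mset (\<lambda>e. e > 1) (?M k (2 * i) + {#1 + 1#})"
        using filter_twos_ones[of "k + 1" "2 * i"] by (simp add: 1 numeral_2_eq_2)
      ultimately show ?thesis unfolding joins_def full by blast
    next
      case 2
      then obtain i where k: "k = Suc (Suc i)" by (metis Suc_le_D le_Suc_ex add_2_eq_Suc)
      have "?M k (2 * j) = ?M i (2 * j) + {#2, 2#}" by (simp add: k)
      moreover have "J = filter_mset (\<lambda>e. e > 1) (?M i (2 * j) + {#2 + 2#})"
        using filter_twos_ones[of i "2 * j"] by (simp add: 2 k)
      ultimately show ?thesis unfolding joins_def full by blast
    next
      case 3
      then obtain i l where kj: "k = Suc i" "j = Suc l" by (cases k; cases j) auto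
      have "?M k (2 * j) = ?M i (2 * l + 1) + {#1, 2#}" by (simp add: kj)
      moreover have "J = filter_mset (\<lambda>e. e > 1) (?M i (2 * l + 1) + {#1 + 2#})"
        using filter_twos_ones[of i "2 * l + 1"] by (simp add: 3 kj)
      ultimately show ?thesis unfolding joins_def full by blast
    qed
  }
qed

lemma joins_twos':
  "k \<le> h \<Longrightarrow> joins (2 * h) (twos k) =
     (if k < h then {twos (k+1)} else {}) \<union>
     (if 2 \<le> k then {add_mset 4 (twos (k-2))} else {}) \<union>
     (if 1 \<le> k \<and> k < h then {add_mset 3 (twos (k-1))} else {})"
  using joins_twos[of k "h - k"] by (auto simp: Suc_le_eq)

lemma collapses_type_I:
  assumes "S \<in> type_I (2 * int h)"
  shows "collapses (2 * h) S = degenerate_I (2 * int h)"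
proof -
  have "1 \<le> h" using assms by (auto simp: type_I_eq split: if_splits)
  \<comment> \<open>Writing \<open>h\<close> as \<open>k + 1\<close> removes the truncated
    subtractions before the two finite unions are compared.\<close>
  then obtain k where h: "h = k + 1" by (metis add.commute le_Suc_ex)
  have S: "S = ({#twos k, twos k, twos k, twos h#}, {#{#2#}#})"
    using assms unfolding type_I_eq by (simp add: h)
  have le: "k \<le> h" "h \<le> h" by (simp_all add: h)
  show ?thesis
    unfolding S collapses_eq degenerate_I_eq set_mset_add_mset_insert set_mset_empty UN_insert UN_empty
      le[THEN joins_twos']
    by (auto simp: h twos_eq_iff add_mset_commute eval_nat_numeral simp del: replicate_mset_Suc split: if_splits)
qed

lemma collapses_type_II:
  assumes "S \<in> type_II (2 * int h)"
  shows "collapses (2 * h) S = degenerate_II (2 * int h)"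
proof -
  have "2 \<le> h" using assms by (auto simp: type_II_eq split: if_splits)
  then obtain k where h: "h = k + 2" by (metis add.commute le_Suc_ex)
  have S: "S = ({#twos k, twos (k+1), twos h, twos h#}, {#{#2#}#})"
    using assms unfolding type_II_eq by (simp add: h)
  have le: "k \<le> h" "k + 1 \<le> h" "h \<le> h" by (simp_all add: h)
  show ?thesis
    unfolding S collapses_eq degenerate_II_eq set_mset_add_mset_insert set_mset_empty UN_insert UN_empty
      le[THEN joins_twos']
    by (auto simp: h twos_eq_iff add_mset_commute eval_nat_numeral simp del: replicate_mset_Suc split: if_splits)
qed

lemma collapses_type_III:
  assumes "S \<in> type_III (2 * int h)"
  shows "collapses (2 * h) S = degenerate_III (2 * int h)"
proof -
  have "3 \<le> h" using assms by (auto simp: type_III_eq split: if_splits)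
  then obtain k where h: "h = k + 3" by (metis add.commute le_Suc_ex)
  have S: "S = ({#twos k, twos h, twos h, twos h#}, {#{#2#}#})"
    using assms unfolding type_III_eq by (simp add: h)
  have le: "k \<le> h" "h \<le> h" by (simp_all add: h)
  show ?thesis
    unfolding S collapses_eq degenerate_III_eq set_mset_add_mset_insert set_mset_empty UN_insert UN_empty
      le[THEN joins_twos']
    by (auto simp: h twos_eq_iff add_mset_commute eval_nat_numeral simp del: replicate_mset_Suc split: if_splits)
qed

section \<open>Enumeration of the possible structures\<close>

lemma size_Suc_mset: "size M = Suc k \<longleftrightarrow> (\<exists>x N. M = add_mset x N \<and> size N = k)"
proof
  assume *: "size M = Suc k"
  then obtain x N where "M = add_mset x N" using size_eq_Suc_imp_eq_union by blast
  with * show "\<exists>x N. M = add_mset x N \<and> size N = k" by auto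
qed auto

lemma mset3_cases:
  assumes "size M = 3"
  obtains a b c :: nat where "M = {#a, b, c#}" "a \<le> b" "b \<le> c"
proof -
  obtain x y z where M: "M = {#x, y, z#}" using assms by (auto simp: numeral_3_eq_3 size_Suc_mset)
  consider "x \<le> y" "y \<le> z" | "x \<le> z" "z \<le> y" | "y \<le> x" "x \<le> z" | "y \<le> z" "z \<le> x" | "z \<le> x" "x \<le> y" | "z \<le> y" "y \<le> x"
    by linarith
  then show ?thesis
  proof cases
    case 1 with M show ?thesis by (intro that[of x y z]) (simp_all add: add_mset_commute)
  next
    case 2 with M show ?thesis by (intro that[of x z y]) (simp_all add: add_mset_commute)
  next
    case 3 with M show ?thesis by (intro that[of y x z]) (simp_all add: add_mset_commute)
  next
    case 4 with M show ?thesis by (intro that[of y z x]) (simp_all add: add_mset_commute)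
  next
    case 5 with M show ?thesis by (intro that[of z x y]) (simp_all add: add_mset_commute)
  next
    case 6 with M show ?thesis by (intro that[of z y x]) (simp_all add: add_mset_commute)
  qed
qed

text \<open>These are the partitions of \<open>s\<close> into at most three parts, padded with
  zeros.\<close>

lemma mset3_sum_cases:
  fixes M :: "nat multiset"
  assumes "size M = 3" "sum_mset M = s" "s \<le> 3"
  shows "(s = 0 \<and> M = {#0, 0, 0#}) \<or> (s = 1 \<and> M = {#0, 0, 1#}) \<or>
    (s = 2 \<and> (M = {#0, 0, 2#} \<or> M = {#0, 1, 1#})) \<or>
    (s = 3 \<and> (M = {#0, 0, 3#} \<or> M = {#0, 1, 2#} \<or> M = {#1, 1, 1#}))"
proof -
  obtain a b c where M: "M = {#a, b, c#}" "a \<le> b" "b \<le> c" using mset3_cases[OF assms(1)] .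
  then have s: "a + b + c = s" using assms(2) by simp
  have "a = 0 \<or> a = 1" "b = 0 \<or> b = 1" "s = 0 \<or> s = 1 \<or> s = 2 \<or> s = 3"
    using s M(2,3) assms(3) by linarith+
  then show ?thesis using s M by (elim disjE) auto
qed

text \<open>
  Below, \<open>x\<close> and the elements of \<open>A\<close> and \<open>M\<close> stand for half the number of points of odd index in a
  fiber.
\<close>

lemma generic_structures:
  fixes A :: "nat multiset"
  assumes "size A = 4" "sum_mset A = 3" "\<And>a. a \<in># A \<Longrightarrow> a \<le> h" "h > 0"
  shows "(image_mset (\<lambda>a. twos (h - a)) A, {#{#2#}#}) \<in>
    type_I (2 * int h) \<union> type_II (2 * int h) \<union> type_III (2 * int h)"
proof -
  obtain x M where A: "A = add_mset x M" "size M = 3"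
    using assms(1) size_Suc_mset[of A 3] by auto
  have xM: "x + sum_mset M = 3" using assms(2) A by simp
  have le: "x \<le> h" "\<forall>a\<in>#M. a \<le> h" using assms(3) A by auto
  have "sum_mset M \<le> 3" using xM by simp
  from mset3_sum_cases[OF A(2) refl this] xM le assms(4) show ?thesis
    by (elim disjE conjE; simp add: A(1) type_I_eq type_II_eq type_III_eq add_mset_commute del: One_nat_def)
qed

text \<open>The 2x odd points of the exceptional fiber include the point of index 3, hence
  \<open>1 \<le> x\<close>, and 2h = 3 + (2x - 1) + 2N leaves N = h - (1 + x) twos.\<close>

lemma degenerate_structures_3:
  assumes "size M = 3" "x + sum_mset M = 3" "\<forall>a\<in>#M. a \<le> h" "1 \<le> x" "1 + x \<le> h"
  shows "(add_mset (add_mset 3 (twos (h - (1 + x)))) (image_mset (\<lambda>a. twos (h - a)) M), {#}) \<in>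
    degenerate_I (2 * int h) \<union> degenerate_II (2 * int h) \<union> degenerate_III (2 * int h)"
proof -
  have "sum_mset M \<le> 3" using assms(2) by simp
  from mset3_sum_cases[OF assms(1) refl this] assms(2-5) show ?thesis
    by (elim disjE conjE; simp add: degenerate_I_eq degenerate_II_eq degenerate_III_eq add_mset_commute del: One_nat_def)
qed

text \<open>A point of index 4 is not among the 2x odd points of its fiber, so \<open>x\<close> may
  be 0, and 2h = 4 + 2x + 2N leaves N = h - (2 + x) twos.\<close>

lemma degenerate_structures_4:
  assumes "size M = 3" "x + sum_mset M = 3" "\<forall>a\<in>#M. a \<le> h" "2 + x \<le> h"
  shows "(add_mset (add_mset 4 (twos (h - (2 + x)))) (image_mset (\<lambda>a. twos (h - a)) M), {#}) \<in>
    degenerate_I (2 * int h) \<union> degenerate_II (2 * int h) \<union> degenerate_III (2 * int h)"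
proof -
  have "sum_mset M \<le> 3" using assms(2) by simp
  from mset3_sum_cases[OF assms(1) refl this] assms(2-4) show ?thesis
    by (elim disjE conjE; simp add: degenerate_I_eq degenerate_II_eq degenerate_III_eq add_mset_commute del: One_nat_def)
qed

lemma fiber_type_of_eq:
  assumes "finite (fiber \<iota> h u)"
  shows "fiber_type_of \<iota> h u = image_mset (ram_index h) (mset_set {v \<in> fiber \<iota> h u. ram_index h v > 1})"
  using assms by (simp add: fiber_type_of_def filter_mset_image_mset comp_def)

lemma even_of_sum_eq:
  fixes a b c h :: nat
  assumes "2 * h = c + a + 2 * b" "even c"
  shows "even a"
  using assms by presburger

section \<open>Counting over the four points of \<open>T\<close>\<close>

context P1_covering
begin

context
  fixes T :: "('k poly fract \<Rightarrow> int) set" and B h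
  assumes finT: "finite T" and cardT: "card T = 4" and ptsT: "T \<subseteq> Collect (point const_P1)"
    and B_def: "B = {v. point const_P1 v \<and> im v \<in> T \<and> odd (ram v)}" and cardB: "card B = 6"
    and d_even: "d = 2 * h"
begin

text \<open>Deviation from the expected index: over \<open>T\<close> the indices 1 and 2 have excess
  0 and the indices 3 and 4 have excess 1; elsewhere every unit above 1 counts.\<close>

definition excess :: "('k poly fract \<Rightarrow> int) \<Rightarrow> nat" where
  "excess v = (if im v \<in> T then (ram v - 1) div 2 else ram v - 1)"

abbreviation "fib t \<equiv> fiber const_P1 \<phi> t"

lemma fib_T: "t \<in> T \<Longrightarrow> finite (fib t) \<and> (\<Sum>v\<in>fib t. ram v) = d"
  using sum_ram_fiber ptsT by blast

text \<open>
  Subtracting the Riemann--Hurwitz formula from the fundamental identities over the four points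
  of \<open>T\<close>, the six odd points absorb everything except one unit.
\<close>

lemma sum_excess:
  defines "U \<equiv> (\<Union>t\<in>T. fib t)"
  shows "finite (U \<union> ramification_points const_P1 \<phi>)"
    and "(\<Sum>v\<in>U \<union> ramification_points const_P1 \<phi>. excess v) = 1"
proof -
  let ?R = "ramification_points const_P1 \<phi>"
  have finU: "finite U" using finT fib_T by (simp add: U_def)
  with riemann_hurwitz(1) show fin: "finite (U \<union> ?R)" by simp
  have U: "v \<in> U \<longleftrightarrow> point const_P1 v \<and> im v \<in> T" for v by (auto simp: U_def fiber_def)
  define Ev where "Ev = {v \<in> U. even (ram v)}"
  have BU: "B = {v \<in> U. odd (ram v)}" by (auto simp: B_def U)
  have cardU: "card U = 6 + card Ev"
  proof -
    have "U = B \<union> Ev" "B \<inter> Ev = {}" by (auto simp: BU Ev_def)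
    then show ?thesis using finU cardB by (metis card_Un_disjoint finite_Un)
  qed
  have "(\<Sum>v\<in>U. ram v) = (\<Sum>t\<in>T. \<Sum>v\<in>fib t. ram v)"
    unfolding U_def by (rule sum.UNION_disjoint) (use finT fib_T in \<open>auto simp: fiber_def\<close>)
  also have "\<dots> = 4 * d" using fib_T cardT by simp
  finally have sumU: "(\<Sum>v\<in>U. ram v) = 4 * d" .
  have "ram v = 2 * excess v + 1 + (if even (ram v) then 1 else 0)" if "v \<in> U" for v
    using that ram_pos[of v] by (auto simp: excess_def U elim!: evenE oddE)
  then have "(\<Sum>v\<in>U. ram v) = (\<Sum>v\<in>U. 2 * excess v + 1 + (if even (ram v) then 1 else 0))"
    by (intro sum.cong) auto
  also have "\<dots> = 2 * (\<Sum>v\<in>U. excess v) + card U + card Ev"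
    using finU by (simp add: sum.distrib sum_Suc sum_distrib_left Ev_def sum.If_cases Int_def)
  finally have 1: "4 * d = 2 * (\<Sum>v\<in>U. excess v) + 6 + 2 * card Ev" using sumU cardU by simp
  have "(\<Sum>v\<in>?R. ram v - 1) = (\<Sum>v\<in>U \<union> (?R - U). ram v - 1)"
    by (rule sum.mono_neutral_left) (use fin finU in \<open>auto simp: ramification_points_def U\<close>)
  also have "\<dots> = (\<Sum>v\<in>U. ram v - 1) + (\<Sum>v\<in>?R - U. ram v - 1)"
    by (rule sum.union_disjoint) (use fin finU in auto)
  also have "(\<Sum>v\<in>?R - U. ram v - 1) = (\<Sum>v\<in>?R - U. excess v)"
    by (rule sum.cong) (auto simp: excess_def U ramification_points_def)
  finally have 2: "2 * d - 2 = (\<Sum>v\<in>U. ram v - 1) + (\<Sum>v\<in>?R - U. excess v)"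
    using riemann_hurwitz(2) by simp
  have "(\<Sum>v\<in>U. ram v) = (\<Sum>v\<in>U. (ram v - 1) + 1)"
    by (rule sum.cong) (use ram_pos in \<open>auto simp: U Suc_le_eq\<close>)
  also have "\<dots> = (\<Sum>v\<in>U. ram v - 1) + card U" by (simp add: sum_Suc)
  finally have 3: "4 * d = (\<Sum>v\<in>U. ram v - 1) + 6 + card Ev" using sumU cardU by simp
  have "(\<Sum>v\<in>U \<union> ?R. excess v) = (\<Sum>v\<in>U \<union> (?R - U). excess v)" by simp
  also have "\<dots> = (\<Sum>v\<in>U. excess v) + (\<Sum>v\<in>?R - U. excess v)"
    by (rule sum.union_disjoint) (use fin finU in auto)
  \<comment> \<open>Let S1 and S2 be the sums over \<open>U\<close> and outside it. Equation
    \<open>1\<close> gives S1 = 2d - 3 - card Ev, and \<open>2\<close> minus \<open>3\<close> gives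
    S2 = 4 + card Ev - 2d.\<close>
  finally show "(\<Sum>v\<in>U \<union> ?R. excess v) = 1" using 1 2 3 d_pos by linarith
qed

lemma exceptional_point:
  obtains v0 where "point const_P1 v0" "excess v0 = 1"
    "\<And>v. point const_P1 v \<Longrightarrow> v \<noteq> v0 \<Longrightarrow> excess v = 0"
proof -
  let ?S = "(\<Union>t\<in>T. fib t) \<union> ramification_points const_P1 \<phi>"
  obtain v0 where v0: "v0 \<in> ?S" "excess v0 = 1" "\<forall>v\<in>?S. v0 \<noteq> v \<longrightarrow> excess v = 0"
    using iffD1[OF sum_eq_1_iff[OF sum_excess(1)] sum_excess(2)] by blast
  have "excess v = 0" if "point const_P1 v" "v \<noteq> v0" for v
  proof (cases "v \<in> ?S")
    case False
    then have "im v \<notin> T" "ram v \<le> 1" using that by (auto simp: fiber_def ramification_points_def)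
    then show ?thesis by (simp add: excess_def)
  qed (use v0 that in auto)
  with that v0 show ?thesis by (auto simp: fiber_def ramification_points_def)
qed

text \<open>The division is exact for the points of \<open>T\<close>: as \<open>d\<close> is even,
  each fiber contains an even number of points of odd index.\<close>

definition half_odd :: "('k poly fract \<Rightarrow> int) \<Rightarrow> nat" where
  "half_odd t = card {v \<in> fib t. odd (ram v)} div 2"

lemma regular_T_ram:
  assumes "point const_P1 v" "im v \<in> T" "excess v = 0"
  shows "ram v = 1 \<or> ram v = 2"
proof -
  have "(ram v - 1) div 2 = 0" using assms by (simp add: excess_def)
  then show ?thesis using ram_pos[OF assms(1)] by (auto simp: div_eq_0_iff)
qed

lemma regular_sum:
  assumes "t \<in> T" "V \<subseteq> fib t" "\<And>v. v \<in> V \<Longrightarrow> excess v = 0"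
  shows "(\<Sum>v\<in>V. ram v) = card {v \<in> V. odd (ram v)} + 2 * card {v \<in> V. ram v > 1}"
proof -
  have fin: "finite V" using fib_T[OF assms(1)] assms(2) finite_subset by blast
  have r: "ram v = 1 \<or> ram v = 2" if "v \<in> V" for v
    using that assms by (intro regular_T_ram) (auto simp: fiber_def)
  have "(\<Sum>v\<in>V. ram v) = (\<Sum>v\<in>V. (if odd (ram v) then 1 else 0) + 2 * (if ram v > 1 then 1 else 0))"
    by (rule sum.cong) (use r in force)+
  also have "\<dots> = card {v \<in> V. odd (ram v)} + 2 * card {v \<in> V. ram v > 1}"
    using fin by (simp add: sum.distrib sum_distrib_left[symmetric] sum.If_cases Int_def)
  finally show ?thesis .
qed

lemma regular_image_mset:
  assumes "t \<in> T" "V \<subseteq> fib t" "\<And>v. v \<in> V \<Longrightarrow> excess v = 0"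
  shows "image_mset ram (mset_set {v \<in> V. ram v > 1}) = twos (card {v \<in> V. ram v > 1})"
proof -
  have fin: "finite V" using fib_T[OF assms(1)] assms(2) finite_subset by blast
  have "ram v = 2" if "v \<in> V" "ram v > 1" for v
    using that assms regular_T_ram[of v] by (auto simp: fiber_def)
  then have "image_mset ram (mset_set {v \<in> V. ram v > 1}) = image_mset (\<lambda>_. 2) (mset_set {v \<in> V. ram v > 1})"
    using fin by (intro image_mset_cong) auto
  then show ?thesis by (simp add: image_mset_const_eq)
qed

text \<open>All indices are 1 or 2, so 2h is the number of odd points plus twice the number of
  points of index 2; this yields the parity as well as the exponent.\<close>

lemma regular_fiber:
  assumes t: "t \<in> T" and reg: "\<And>v. v \<in> fib t \<Longrightarrow> excess v = 0"
  shows "fiber_type_of const_P1 \<phi> t = twos (h - half_odd t)" "half_odd t \<le> h"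
    "card {v \<in> fib t. odd (ram v)} = 2 * half_odd t"
proof -
  have sum: "2 * h = card {v \<in> fib t. odd (ram v)} + 2 * card {v \<in> fib t. ram v > 1}"
    using regular_sum[OF t subset_refl reg] fib_T[OF t] d_even by simp
  then have "2 * h = 0 + card {v \<in> fib t. odd (ram v)} + 2 * card {v \<in> fib t. ram v > 1}"
    by (simp only: add_0)
  then have "even (card {v \<in> fib t. odd (ram v)})" by (rule even_of_sum_eq) simp
  then show odd: "card {v \<in> fib t. odd (ram v)} = 2 * half_odd t" by (simp add: half_odd_def)
  then show "half_odd t \<le> h" using sum by simp
  have "card {v \<in> fib t. ram v > 1} = h - half_odd t" using sum odd by simp
  then show "fiber_type_of const_P1 \<phi> t = twos (h - half_odd t)"
    using regular_image_mset[OF t subset_refl reg] fib_T[OF t] by (simp add: fiber_type_of_eq)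
qed

lemma special_fiber:
  assumes v0: "point const_P1 v0" "im v0 \<in> T" "excess v0 = 1"
    and reg: "\<And>v. point const_P1 v \<Longrightarrow> v \<noteq> v0 \<Longrightarrow> excess v = 0"
  defines "t \<equiv> im v0"
  shows "card {v \<in> fib t. odd (ram v)} = 2 * half_odd t"
    and "ram v0 = 3 \<and> 1 \<le> half_odd t \<and> 1 + half_odd t \<le> h \<and>
        fiber_type_of const_P1 \<phi> t = add_mset 3 (twos (h - (1 + half_odd t))) \<or>
      ram v0 = 4 \<and> 2 + half_odd t \<le> h \<and>
        fiber_type_of const_P1 \<phi> t = add_mset 4 (twos (h - (2 + half_odd t)))"
proof -
  have t: "t \<in> T" using v0 by (simp add: t_def)
  let ?V = "fib t - {v0}"
  have v0f: "v0 \<in> fib t" using v0 by (simp add: fiber_def t_def)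
  have fin: "finite (fib t)" using fib_T[OF t] by simp
  have regV: "excess v = 0" if "v \<in> ?V" for v using that reg by (auto simp: fiber_def)
  define N where "N = card {v \<in> ?V. ram v > 1}"
  have "(ram v0 - 1) div 2 = 1" using v0 by (simp add: excess_def)
  then have r0: "ram v0 = 3 \<or> ram v0 = 4" by presburger
  have remove: "2 * h = ram v0 + (\<Sum>v\<in>?V. ram v)"
    using fib_T[OF t] d_even sum.remove[OF fin v0f, of ram] by simp
  have sum: "2 * h = ram v0 + card {v \<in> ?V. odd (ram v)} + 2 * N"
    unfolding N_def using remove regular_sum[OF t Diff_subset[of "fib t" "{v0}"] regV] by linarith
  have "{v \<in> fib t. ram v > 1} = insert v0 {v \<in> ?V. ram v > 1}" using v0f r0 by auto
  then have "mset_set {v \<in> fib t. ram v > 1} = add_mset v0 (mset_set {v \<in> ?V. ram v > 1})"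
    using fin by simp
  then have type: "fiber_type_of const_P1 \<phi> t = add_mset (ram v0) (twos N)"
    using regular_image_mset[OF t Diff_subset[of "fib t" "{v0}"] regV] fin by (simp add: fiber_type_of_eq N_def)
  from r0 have "card {v \<in> fib t. odd (ram v)} = 2 * half_odd t \<and>
      (ram v0 = 3 \<and> 1 \<le> half_odd t \<and> 1 + half_odd t \<le> h \<and> N = h - (1 + half_odd t) \<or>
       ram v0 = 4 \<and> 2 + half_odd t \<le> h \<and> N = h - (2 + half_odd t))"
  proof
    assume r: "ram v0 = 3"
    have "{v \<in> fib t. odd (ram v)} = insert v0 {v \<in> ?V. odd (ram v)}" using v0f r by auto
    then have c: "card {v \<in> fib t. odd (ram v)} = card {v \<in> ?V. odd (ram v)} + 1" using fin by simp
    then have *: "2 * h = 2 + card {v \<in> fib t. odd (ram v)} + 2 * N" using sum r by simp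
    then have "even (card {v \<in> fib t. odd (ram v)})" by (rule even_of_sum_eq) simp
    then have "card {v \<in> fib t. odd (ram v)} = 2 * half_odd t" by (simp add: half_odd_def)
    with * c r show ?thesis by auto
  next
    assume r: "ram v0 = 4"
    have "{v \<in> fib t. odd (ram v)} = {v \<in> ?V. odd (ram v)}" using r by auto
    then have *: "2 * h = 4 + card {v \<in> fib t. odd (ram v)} + 2 * N" using sum r by simp
    then have "even (card {v \<in> fib t. odd (ram v)})" by (rule even_of_sum_eq) simp
    then have "card {v \<in> fib t. odd (ram v)} = 2 * half_odd t" by (simp add: half_odd_def)
    with * r show ?thesis by auto
  qed
  then show "card {v \<in> fib t. odd (ram v)} = 2 * half_odd t"
    "ram v0 = 3 \<and> 1 \<le> half_odd t \<and> 1 + half_odd t \<le> h \<and>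
        fiber_type_of const_P1 \<phi> t = add_mset 3 (twos (h - (1 + half_odd t))) \<or>
      ram v0 = 4 \<and> 2 + half_odd t \<le> h \<and>
        fiber_type_of const_P1 \<phi> t = add_mset 4 (twos (h - (2 + half_odd t)))"
    using type by auto
qed

lemma sum_half_odd:
  assumes "\<And>t. t \<in> T \<Longrightarrow> card {v \<in> fib t. odd (ram v)} = 2 * half_odd t"
  shows "(\<Sum>t\<in>T. half_odd t) = 3"
proof -
  have "B = (\<Union>t\<in>T. {v \<in> fib t. odd (ram v)})" by (auto simp: B_def fiber_def)
  then have "6 = card (\<Union>t\<in>T. {v \<in> fib t. odd (ram v)})" using cardB by simp
  also have "\<dots> = (\<Sum>t\<in>T. card {v \<in> fib t. odd (ram v)})"
  proof (rule card_UN_disjoint[OF finT])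
    show "\<forall>t\<in>T. finite {v \<in> fib t. odd (ram v)}" using fib_T by simp
  qed (auto simp: fiber_def)
  also have "\<dots> = 2 * (\<Sum>t\<in>T. half_odd t)" using assms by (simp add: sum_distrib_left)
  finally show ?thesis by simp
qed

text \<open>The point of excess 1 lies either outside \<open>T\<close>, where it has index 2, or
  over \<open>T\<close>, where it has index 3 or 4. The six odd points leave four half-counts with
  sum 3 to be distributed over \<open>T\<close>.\<close>

theorem ramification_structure_cases:
  obtains v0 where "point const_P1 v0" "im v0 \<notin> T" "ram v0 = 2"
      "\<And>v. point const_P1 v \<Longrightarrow> v \<noteq> v0 \<Longrightarrow> ram v = 1 \<or> im v \<in> T \<and> ram v = 2"
      "ramification_structure const_P1 \<phi> T \<in> type_I (2 * int h) \<union> type_II (2 * int h) \<union> type_III (2 * int h)"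
  | v0 where "point const_P1 v0" "im v0 \<in> T" "ram v0 = 3 \<or> ram v0 = 4"
      "\<And>v. point const_P1 v \<Longrightarrow> v \<noteq> v0 \<Longrightarrow> ram v = 1 \<or> im v \<in> T \<and> ram v = 2"
      "ramification_structure const_P1 \<phi> T \<in> degenerate_I (2 * int h) \<union> degenerate_II (2 * int h) \<union> degenerate_III (2 * int h)"
proof -
  obtain v0 where v0: "point const_P1 v0" "excess v0 = 1"
    and reg: "\<And>v. point const_P1 v \<Longrightarrow> v \<noteq> v0 \<Longrightarrow> excess v = 0" using exceptional_point by blast
  have ram_reg: "ram v = 1 \<or> im v \<in> T \<and> ram v = 2" if "point const_P1 v" "v \<noteq> v0" for v
    using regular_T_ram[OF that(1) _ reg[OF that]] reg[OF that] ram_pos[OF that(1)]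
    by (cases "im v \<in> T") (auto simp: excess_def)
  define ft where "ft = fiber_type_of const_P1 \<phi>"
  show ?thesis
  proof (cases "im v0 \<in> T")
    case False
    have r0: "ram v0 = 2" using v0(2) False by (simp add: excess_def)
    have regT: "excess v = 0" if "v \<in> fib t" "t \<in> T" for v t
      using that reg False by (auto simp: fiber_def)
    note rf = regular_fiber[OF _ regT]
    have "image_mset ft (mset_set T) = image_mset (\<lambda>t. twos (h - half_odd t)) (mset_set T)"
      by (rule image_mset_cong) (use rf(1) finT in \<open>auto simp: ft_def\<close>)
    then have 1: "image_mset ft (mset_set T) = image_mset (\<lambda>a. twos (h - a)) (image_mset half_odd (mset_set T))"
      by (simp add: comp_def image_mset.compositionality)
    have "branch_points const_P1 \<phi> - T = {im v0}"
      using ram_reg v0 r0 False by (fastforce simp: branch_points_def ramification_points_def)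
    moreover have "ft (im v0) = {#2#}"
    proof -
      have "{v \<in> fib (im v0). ram v > 1} = {v0}"
        using ram_reg v0 r0 False by (fastforce simp: fiber_def)
      then show ?thesis using sum_ram_fiber(1)[OF lies_over_im(2)[OF v0(1)]] r0
        by (simp add: ft_def fiber_type_of_eq)
    qed
    ultimately have "ramification_structure const_P1 \<phi> T =
        (image_mset (\<lambda>a. twos (h - a)) (image_mset half_odd (mset_set T)), {#{#2#}#})"
      using 1 by (simp add: ramification_structure_def ft_def)
    moreover have "\<dots> \<in> type_I (2 * int h) \<union> type_II (2 * int h) \<union> type_III (2 * int h)"
    proof (rule generic_structures)
      show "size (image_mset half_odd (mset_set T)) = 4" using cardT by simp
      show "sum_mset (image_mset half_odd (mset_set T)) = 3"
        using sum_half_odd rf(3) by (simp add: sum_unfold_sum_mset[symmetric])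
      show "a \<le> h" if "a \<in># image_mset half_odd (mset_set T)" for a using that rf(2) finT by auto
      show "h > 0" using d_pos d_even by simp
    qed
    ultimately show ?thesis using that(1)[OF v0(1) False r0 ram_reg] by simp
  next
    case True
    define t0 where "t0 = im v0"
    define T' where "T' = T - {t0}"
    have t0: "t0 \<in> T" using True by (simp add: t0_def)
    then have T: "T = insert t0 T'" "t0 \<notin> T'" "finite T'" "card T' = 3"
      using finT cardT by (auto simp: T'_def)
    have regT: "excess v = 0" if "v \<in> fib t" "t \<in> T'" for v t
      using that reg by (auto simp: fiber_def T'_def t0_def)
    note rf = regular_fiber[OF _ regT]
    have T'T: "t \<in> T" if "t \<in> T'" for t using that by (simp add: T'_def)
    note sf = special_fiber[OF v0(1) True v0(2) reg, folded t0_def]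
    have "card {v \<in> fib t. odd (ram v)} = 2 * half_odd t" if "t \<in> T" for t
      using that sf(1) rf(3)[OF T'T] T(1) by auto
    then have "half_odd t0 + (\<Sum>t\<in>T'. half_odd t) = 3" using sum_half_odd T by simp
    then have sum: "half_odd t0 + sum_mset (image_mset half_odd (mset_set T')) = 3"
      by (simp add: sum_unfold_sum_mset[symmetric])
    have size: "size (image_mset half_odd (mset_set T')) = 3" using T by simp
    have le: "\<forall>a\<in>#image_mset half_odd (mset_set T'). a \<le> h" using rf(2)[OF T'T] T by auto
    have "image_mset ft (mset_set T') = image_mset (\<lambda>t. twos (h - half_odd t)) (mset_set T')"
      by (rule image_mset_cong) (use rf(1)[OF T'T] T in \<open>auto simp: ft_def\<close>)
    then have "image_mset ft (mset_set T) = add_mset (ft t0) (image_mset (\<lambda>a. twos (h - a)) (image_mset half_odd (mset_set T')))"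
      using T by (simp add: comp_def image_mset.compositionality)
    moreover have "branch_points const_P1 \<phi> - T = {}"
      using ram_reg True by (fastforce simp: branch_points_def ramification_points_def)
    ultimately have R: "ramification_structure const_P1 \<phi> T =
        (add_mset (ft t0) (image_mset (\<lambda>a. twos (h - a)) (image_mset half_odd (mset_set T'))), {#})"
      unfolding ramification_structure_def ft_def by (simp only: mset_set.empty image_mset_empty)
    have "ramification_structure const_P1 \<phi> T \<in> degenerate_I (2 * int h) \<union> degenerate_II (2 * int h) \<union> degenerate_III (2 * int h)"
      unfolding R using sf(2) degenerate_structures_3[OF size sum le] degenerate_structures_4[OF size sum le]
      by (auto simp: ft_def)
    then show ?thesis using that(2)[OF v0(1) True _ ram_reg] sf(2) by blast
  qed
qed

end

end

section \<open>The two curves\<close>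

text \<open>Cramer's rule turns an arbitrary basis into 1, z for some z outside the subfield, and
  completing the square makes z a pure square root.\<close>

lemma quadratic_generator:
  fixes h :: "'b::field \<Rightarrow> 'a::field"
  assumes h: "field_hom h" and two: "(2::'b) \<noteq> 0" and deg: "cover_degree h = 2"
  obtains y F where "y\<^sup>2 = h F" "y \<notin> range h" "\<And>z. \<exists>a b. z = h a + h b * y"
proof -
  interpret V: vector_space "\<lambda>b a. h b * a" by (rule field_hom_vector_space[OF h])
  have dim: "V.dim UNIV = 2" using deg by (simp add: cover_degree_def)
  then have "V.dim UNIV > 0" by simp
  then obtain B where B: "finite B" "card B = 2" "\<And>z. \<exists>c. z = (\<Sum>b\<in>B. h (c b) * b)"
    "\<And>c b. (\<Sum>b\<in>B. h (c b) * b) = 0 \<Longrightarrow> b \<in> B \<Longrightarrow> c b = 0"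
    using V.finite_basis_of_dim unfolding dim by blast
  obtain b1 b2 where b: "B = {b1, b2}" "b1 \<noteq> b2" using B(2) by (auto simp: card_2_iff)
  have span: "\<exists>p q. z = h p * b1 + h q * b2" for z
  proof -
    obtain c where "z = (\<Sum>b\<in>B. h (c b) * b)" using B(3) by blast
    then show ?thesis using b by auto
  qed
  have ind: "p = 0 \<and> q = 0" if "h p * b1 + h q * b2 = 0" for p q
    using B(4)[of "\<lambda>x. if x = b1 then p else q" b1] B(4)[of "\<lambda>x. if x = b1 then p else q" b2] that b by auto
  have "\<exists>z. z \<notin> range h"
  proof (rule ccontr)
    assume "\<not> ?thesis"
    then obtain c1 c2 where c: "b1 = h c1" "b2 = h c2" by (metis rangeE)
    have "h c2 * b1 + h (- c1) * b2 = 0" by (simp add: c field_hom_minus[OF h])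
    from ind[OF this] have "c2 = 0" "c1 = 0" by auto
    then show False using b c by simp
  qed
  then obtain z where z: "z \<notin> range h" by blast
  obtain a1 a2 where one: "1 = h a1 * b1 + h a2 * b2" using span by blast
  obtain c1 c2 where zc: "z = h c1 * b1 + h c2 * b2" using span by blast
  \<comment> \<open>The determinant of the coordinates of 1 and z. If it vanished, either z would
    lie in \<open>range h\<close> or 1 would be 0.\<close>
  define \<Delta> where "\<Delta> = a1 * c2 - a2 * c1"
  have cramer: "h \<Delta> * b1 = h c2 - h a2 * z" "h \<Delta> * b2 = h a1 * z - h c1"
  proof -
    have "h c2 - h a2 * z = h c2 * 1 - h a2 * z" by simp
    also have "\<dots> = h \<Delta> * b1"
      by (subst one, subst zc) (simp add: \<Delta>_def field_hom_diff[OF h] field_hom_mult[OF h] algebra_simps del: V.scale_scale)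
    finally show "h \<Delta> * b1 = h c2 - h a2 * z" by simp
    have "h a1 * z - h c1 = h a1 * z - h c1 * 1" by simp
    also have "\<dots> = h \<Delta> * b2"
      by (subst one, subst zc) (simp add: \<Delta>_def field_hom_diff[OF h] field_hom_mult[OF h] algebra_simps del: V.scale_scale)
    finally show "h \<Delta> * b2 = h a1 * z - h c1" by simp
  qed
  have "\<Delta> \<noteq> 0"
  proof
    assume D: "\<Delta> = 0"
    have "a2 = 0"
    proof (rule ccontr)
      assume "a2 \<noteq> 0"
      then have "z = h (c2 / a2)" using cramer(1) h by (simp add: D field_hom_0 field_hom_divide[OF h] field_simps)
      then show False using z by blast
    qed
    have "a1 = 0"
    proof (rule ccontr)
      assume "a1 \<noteq> 0"
      then have "z = h (c1 / a1)" using cramer(2) h by (simp add: D field_hom_0 field_hom_divide[OF h] field_simps)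
      then show False using z by blast
    qed
    then show False using one \<open>a2 = 0\<close> by (simp add: field_hom_0[OF h])
  qed
  then have hD: "h \<Delta> \<noteq> 0" using h by simp
  have b12: "b1 = h (c2 / \<Delta>) + h (- a2 / \<Delta>) * z" "b2 = h (- c1 / \<Delta>) + h (a1 / \<Delta>) * z"
  proof -
    have "b1 = (h c2 - h a2 * z) / h \<Delta>" "b2 = (h a1 * z - h c1) / h \<Delta>"
      using cramer hD by (simp_all add: field_simps)
    then show "b1 = h (c2 / \<Delta>) + h (- a2 / \<Delta>) * z" "b2 = h (- c1 / \<Delta>) + h (a1 / \<Delta>) * z"
      using hD by (simp_all add: field_hom_divide[OF h] field_hom_minus[OF h] diff_divide_distrib)
  qed
  have gen: "\<exists>p q. x = h p + h q * z" for x
  proof -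
    obtain p q where x: "x = h p * b1 + h q * b2" using span by blast
    have "x = h (p * (c2 / \<Delta>) + q * (- c1 / \<Delta>)) + h (p * (- a2 / \<Delta>) + q * (a1 / \<Delta>)) * z"
      unfolding x by (subst b12(1), subst b12(2))
        (simp only: field_hom_add[OF h] field_hom_mult[OF h] distrib_left distrib_right mult.assoc add_ac)
    then show ?thesis by blast
  qed
  obtain p q where pq: "z\<^sup>2 = h p + h q * z" using gen by blast
  define y where "y = z - h (q / 2)"
  have q2: "h q = 2 * h (q / 2)"
    using field_hom_mult[OF h, of 2 "q / 2"] two by (simp add: field_hom_2[OF h])
  have "y\<^sup>2 = z\<^sup>2 - h q * z + (h (q / 2))\<^sup>2"
    unfolding y_def q2 by (simp only: power2_diff) (simp add: mult_ac del: V.scale_scale)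
  then have "y\<^sup>2 = h (p + (q / 2)\<^sup>2)" by (simp add: pq field_hom_add[OF h] field_hom_power[OF h])
  moreover have "y \<notin> range h"
  proof
    assume "y \<in> range h"
    then obtain r where "y = h r" by blast
    then have "z = h (r + q / 2)" by (simp add: y_def field_hom_add[OF h] algebra_simps)
    then show False using z by blast
  qed
  moreover have "\<exists>a b. x = h a + h b * y" for x
  proof -
    obtain a b where x: "x = h a + h b * z" using gen by blast
    have "x = h (a + b * (q / 2)) + h b * y"
      unfolding x y_def by (simp only: field_hom_add[OF h] field_hom_mult[OF h] right_diff_distrib) simp
    then show ?thesis by blast
  qed
  ultimately show ?thesis using that by blast
qed

lemma two_neq_0_P1: "(2 :: 'k::field_char_0 poly fract) \<noteq> 0"
proof -
  have "const_P1 (2::'k) \<noteq> 0" by (simp add: field_hom_const_P1)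
  then show ?thesis by (simp add: field_hom_2[OF field_hom_const_P1])
qed

text \<open>The square of \<open>y\<close> is fixed by \<open>s\<close>, so \<open>s y\<close> is
  \<open>y\<close> or \<open>- y\<close>; the former would put \<open>y\<close> into the fixed
  field, which is \<open>range h\<close>.\<close>

lemma P1_quotient_double_cover:
  fixes \<iota> :: "'k::{alg_closed_field, field_char_0} \<Rightarrow> 'a::field"
  assumes Q: "P1_quotient \<iota> s h" and s: "field_hom s"
  obtains y F where "double_cover \<iota> h y F s"
proof -
  have cov: "covering const_P1 \<iota> h" and range: "range h = {z. s z = z}" and deg: "cover_degree h = 2"
    using Q by (auto simp: P1_quotient_def)
  obtain y F where y: "y\<^sup>2 = h F" "y \<notin> range h" "\<And>z. \<exists>a b. z = h a + h b * y"
    using quadratic_generator[OF covering_hom[OF cov] two_neq_0_P1 deg] by blast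
  have sh: "s (h a) = h a" for a using range by blast
  have "(s y)\<^sup>2 = y\<^sup>2" using field_hom_power[OF s, of y 2] by (simp add: y(1) sh)
  then have "s y = y \<or> s y = - y" by (simp add: power2_eq_iff)
  then have "s y = - y" using y(2) range by auto
  then have "double_cover \<iota> h y F s" using cov y s sh by unfold_locales auto
  with that show ?thesis by blast
qed

context double_cover
begin

text \<open>The invariant part of \<open>z\<close> is zero, so \<open>z = \<pi> b * y\<close>
  generates as well as \<open>y\<close> does. This is how the generator on \<open>E\<close> is
  carried over to \<open>C\<close>.\<close>

lemma antiinvariant_generator:
  assumes z: "w z = - z" "z \<noteq> 0" and sq: "z\<^sup>2 = \<pi> G"
  shows "double_cover \<iota> \<pi> z G w"
proof -
  obtain a b where zab: "z = \<pi> a + \<pi> b * y" using generate by blast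
  have "z + w z = 2 * \<pi> a" by (simp add: zab w_coords)
  then have "\<pi> a = 0" using z two_nz by simp
  then have zb: "z = \<pi> b * y" by (simp add: zab)
  then have b: "\<pi> b \<noteq> 0" using z by auto
  show ?thesis
  proof unfold_locales
    show "z \<notin> range \<pi>"
    proof
      assume "z \<in> range \<pi>"
      then have "w z = z" using w_pi by auto
      then have "2 * z = 0" using z(1) by (metis add.right_inverse mult_2)
      then show False using z(2) two_nz by simp
    qed
    fix x
    obtain p q where "x = \<pi> p + \<pi> q * y" using generate by blast
    then have "x = \<pi> p + \<pi> (q / b) * z" using b by (simp add: zb field_hom_divide[OF pi_hom])
    then show "\<exists>p q. x = \<pi> p + \<pi> q * z" by blast
  qed (use cov sq w_hom w_pi z in auto)
qed

end

text \<open>If P lies over a point of even order of \<open>F\<close>, then P differs from -P. Were P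
  also 2-torsion, P - (-P) would be principal with poles bounded by one fiber, so its function would
  come from the line and have the same order at P and -P. Conversely, the point over a point of odd
  order is fixed by \<nu>.\<close>

lemma two_torsion_image:
  assumes E: "double_cover \<kappa> \<pi> y F \<nu>" and g: "has_genus \<kappa> 1" and neg: "negation \<kappa> \<O> \<nu>"
  shows "image_point \<pi> ` two_torsion \<kappa> \<O> = odd_points F"
proof -
  interpret double_cover \<kappa> \<pi> y F \<nu> by (rule E)
  have inv: "inverse_points \<kappa> \<O> P (\<lambda>z. P (\<nu> z))" if P: "point \<kappa> P" for P
  proof -
    have "lies_over \<nu> P 1 (\<lambda>z. P (\<nu> z))" by (simp add: lies_over_def)
    then have "image_point \<nu> P = (\<lambda>z. P (\<nu> z))"
      using lies_over_point_unique(2)[OF point_w(1)[OF P]] by blast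
    then show ?thesis using neg P unfolding negation_def by metis
  qed
  have "im P \<in> odd_points F" if P: "P \<in> two_torsion \<kappa> \<O>" for P
  proof (rule ccontr)
    have pP: "point \<kappa> P" and PP: "inverse_points \<kappa> \<O> P P" using P by (auto simp: two_torsion_def)
    let ?P' = "\<lambda>z. P (\<nu> z)"
    assume "im P \<notin> odd_points F"
    then have "even (im P F)" using lies_over_im(2)[OF pP] by (simp add: odd_points_def)
    then have ne: "?P' \<noteq> P" using even_point(2)[OF pP] by blast
    obtain z1 where z1: "z1 \<noteq> 0" "\<And>v. point \<kappa> v \<Longrightarrow> (pt_div P v + pt_div ?P' v) - 2 * pt_div \<O> v = v z1"
      using inv[OF pP] unfolding inverse_points_def lin_equiv_def by blast
    obtain z2 where z2: "z2 \<noteq> 0" "\<And>v. point \<kappa> v \<Longrightarrow> (pt_div P v + pt_div P v) - 2 * pt_div \<O> v = v z2"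
      using PP unfolding inverse_points_def lin_equiv_def by blast
    \<comment> \<open>The multiples of the origin cancel in the quotient, whose divisor is P -
      P'.\<close>
    define z where "z = z2 / z1"
    have z: "z \<noteq> 0" "v z = pt_div P v - pt_div ?P' v" if "point \<kappa> v" for v
      using z1(1) z2(1) z1(2)[OF that] z2(2)[OF that] valn_divide[OF point_valn[OF that] z2(1) z1(1)]
      by (simp_all add: z_def)
    have "z \<in> range \<pi>"
    proof (rule one_fiber_poles_descend[OF g _ lies_over_im(2)[OF pP]])
      show "vge v 0 z" if "point \<kappa> v" "im v \<noteq> im P" for v
      proof -
        have "v \<noteq> P" "v \<noteq> ?P'" using that point_w(2)[OF pP] by auto
        then show ?thesis using z(2)[OF that(1)] by (simp add: vge_def pt_div_def)
      qed
      show "vge v (-1) z" if "point \<kappa> v" "im v = im P" for v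
        using z(2)[OF that(1)] by (simp add: vge_def pt_div_def)
    qed simp
    then obtain a where "z = \<pi> a" by blast
    then have "?P' z = P z" by (simp add: w_pi)
    moreover have "P z = 1" using z(2)[OF pP] ne by (simp add: pt_div_def)
    moreover have "?P' z = -1" using z(2)[OF point_w(1)[OF pP]] ne by (simp add: pt_div_def)
    ultimately show False by simp
  qed
  moreover have "u \<in> im ` two_torsion \<kappa> \<O>" if u: "u \<in> odd_points F" for u
  proof -
    have pu: "point const_P1 u" "odd (u F)" using u by (auto simp: odd_points_def)
    obtain v where v: "point \<kappa> v" "im v = u" "(\<lambda>z. v (\<nu> z)) = v" using fiber_odd[OF pu] by metis
    then have "v \<in> two_torsion \<kappa> \<O>" using inv[OF v(1)] by (simp add: two_torsion_def)
    then show ?thesis using v(2) by blast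
  qed
  ultimately show ?thesis by blast
qed

theorem theorem2:
  fixes \<iota> :: "'k::{alg_closed_field, field_char_0} \<Rightarrow> 'c::field"
    and \<kappa> :: "'k \<Rightarrow> 'e::field"
    and \<O> :: "'e \<Rightarrow> int"
    and \<psi> :: "'e \<Rightarrow> 'c"
    and w :: "'c \<Rightarrow> 'c"
    and \<nu> :: "'e \<Rightarrow> 'e"
    and \<pi>\<^sub>C :: "'k poly fract \<Rightarrow> 'c"
    and \<pi>\<^sub>E :: "'k poly fract \<Rightarrow> 'e"
    and \<phi> :: "'k poly fract \<Rightarrow> 'k poly fract"
    and n :: nat
  assumes "genus2_curve \<iota>"
    and "elliptic_curve \<kappa> \<O>"
    and "covering \<kappa> \<iota> \<psi>"
    and "cover_degree \<psi> = n" and "n > 0" and "even n"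
    and "hyperelliptic_involution \<iota> w"
    and "negation \<kappa> \<O> \<nu>"
    and "w \<circ> \<psi> = \<psi> \<circ> \<nu>"
    and "P1_quotient \<iota> w \<pi>\<^sub>C"
    and "P1_quotient \<kappa> \<nu> \<pi>\<^sub>E"
    and "covering const_P1 const_P1 \<phi>"
    and "\<pi>\<^sub>C \<circ> \<phi> = \<psi> \<circ> \<pi>\<^sub>E"
  defines "R \<equiv> ramification_structure const_P1 \<phi> (image_point \<pi>\<^sub>E ` two_torsion \<kappa> \<O>)"
  shows "(generic_covering \<iota> \<psi> \<longrightarrow> R \<in> type_I (int n) \<union> type_II (int n) \<union> type_III (int n)) \<and>
    (\<not> generic_covering \<iota> \<psi> \<longrightarrow>
       R \<in> degenerate_I (int n) \<union> degenerate_II (int n) \<union> degenerate_III (int n)) \<and>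
    (\<forall>S \<in> type_I (int n). collapses n S = degenerate_I (int n)) \<and>
    (\<forall>S \<in> type_II (int n). collapses n S = degenerate_II (int n)) \<and>
    (\<forall>S \<in> type_III (int n). collapses n S = degenerate_III (int n))"
proof -
  obtain h where n: "n = 2 * h" using \<open>even n\<close> by (elim evenE)
  then have int_n: "int n = 2 * int h" by simp
  have gC: "has_genus \<iota> 2" using assms(1) by (simp add: genus2_curve_def)
  have gE: "has_genus \<kappa> 1" using assms(2) by (simp add: elliptic_curve_def)
  have hw: "field_hom w" using assms(7) by (auto simp: hyperelliptic_involution_def covering_def)
  have h\<nu>: "field_hom \<nu>" using assms(8) by (auto simp: negation_def covering_def)
  note h\<psi> = covering_hom[OF assms(3)]
  have w\<psi>: "w (\<psi> z) = \<psi> (\<nu> z)" for z using assms(9) by (metis comp_apply)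
  have sq: "\<pi>\<^sub>C (\<phi> z) = \<psi> (\<pi>\<^sub>E z)" for z using assms(13) by (metis comp_apply)
  obtain s fE where E_loc: "double_cover \<kappa> \<pi>\<^sub>E s fE \<nu>" using P1_quotient_double_cover[OF assms(11) h\<nu>] by blast
  interpret E: double_cover \<kappa> \<pi>\<^sub>E s fE \<nu> by (rule E_loc)
  obtain y0 F0 where C0: "double_cover \<iota> \<pi>\<^sub>C y0 F0 w" using P1_quotient_double_cover[OF assms(10) hw] by blast
  have C_loc: "double_cover \<iota> \<pi>\<^sub>C (\<psi> s) (\<phi> fE) w"
  proof (rule double_cover.antiinvariant_generator[OF C0])
    show "w (\<psi> s) = - \<psi> s" by (simp add: w\<psi> E.w_y field_hom_minus[OF h\<psi>])
    show "\<psi> s \<noteq> 0" using E.y_nz h\<psi> by simp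
    show "(\<psi> s)\<^sup>2 = \<pi>\<^sub>C (\<phi> fE)" by (simp add: field_hom_power[OF h\<psi>, symmetric] E.y2 sq)
  qed
  interpret C: double_cover \<iota> \<pi>\<^sub>C "\<psi> s" "\<phi> fE" w by (rule C_loc)
  obtain f g where fg: "\<phi> (to_fract [:0, 1:]) = to_fract f / to_fract g" "g \<noteq> 0"
    "\<And>c. poly f c \<noteq> 0 \<or> poly g c \<noteq> 0" using coprime_representation by metis
  interpret P: P1_covering \<phi> f g by unfold_locales (use assms(12) fg in auto)
  \<comment> \<open>Both ways around the square have degree 2n, which makes the degree of \<phi>
    equal to n.\<close>
  have "cover_degree (\<pi>\<^sub>C \<circ> \<phi>) = 2 * P.d"
    using cover_degree_compose[OF C.pi_hom P.phi_hom] assms(10) P.cover_degree_eq P.d_pos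
    by (simp add: P1_quotient_def)
  moreover have "cover_degree (\<psi> \<circ> \<pi>\<^sub>E) = n * 2"
    using cover_degree_compose[OF h\<psi> E.pi_hom] assms(11,4,5) by (simp add: P1_quotient_def)
  ultimately have d: "P.d = 2 * h" using assms(13) n by simp
  define T where "T = odd_points fE"
  have T_eq: "image_point \<pi>\<^sub>E ` two_torsion \<kappa> \<O> = T"
    unfolding T_def by (rule two_torsion_image[OF E_loc gE assms(8)])
  have T: "u \<in> T \<longleftrightarrow> point const_P1 u \<and> odd (u fE)" for u by (simp add: T_def odd_points_def)
  have finT: "finite T" and cardT: "card T = 4" using E.genus_odd_points[OF gE] by (simp_all add: T_def)
  define B where "B = {v. point const_P1 v \<and> P.im v \<in> T \<and> odd (P.ram v)}"
  \<comment> \<open>The order of \<open>\<phi> fE\<close> at \<open>v\<close> is the index of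
    \<open>v\<close> times the order of \<open>fE\<close> at its image, so it is odd exactly when
    both factors are.\<close>
  have BC: "v \<in> B \<longleftrightarrow> odd (v (\<phi> fE))" if "point const_P1 v" for v
    using that P.lies_over_im(2)[OF that] by (auto simp: B_def T P.v_phi)
  then have "B = odd_points (\<phi> fE)" by (auto simp: B_def odd_points_def)
  then have cardB: "card B = 6" using C.genus_odd_points[OF gC] by simp
  have ptsT: "T \<subseteq> Collect (point const_P1)" using T by blast
  note cases = P.ramification_structure_cases[OF finT cardT ptsT B_def cardB d, consumes 0]

  \<comment> \<open>Restricting \<open>p\<close> to k(X) along either side of the square gives the
    same valuation, so the image points on the line agree and so do the products of indices. That
    valuation is nontrivial, which shows that \<open>p\<close> is nontrivial on the function field
    of \<open>E\<close>.\<close>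
  have \<psi>_point: "lies_over \<psi> p (ram_index \<psi> p) (image_point \<psi> p)" "point \<kappa> (image_point \<psi> p)"
      "E.im (image_point \<psi> p) = P.im (C.im p)"
      "ram_index \<psi> p * E.ram (image_point \<psi> p) = C.ram p * P.ram (C.im p)"
    if p: "point \<iota> p" for p
  proof -
    note v = C.lies_over_im(2)[OF p]
    have comp: "p (\<psi> (\<pi>\<^sub>E z)) = int (C.ram p * P.ram (C.im p)) * P.im (C.im p) z" for z
      using C.v_pi[OF p, of "\<phi> z"] P.v_phi[OF v] by (simp add: sq)
    obtain r where "P.im (C.im p) r = 1" using P.lies_over_im(2)[OF v] by (auto simp: point_iff_valn)
    then have nt: "p (\<psi> (\<pi>\<^sub>E r)) \<noteq> 0" using comp[of r] C.ram_pos[OF p] P.ram_pos[OF v] by simp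
    note lo = covering_lies_over[OF p assms(3) nt]
    show "lies_over \<psi> p (ram_index \<psi> p) (image_point \<psi> p)" "point \<kappa> (image_point \<psi> p)" by (rule lo)+
    have eq: "int (ram_index \<psi> p * E.ram (image_point \<psi> p)) * E.im (image_point \<psi> p) z =
        int (C.ram p * P.ram (C.im p)) * P.im (C.im p) z" for z
      using lo(1) comp[of z] E.v_pi[OF lo(2), of z] by (simp add: lies_over_def)
    have "ram_index \<psi> p * E.ram (image_point \<psi> p) > 0"
      using lo(1) E.ram_pos[OF lo(2)] by (simp add: lies_over_def)
    from point_multiple_unique[OF E.lies_over_im(2)[OF lo(2)] P.lies_over_im(2)[OF v] eq this]
    show "E.im (image_point \<psi> p) = P.im (C.im p)"
      "ram_index \<psi> p * E.ram (image_point \<psi> p) = C.ram p * P.ram (C.im p)" by auto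
  qed
  \<comment> \<open>Over \<open>T\<close> the map to the line from \<open>E\<close> has index 2,
    while the one from \<open>C\<close> has index 2 only where \<phi> has odd index. Hence even
    indices over \<open>T\<close> are halved and all others carry over.\<close>
  have ram_\<psi>: "ram_index \<psi> p =
      (if P.im (C.im p) \<in> T \<and> even (P.ram (C.im p)) then P.ram (C.im p) div 2 else P.ram (C.im p))"
    if p: "point \<iota> p" for p
  proof -
    note v = C.lies_over_im(2)[OF p]
    have eE: "E.ram (image_point \<psi> p) = (if P.im (C.im p) \<in> T then 2 else 1)"
      using E.ram_eq[OF \<psi>_point(2)[OF p]] P.lies_over_im(2)[OF v] by (simp add: \<psi>_point(3)[OF p] T)
    have eC: "C.ram p = (if P.im (C.im p) \<in> T \<and> odd (P.ram (C.im p)) then 2 else 1)"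
      using C.ram_eq[OF p] BC[OF v] v by (simp add: B_def)
    show ?thesis using \<psi>_point(4)[OF p] unfolding eE eC by (auto split: if_splits)
  qed
  have ramified: "ramification_points \<iota> \<psi> = {p. point \<iota> p \<and> C.im p = v0}"
    if v0: "point const_P1 v0" "\<And>p. point \<iota> p \<Longrightarrow> C.im p = v0 \<Longrightarrow> ram_index \<psi> p > 1"
      and reg: "\<And>v. point const_P1 v \<Longrightarrow> v \<noteq> v0 \<Longrightarrow> P.ram v = 1 \<or> P.im v \<in> T \<and> P.ram v = 2" for v0
  proof -
    have "ram_index \<psi> p \<le> 1" if "point \<iota> p" "C.im p \<noteq> v0" for p
      using reg[OF C.lies_over_im(2)[OF that(1)] that(2)] by (auto simp: ram_\<psi>[OF that(1)])
    then show ?thesis using v0(2) by (force simp: ramification_points_def)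
  qed
  have conj: "image_point \<psi> (\<lambda>z. p (w z)) = (\<lambda>z. image_point \<psi> p (\<nu> z))" if p: "point \<iota> p" for p
  proof -
    have "lies_over \<psi> (\<lambda>z. p (w z)) (ram_index \<psi> p) (\<lambda>z. image_point \<psi> p (\<nu> z))"
      using \<psi>_point(1)[OF p] by (simp add: lies_over_def w\<psi>)
    then show ?thesis by (rule lies_over_point_unique(2)[OF E.point_w(1)[OF \<psi>_point(2)[OF p]]])
  qed
  have generic_cases: "(generic_covering \<iota> \<psi> \<longrightarrow> R \<in> type_I (int n) \<union> type_II (int n) \<union> type_III (int n)) \<and>
    (\<not> generic_covering \<iota> \<psi> \<longrightarrow>
       R \<in> degenerate_I (int n) \<union> degenerate_II (int n) \<union> degenerate_III (int n))"
  proof (cases rule: cases)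
    case (1 v0)
    have ev: "even (v0 (\<phi> fE))" using BC[OF 1(1)] 1(2) by (auto simp: B_def)
    obtain p where p: "fiber \<iota> \<pi>\<^sub>C v0 = {p, \<lambda>z. p (w z)}" "point \<iota> p" "C.im p = v0" "(\<lambda>z. p (w z)) \<noteq> p"
      using C.fiber_even[OF 1(1) ev] by metis
    have r: "ram_index \<psi> p' = 2" if "point \<iota> p'" "C.im p' = v0" for p'
      using ram_\<psi>[OF that(1)] that(2) 1(2,3) by simp
    have ramp: "ramification_points \<iota> \<psi> = {p, \<lambda>z. p (w z)}"
      using ramified[OF 1(1) _ 1(4)] r p(1) by (simp add: fiber_def)
    \<comment> \<open>The two ramification points are conjugate under \<open>w\<close>, so their
      images on \<open>E\<close> are negatives of each other; these differ because they do not lie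
      over \<open>T\<close>.\<close>
    have "E.im (image_point \<psi> p) \<notin> T" using \<psi>_point(3)[OF p(2)] p(3) 1(2) by simp
    then have "even (E.im (image_point \<psi> p) fE)"
      using E.lies_over_im(2)[OF \<psi>_point(2)[OF p(2)]] by (simp add: T)
    then have "image_point \<psi> (\<lambda>z. p (w z)) \<noteq> image_point \<psi> p"
      unfolding conj[OF p(2)] using E.even_point(2)[OF \<psi>_point(2)[OF p(2)]] by blast
    then have "generic_covering \<iota> \<psi>"
      unfolding generic_covering_def using ramp p r[OF p(2,3)] r[OF C.point_w(1)[OF p(2)]] C.point_w(2)[OF p(2)]
      by metis
    then show ?thesis using 1(5) by (simp add: R_def T_eq int_n)
  next
    case (2 v0)
    have "\<not> generic_covering \<iota> \<psi>"
    proof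
      \<comment> \<open>If \<phi> has index 3 at \<open>v0\<close>, so has \<psi> above it. If it
        has index 4, the two points above \<open>v0\<close> are conjugate, and their images on
        \<open>E\<close> coincide since over \<open>T\<close> each point is fixed by \<nu>.\<close>
      assume "generic_covering \<iota> \<psi>"
      then obtain P Q where PQ: "P \<noteq> Q" "ramification_points \<iota> \<psi> = {P, Q}"
        "ram_index \<psi> P = 2" "image_point \<psi> P \<noteq> image_point \<psi> Q"
        unfolding generic_covering_def by blast
      have r: "ram_index \<psi> p = (if P.ram v0 = 3 then 3 else 2)" if "point \<iota> p" "C.im p = v0" for p
        using ram_\<psi>[OF that(1)] that(2) 2(2,3) by auto
      have "ramification_points \<iota> \<psi> = {p. point \<iota> p \<and> C.im p = v0}"
        by (rule ramified[OF 2(1) _ 2(4)]) (use r in auto)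
      then have PQ0: "point \<iota> P" "C.im P = v0" "point \<iota> Q" "C.im Q = v0" using PQ(2) by auto
      then have "P.ram v0 = 4" using r[of P] PQ(3) 2(3) by auto
      then have "even (v0 (\<phi> fE))" using BC[OF 2(1)] by (auto simp: B_def)
      then have "Q = (\<lambda>z. P (w z))" using C.even_point(3)[OF PQ0(1) _ PQ0(3)] PQ0 PQ(1) by auto
      moreover have "(\<lambda>z. image_point \<psi> P (\<nu> z)) = image_point \<psi> P"
      proof -
        have "E.im (image_point \<psi> P) \<in> T" using \<psi>_point(3)[OF PQ0(1)] PQ0(2) 2(2) by simp
        then show ?thesis using E.w_point_eq_iff[OF \<psi>_point(2)[OF PQ0(1)]] by (simp add: T)
      qed
      ultimately show False using PQ(4) conj[OF PQ0(1)] by simp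
    qed
    then show ?thesis using 2(5) by (simp add: R_def T_eq int_n)
  qed
  moreover have "\<forall>S \<in> type_I (int n). collapses n S = degenerate_I (int n)"
    "\<forall>S \<in> type_II (int n). collapses n S = degenerate_II (int n)"
    "\<forall>S \<in> type_III (int n). collapses n S = degenerate_III (int n)"
    using collapses_type_I collapses_type_II collapses_type_III by (simp_all add: n)
  ultimately show ?thesis by blast
qed

end
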